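(* Let $K$ be a field, $\varphi$ a ring endomorphism of $K$, and $R=K[t;\varphi]$. Let $(F,v)$ and $(G,w)$ be two non-zero henselian divisible valued $R$-modules such that the torsion submodules $F_{tor}$ and $G_{tor}$ are elementarily equivalent as $L_{Mod}(R)$-structures and the value sets $v(F)$ and $w(G)$ are elementarily equivalent as $L_V$-structures. Then $(F,v)$ and $(G,w)$ are elementarily equivalent as $L$-structures.
   Context: $R=K[t;\varphi]$: elements are finite sums $\sum_i t^ia_i$ ($a_i\in K$), added termwise, multiplied using $at=t\varphi(a)$. Modules are right $R$-modules, action $x.r$; $M$ is divisible if $M.r=M$ for every non-zero $r$; $M_{tor}=\{x\in M:\ x.r=0$ for some non-zero $r\in R\}$. A polynomial $\sum_it^ia_i$ is separable if $a_0\neq 0$. A $\tau$-chain is a linear order $\Delta$ with maximum $\infty$ and a strictly increasing map $\tau:\Delta\to\Delta$ with $\tau(\infty)=\infty$ such that for all $\gamma\neq\infty$ and all $\delta$: if $\tau(\gamma)\le\gamma$ and $\delta<\gamma$ then $\tau(\delta)<\delta$. Put $\Delta_+=\{\gamma:\tau(\gamma)>\gamma\}\cup\{\infty\}$, $\Delta_-=\{\gamma:\tau(\gamma)<\gamma\}$; "$v(x)>\theta$" means $v(x)\in\Delta_+$ and "$v(x)<\theta$" means $v(x)\in\Delta_-$. A valued $R$-module $(M,v)$ is a right $R$-module $M$ with a surjection $v:M\to\Delta$ onto a $\tau$-chain such that $v(x)=\infty\iff x=0$, $v(x\pm y)\ge\min\{v(x),v(y)\}$, $x\mapsto x.t$ is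 injective, $v(x.\lambda)=v(x)$ for all $\lambda\in K^\times$, and $v(x.t)=\tau(v(x))$. It is henselian if for every separable $r\in R$ and every $x$ with $v(x)>\theta$ there is $y$ with $v(y)>\theta$ and $y.r=x$. $L$ is the two-sorted language with module sort language $L_{Mod}(R)=\{0,+,-,(\cdot r)_{r\in R}\}$, value-set sort language $L_V=\{<,\tau,\infty,(R_n)_{n\in\mathbb{N}}\}$ ($R_n$ unary predicates), and a function symbol $v$ from the module sort to the value sort. In a valued module $(M,v)$, the value set $v(M)$ is an $L_V$-structure where, for $\gamma\neq\infty$, $R_n(\gamma)$ holds iff $|M_{\ge\gamma}/M_{>\gamma}|\ge n$, with $M_{\ge\gamma}=\{x:v(x)\ge\gamma\}$, $M_{>\gamma}=\{x:v(x)>\gamma\}$. *)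

theory Defs
  imports "HOL-Algebra.UnivPoly"
begin

section \<open>Skew polynomial rings\<close>

text \<open>
  The element \<open>\<Sum>i. t^i a\<^sub>i\<close> (coefficients on the right) is represented by the finitely
  supported sequence \<open>i \<mapsto> a\<^sub>i\<close>. From \<open>a t = t \<phi>(a)\<close> one gets
  \<open>(t^i a) (t^j b) = t^(i+j) \<phi>^j(a) b\<close>, which is the source of the formula for the product.
\<close>

definition skew_poly :: "('k, 'x) ring_scheme \<Rightarrow> ('k \<Rightarrow> 'k) \<Rightarrow> (nat \<Rightarrow> 'k) ring" where
  "skew_poly K \<phi> = \<lparr>
     carrier = up K,
     mult = (\<lambda>p q n. \<Oplus>\<^bsub>K\<^esub>i\<in>{..n}. (\<phi> ^^ (n - i)) (p i) \<otimes>\<^bsub>K\<^esub> q (n - i)),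
     one = (\<lambda>n. if n = 0 then \<one>\<^bsub>K\<^esub> else \<zero>\<^bsub>K\<^esub>),
     zero = (\<lambda>n. \<zero>\<^bsub>K\<^esub>),
     add = (\<lambda>p q n. p n \<oplus>\<^bsub>K\<^esub> q n)\<rparr>"

definition skew_const :: "('k, 'x) ring_scheme \<Rightarrow> 'k \<Rightarrow> nat \<Rightarrow> 'k" where
  "skew_const K a = (\<lambda>n. if n = 0 then a else \<zero>\<^bsub>K\<^esub>)"

definition skew_t :: "('k, 'x) ring_scheme \<Rightarrow> nat \<Rightarrow> 'k" where
  "skew_t K = (\<lambda>n. if n = 1 then \<one>\<^bsub>K\<^esub> else \<zero>\<^bsub>K\<^esub>)"

definition separable :: "('k, 'x) ring_scheme \<Rightarrow> (nat \<Rightarrow> 'k) \<Rightarrow> bool" where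
  "separable K r \<longleftrightarrow> r 0 \<noteq> \<zero>\<^bsub>K\<^esub>"


section \<open>Right modules\<close>

text \<open>
  As for the library's modules, the record extends \<^typ>\<open>'m ring\<close> so that \<^const>\<open>abelian_group\<close>
  applies; its multiplicative fields are irrelevant. The term \<open>x \<cdot>\<^bsub>M\<^esub> r\<close> is the right action.
\<close>

record ('r, 'm) rmodule = "'m ring" +
  ract :: "'m \<Rightarrow> 'r \<Rightarrow> 'm" (infixl \<open>\<cdot>\<index>\<close> 70)

locale right_module = R?: ring R + M?: abelian_group M
  for R :: "('r, 'x) ring_scheme" (structure) and M :: "('r, 'm, 'y) rmodule_scheme" (structure) +
  assumes ract_closed:
      "\<lbrakk>x \<in> carrier M; r \<in> carrier R\<rbrakk> \<Longrightarrow> x \<cdot>\<^bsub>M\<^esub> r \<in> carrier M"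
    and ract_add_left:
      "\<lbrakk>x \<in> carrier M; y \<in> carrier M; r \<in> carrier R\<rbrakk>
        \<Longrightarrow> (x \<oplus>\<^bsub>M\<^esub> y) \<cdot>\<^bsub>M\<^esub> r = x \<cdot>\<^bsub>M\<^esub> r \<oplus>\<^bsub>M\<^esub> y \<cdot>\<^bsub>M\<^esub> r"
    and ract_add_right:
      "\<lbrakk>x \<in> carrier M; r \<in> carrier R; s \<in> carrier R\<rbrakk>
        \<Longrightarrow> x \<cdot>\<^bsub>M\<^esub> (r \<oplus>\<^bsub>R\<^esub> s) = x \<cdot>\<^bsub>M\<^esub> r \<oplus>\<^bsub>M\<^esub> x \<cdot>\<^bsub>M\<^esub> s"
    and ract_mult:
      "\<lbrakk>x \<in> carrier M; r \<in> carrier R; s \<in> carrier R\<rbrakk>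
        \<Longrightarrow> x \<cdot>\<^bsub>M\<^esub> (r \<otimes>\<^bsub>R\<^esub> s) = (x \<cdot>\<^bsub>M\<^esub> r) \<cdot>\<^bsub>M\<^esub> s"
    and ract_one:
      "x \<in> carrier M \<Longrightarrow> x \<cdot>\<^bsub>M\<^esub> \<one>\<^bsub>R\<^esub> = x"

definition divisible :: "('r, 'x) ring_scheme \<Rightarrow> ('r, 'm, 'y) rmodule_scheme \<Rightarrow> bool" where
  "divisible R M \<longleftrightarrow>
     (\<forall>r\<in>carrier R - {\<zero>\<^bsub>R\<^esub>}. (\<lambda>x. x \<cdot>\<^bsub>M\<^esub> r) ` carrier M = carrier M)"

definition torsion ::
  "('r, 'x) ring_scheme \<Rightarrow> ('r, 'm, 'y) rmodule_scheme \<Rightarrow> ('r, 'm, 'y) rmodule_scheme" where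
  "torsion R M =
     M\<lparr>carrier := {x \<in> carrier M. \<exists>r\<in>carrier R - {\<zero>\<^bsub>R\<^esub>}. x \<cdot>\<^bsub>M\<^esub> r = \<zero>\<^bsub>M\<^esub>}\<rparr>"


section \<open>Chains\<close>

record 'd chain = "'d partial_object" +
  le_rel :: "'d rel"
  tau :: "'d \<Rightarrow> 'd"
  infty :: 'd

definition chain_less :: "('d, 'x) chain_scheme \<Rightarrow> 'd \<Rightarrow> 'd \<Rightarrow> bool" where
  "chain_less \<Delta> \<gamma> \<delta> \<longleftrightarrow> (\<gamma>, \<delta>) \<in> le_rel \<Delta> \<and> \<gamma> \<noteq> \<delta>"

definition chain_min :: "('d, 'x) chain_scheme \<Rightarrow> 'd \<Rightarrow> 'd \<Rightarrow> 'd" where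
  "chain_min \<Delta> \<gamma> \<delta> = (if (\<gamma>, \<delta>) \<in> le_rel \<Delta> then \<gamma> else \<delta>)"

locale tau_chain =
  fixes \<Delta> :: "('d, 'x) chain_scheme"
  assumes linear_order: "linear_order_on (carrier \<Delta>) (le_rel \<Delta>)"
    and infty_closed: "infty \<Delta> \<in> carrier \<Delta>"
    and infty_max: "\<gamma> \<in> carrier \<Delta> \<Longrightarrow> (\<gamma>, infty \<Delta>) \<in> le_rel \<Delta>"
    and tau_closed: "\<gamma> \<in> carrier \<Delta> \<Longrightarrow> tau \<Delta> \<gamma> \<in> carrier \<Delta>"
    and tau_strict_mono:
      "\<lbrakk>\<gamma> \<in> carrier \<Delta>; \<delta> \<in> carrier \<Delta>; chain_less \<Delta> \<gamma> \<delta>\<rbrakk>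
        \<Longrightarrow> chain_less \<Delta> (tau \<Delta> \<gamma>) (tau \<Delta> \<delta>)"
    and tau_infty: "tau \<Delta> (infty \<Delta>) = infty \<Delta>"
    and tau_below:
      "\<lbrakk>\<gamma> \<in> carrier \<Delta>; \<gamma> \<noteq> infty \<Delta>; \<delta> \<in> carrier \<Delta>;
        (tau \<Delta> \<gamma>, \<gamma>) \<in> le_rel \<Delta>; chain_less \<Delta> \<delta> \<gamma>\<rbrakk>
        \<Longrightarrow> chain_less \<Delta> (tau \<Delta> \<delta>) \<delta>"

definition chain_pos :: "('d, 'x) chain_scheme \<Rightarrow> 'd set" where
  "chain_pos \<Delta> = {\<gamma> \<in> carrier \<Delta>. chain_less \<Delta> \<gamma> (tau \<Delta> \<gamma>)} \<union> {infty \<Delta>}"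


section \<open>Valued modules\<close>

locale valued_module =
  right_module "skew_poly K \<phi>" M + tau_chain \<Delta>
  for K :: "('k, 'x) ring_scheme" and \<phi> :: "'k \<Rightarrow> 'k"
    and M :: "(nat \<Rightarrow> 'k, 'm, 'y) rmodule_scheme" and \<Delta> :: "('d, 'z) chain_scheme" +
  fixes v :: "'m \<Rightarrow> 'd"
  assumes val_surj: "v ` carrier M = carrier \<Delta>"
    and val_infty: "x \<in> carrier M \<Longrightarrow> v x = infty \<Delta> \<longleftrightarrow> x = \<zero>\<^bsub>M\<^esub>"
    and val_add:
      "\<lbrakk>x \<in> carrier M; y \<in> carrier M\<rbrakk>
        \<Longrightarrow> (chain_min \<Delta> (v x) (v y), v (x \<oplus>\<^bsub>M\<^esub> y)) \<in> le_rel \<Delta>"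
    and val_diff:
      "\<lbrakk>x \<in> carrier M; y \<in> carrier M\<rbrakk>
        \<Longrightarrow> (chain_min \<Delta> (v x) (v y), v (x \<ominus>\<^bsub>M\<^esub> y)) \<in> le_rel \<Delta>"
    and t_inj: "inj_on (\<lambda>x. x \<cdot>\<^bsub>M\<^esub> skew_t K) (carrier M)"
    and val_const:
      "\<lbrakk>x \<in> carrier M; a \<in> carrier K; a \<noteq> \<zero>\<^bsub>K\<^esub>\<rbrakk> \<Longrightarrow> v (x \<cdot>\<^bsub>M\<^esub> skew_const K a) = v x"
    and val_t: "x \<in> carrier M \<Longrightarrow> v (x \<cdot>\<^bsub>M\<^esub> skew_t K) = tau \<Delta> (v x)"

locale henselian_valued_module = valued_module +
  assumes henselian:
    "\<lbrakk>r \<in> carrier (skew_poly K \<phi>); separable K r; x \<in> carrier M; v x \<in> chain_pos \<Delta>\<rbrakk>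
      \<Longrightarrow> \<exists>y\<in>carrier M. v y \<in> chain_pos \<Delta> \<and> y \<cdot>\<^bsub>M\<^esub> r = x"


section \<open>The language of modules\<close>

text \<open>
  A formula is over \<open>L\<^sub>M\<^sub>o\<^sub>d(R)\<close> when all its scalars lie in the carrier of \<open>R\<close>;
  this is required in the notion of sentence below.
\<close>

datatype (mterm_scalars: 'r) mterm =
    MVar nat
  | MZero
  | MPlus "'r mterm" "'r mterm"
  | MMinus "'r mterm"
  | MAct "'r mterm" 'r

primrec mterm_eval :: "('r, 'm, 'x) rmodule_scheme \<Rightarrow> (nat \<Rightarrow> 'm) \<Rightarrow> 'r mterm \<Rightarrow> 'm" where
  "mterm_eval M s (MVar i) = s i"
| "mterm_eval M s MZero = \<zero>\<^bsub>M\<^esub>"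
| "mterm_eval M s (MPlus a b) = mterm_eval M s a \<oplus>\<^bsub>M\<^esub> mterm_eval M s b"
| "mterm_eval M s (MMinus a) = \<ominus>\<^bsub>M\<^esub> mterm_eval M s a"
| "mterm_eval M s (MAct a r) = mterm_eval M s a \<cdot>\<^bsub>M\<^esub> r"

primrec mterm_vars :: "'r mterm \<Rightarrow> nat set" where
  "mterm_vars (MVar i) = {i}"
| "mterm_vars MZero = {}"
| "mterm_vars (MPlus a b) = mterm_vars a \<union> mterm_vars b"
| "mterm_vars (MMinus a) = mterm_vars a"
| "mterm_vars (MAct a r) = mterm_vars a"

datatype (mform_scalars: 'r) mform =
    MF_Eq "'r mterm" "'r mterm"
  | MF_Not "'r mform"
  | MF_And "'r mform" "'r mform"
  | MF_Ex nat "'r mform"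

primrec mform_sat :: "('r, 'm, 'x) rmodule_scheme \<Rightarrow> (nat \<Rightarrow> 'm) \<Rightarrow> 'r mform \<Rightarrow> bool" where
  "mform_sat M s (MF_Eq a b) \<longleftrightarrow> mterm_eval M s a = mterm_eval M s b"
| "mform_sat M s (MF_Not f) \<longleftrightarrow> \<not> mform_sat M s f"
| "mform_sat M s (MF_And f g) \<longleftrightarrow> mform_sat M s f \<and> mform_sat M s g"
| "mform_sat M s (MF_Ex i f) \<longleftrightarrow> (\<exists>x\<in>carrier M. mform_sat M (s(i := x)) f)"

primrec mform_free :: "'r mform \<Rightarrow> nat set" where
  "mform_free (MF_Eq a b) = mterm_vars a \<union> mterm_vars b"
| "mform_free (MF_Not f) = mform_free f"
| "mform_free (MF_And f g) = mform_free f \<union> mform_free g"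
| "mform_free (MF_Ex i f) = mform_free f - {i}"

definition mod_sentence :: "('r, 'x) ring_scheme \<Rightarrow> 'r mform \<Rightarrow> bool" where
  "mod_sentence R f \<longleftrightarrow> mform_free f = {} \<and> mform_scalars f \<subseteq> carrier R"

definition mod_models :: "('r, 'm, 'x) rmodule_scheme \<Rightarrow> 'r mform \<Rightarrow> bool" where
  "mod_models M f \<longleftrightarrow> (\<forall>s\<in>UNIV \<rightarrow> carrier M. mform_sat M s f)"

definition mod_elem_equiv ::
  "('r, 'x) ring_scheme \<Rightarrow> ('r, 'm, 'y) rmodule_scheme \<Rightarrow> ('r, 'n, 'z) rmodule_scheme \<Rightarrow> bool" where
  "mod_elem_equiv R M N \<longleftrightarrow> (\<forall>f. mod_sentence R f \<longrightarrow> (mod_models M f \<longleftrightarrow> mod_models N f))"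


section \<open>The language of value sets\<close>

record 'd val_struct = "'d chain" +
  res_pred :: "nat \<Rightarrow> 'd \<Rightarrow> bool"

datatype cterm =
    CVar nat
  | CInf
  | CTau cterm

primrec cterm_eval :: "('d, 'x) val_struct_scheme \<Rightarrow> (nat \<Rightarrow> 'd) \<Rightarrow> cterm \<Rightarrow> 'd" where
  "cterm_eval V s (CVar i) = s i"
| "cterm_eval V s CInf = infty V"
| "cterm_eval V s (CTau a) = tau V (cterm_eval V s a)"

primrec cterm_vars :: "cterm \<Rightarrow> nat set" where
  "cterm_vars (CVar i) = {i}"
| "cterm_vars CInf = {}"
| "cterm_vars (CTau a) = cterm_vars a"

datatype cform =
    CF_Eq cterm cterm
  | CF_Less cterm cterm
  | CF_R nat cterm
  | CF_Not cform
  | CF_And cform cform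
  | CF_Ex nat cform

primrec cform_sat :: "('d, 'x) val_struct_scheme \<Rightarrow> (nat \<Rightarrow> 'd) \<Rightarrow> cform \<Rightarrow> bool" where
  "cform_sat V s (CF_Eq a b) \<longleftrightarrow> cterm_eval V s a = cterm_eval V s b"
| "cform_sat V s (CF_Less a b) \<longleftrightarrow> chain_less V (cterm_eval V s a) (cterm_eval V s b)"
| "cform_sat V s (CF_R n a) \<longleftrightarrow> res_pred V n (cterm_eval V s a)"
| "cform_sat V s (CF_Not f) \<longleftrightarrow> \<not> cform_sat V s f"
| "cform_sat V s (CF_And f g) \<longleftrightarrow> cform_sat V s f \<and> cform_sat V s g"
| "cform_sat V s (CF_Ex i f) \<longleftrightarrow> (\<exists>\<gamma>\<in>carrier V. cform_sat V (s(i := \<gamma>)) f)"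

primrec cform_free :: "cform \<Rightarrow> nat set" where
  "cform_free (CF_Eq a b) = cterm_vars a \<union> cterm_vars b"
| "cform_free (CF_Less a b) = cterm_vars a \<union> cterm_vars b"
| "cform_free (CF_R n a) = cterm_vars a"
| "cform_free (CF_Not f) = cform_free f"
| "cform_free (CF_And f g) = cform_free f \<union> cform_free g"
| "cform_free (CF_Ex i f) = cform_free f - {i}"

definition val_models :: "('d, 'x) val_struct_scheme \<Rightarrow> cform \<Rightarrow> bool" where
  "val_models V f \<longleftrightarrow> (\<forall>s\<in>UNIV \<rightarrow> carrier V. cform_sat V s f)"

definition val_elem_equiv ::
  "('d, 'x) val_struct_scheme \<Rightarrow> ('e, 'y) val_struct_scheme \<Rightarrow> bool" where
  "val_elem_equiv V W \<longleftrightarrow> (\<forall>f. cform_free f = {} \<longrightarrow> (val_models V f \<longleftrightarrow> val_models W f))"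

definition val_ge ::
  "('r, 'm, 'x) rmodule_scheme \<Rightarrow> ('d, 'y) chain_scheme \<Rightarrow> ('m \<Rightarrow> 'd) \<Rightarrow> 'd \<Rightarrow> 'm set" where
  "val_ge M \<Delta> v \<gamma> = {x \<in> carrier M. (\<gamma>, v x) \<in> le_rel \<Delta>}"

definition val_gt ::
  "('r, 'm, 'x) rmodule_scheme \<Rightarrow> ('d, 'y) chain_scheme \<Rightarrow> ('m \<Rightarrow> 'd) \<Rightarrow> 'd \<Rightarrow> 'm set" where
  "val_gt M \<Delta> v \<gamma> = {x \<in> carrier M. chain_less \<Delta> \<gamma> (v x)}"

definition val_quot ::
  "('r, 'm, 'x) rmodule_scheme \<Rightarrow> ('d, 'y) chain_scheme \<Rightarrow> ('m \<Rightarrow> 'd) \<Rightarrow> 'd \<Rightarrow> 'm set monoid" where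
  "val_quot M \<Delta> v \<gamma> = (M\<lparr>carrier := val_ge M \<Delta> v \<gamma>\<rparr>) A_Mod (val_gt M \<Delta> v \<gamma>)"

text \<open>
  An infinite quotient satisfies every \<open>R\<^sub>n\<close>. At \<open>\<infinity>\<close>, where the quotient is not
  defined, all the predicates are taken to be false.
\<close>

definition value_set ::
  "('r, 'm, 'x) rmodule_scheme \<Rightarrow> ('d, 'y) chain_scheme \<Rightarrow> ('m \<Rightarrow> 'd) \<Rightarrow> 'd val_struct" where
  "value_set M \<Delta> v = \<lparr>
     carrier = carrier \<Delta>,
     le_rel = le_rel \<Delta>,
     tau = tau \<Delta>,
     infty = infty \<Delta>,
     res_pred = (\<lambda>n \<gamma>. \<gamma> \<noteq> infty \<Delta> \<and>
       (finite (carrier (val_quot M \<Delta> v \<gamma>)) \<longrightarrow> n \<le> card (carrier (val_quot M \<Delta> v \<gamma>))))\<rparr>"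


section \<open>The two-sorted language of valued modules\<close>

text \<open>
  The two sorts have separate variables, both indexed by natural numbers. Terms of the module
  sort are those of the language of modules.
\<close>

datatype (vterm_scalars: 'r) vterm =
    VVar nat
  | VInf
  | VTau "'r vterm"
  | VVal "'r mterm"

datatype (lform_scalars: 'r) lform =
    LF_MEq "'r mterm" "'r mterm"
  | LF_VEq "'r vterm" "'r vterm"
  | LF_Less "'r vterm" "'r vterm"
  | LF_R nat "'r vterm"
  | LF_Not "'r lform"
  | LF_And "'r lform" "'r lform"
  | LF_MEx nat "'r lform"
  | LF_VEx nat "'r lform"

record ('r, 'm, 'd) valued_struct =
  module_sort :: "('r, 'm) rmodule"
  value_sort :: "'d val_struct"
  valuation :: "'m \<Rightarrow> 'd"

primrec vterm_eval ::
  "('r, 'm, 'd) valued_struct \<Rightarrow> (nat \<Rightarrow> 'm) \<Rightarrow> (nat \<Rightarrow> 'd) \<Rightarrow> 'r vterm \<Rightarrow> 'd" where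
  "vterm_eval S s u (VVar i) = u i"
| "vterm_eval S s u VInf = infty (value_sort S)"
| "vterm_eval S s u (VTau a) = tau (value_sort S) (vterm_eval S s u a)"
| "vterm_eval S s u (VVal a) = valuation S (mterm_eval (module_sort S) s a)"

primrec vterm_mvars :: "'r vterm \<Rightarrow> nat set" where
  "vterm_mvars (VVar i) = {}"
| "vterm_mvars VInf = {}"
| "vterm_mvars (VTau a) = vterm_mvars a"
| "vterm_mvars (VVal a) = mterm_vars a"

primrec vterm_vvars :: "'r vterm \<Rightarrow> nat set" where
  "vterm_vvars (VVar i) = {i}"
| "vterm_vvars VInf = {}"
| "vterm_vvars (VTau a) = vterm_vvars a"
| "vterm_vvars (VVal a) = {}"

primrec lform_sat ::
  "('r, 'm, 'd) valued_struct \<Rightarrow> (nat \<Rightarrow> 'm) \<Rightarrow> (nat \<Rightarrow> 'd) \<Rightarrow> 'r lform \<Rightarrow> bool" where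
  "lform_sat S s u (LF_MEq a b) \<longleftrightarrow>
     mterm_eval (module_sort S) s a = mterm_eval (module_sort S) s b"
| "lform_sat S s u (LF_VEq a b) \<longleftrightarrow> vterm_eval S s u a = vterm_eval S s u b"
| "lform_sat S s u (LF_Less a b) \<longleftrightarrow>
     chain_less (value_sort S) (vterm_eval S s u a) (vterm_eval S s u b)"
| "lform_sat S s u (LF_R n a) \<longleftrightarrow> res_pred (value_sort S) n (vterm_eval S s u a)"
| "lform_sat S s u (LF_Not f) \<longleftrightarrow> \<not> lform_sat S s u f"
| "lform_sat S s u (LF_And f g) \<longleftrightarrow> lform_sat S s u f \<and> lform_sat S s u g"
| "lform_sat S s u (LF_MEx i f) \<longleftrightarrow> (\<exists>x\<in>carrier (module_sort S). lform_sat S (s(i := x)) u f)"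
| "lform_sat S s u (LF_VEx i f) \<longleftrightarrow> (\<exists>\<gamma>\<in>carrier (value_sort S). lform_sat S s (u(i := \<gamma>)) f)"

primrec lform_mfree :: "'r lform \<Rightarrow> nat set" where
  "lform_mfree (LF_MEq a b) = mterm_vars a \<union> mterm_vars b"
| "lform_mfree (LF_VEq a b) = vterm_mvars a \<union> vterm_mvars b"
| "lform_mfree (LF_Less a b) = vterm_mvars a \<union> vterm_mvars b"
| "lform_mfree (LF_R n a) = vterm_mvars a"
| "lform_mfree (LF_Not f) = lform_mfree f"
| "lform_mfree (LF_And f g) = lform_mfree f \<union> lform_mfree g"
| "lform_mfree (LF_MEx i f) = lform_mfree f - {i}"
| "lform_mfree (LF_VEx i f) = lform_mfree f"

primrec lform_vfree :: "'r lform \<Rightarrow> nat set" where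
  "lform_vfree (LF_MEq a b) = {}"
| "lform_vfree (LF_VEq a b) = vterm_vvars a \<union> vterm_vvars b"
| "lform_vfree (LF_Less a b) = vterm_vvars a \<union> vterm_vvars b"
| "lform_vfree (LF_R n a) = vterm_vvars a"
| "lform_vfree (LF_Not f) = lform_vfree f"
| "lform_vfree (LF_And f g) = lform_vfree f \<union> lform_vfree g"
| "lform_vfree (LF_MEx i f) = lform_vfree f"
| "lform_vfree (LF_VEx i f) = lform_vfree f - {i}"

definition l_sentence :: "('r, 'x) ring_scheme \<Rightarrow> 'r lform \<Rightarrow> bool" where
  "l_sentence R f \<longleftrightarrow>
     lform_mfree f = {} \<and> lform_vfree f = {} \<and> lform_scalars f \<subseteq> carrier R"

definition l_models :: "('r, 'm, 'd) valued_struct \<Rightarrow> 'r lform \<Rightarrow> bool" where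
  "l_models S f \<longleftrightarrow>
     (\<forall>s\<in>UNIV \<rightarrow> carrier (module_sort S). \<forall>u\<in>UNIV \<rightarrow> carrier (value_sort S). lform_sat S s u f)"

definition l_elem_equiv ::
  "('r, 'x) ring_scheme \<Rightarrow> ('r, 'm, 'd) valued_struct \<Rightarrow> ('r, 'n, 'e) valued_struct \<Rightarrow> bool" where
  "l_elem_equiv R S T \<longleftrightarrow> (\<forall>f. l_sentence R f \<longrightarrow> (l_models S f \<longleftrightarrow> l_models T f))"

definition l_structure ::
  "('r, 'm) rmodule \<Rightarrow> 'd chain \<Rightarrow> ('m \<Rightarrow> 'd) \<Rightarrow> ('r, 'm, 'd) valued_struct" where
  "l_structure M \<Delta> v = \<lparr>module_sort = M, value_sort = value_set M \<Delta> v, valuation = v\<rparr>"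


section \<open>Skew polynomials form a ring\<close>

lemma (in abelian_monoid) finsum_triangle:
  assumes "\<And>i j. g i j \<in> carrier G"
  shows "(\<Oplus>j\<in>{..n::nat}. \<Oplus>i\<in>{..j}. g i (j - i)) = (\<Oplus>i\<in>{..n}. \<Oplus>j\<in>{..n - i}. g i j)"
proof (induction n)
  case 0
  then show ?case using assms by simp
next
  case (Suc n)
  have "(\<Oplus>i\<in>{..n}. \<Oplus>j\<in>{..Suc n - i}. g i j)
      = (\<Oplus>i\<in>{..n}. (\<Oplus>j\<in>{..n - i}. g i j) \<oplus> g i (Suc n - i))"
    by (rule finsum_cong') (auto simp: assms Suc_diff_le a_comm)
  also have "\<dots> = (\<Oplus>i\<in>{..n}. \<Oplus>j\<in>{..n - i}. g i j) \<oplus> (\<Oplus>i\<in>{..n}. g i (Suc n - i))"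
    by (rule finsum_addf) (auto simp: assms)
  finally have *: "(\<Oplus>i\<in>{..n}. \<Oplus>j\<in>{..Suc n - i}. g i j)
      = (\<Oplus>i\<in>{..n}. \<Oplus>j\<in>{..n - i}. g i j) \<oplus> (\<Oplus>i\<in>{..n}. g i (Suc n - i))" .
  show ?case using assms by (simp add: * Suc.IH a_ac Pi_def)
qed

lemma skew_poly_ring:
  assumes K: "cring K" and \<phi>: "\<phi> \<in> ring_hom K K"
  shows "ring (skew_poly K \<phi>)"
proof -
  interpret K: cring K by fact
  have pow: "(\<phi> ^^ n) \<in> ring_hom K K" for n
  proof (induction n)
    case 0 then show ?case by (simp add: ring_hom_def)
  next
    case (Suc n) then show ?case using \<phi> by (auto simp: ring_hom_def Pi_def)
  qed
  have pcl[simp]: "(\<phi> ^^ n) a \<in> carrier K" if "a \<in> carrier K" for n a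
    using ring_hom_closed[OF pow that] .
  have ppow: "(\<phi> ^^ m) ((\<phi> ^^ n) a) = (\<phi> ^^ (m + n)) a" for m n a
    by (simp add: funpow_add)
  have pz[simp]: "(\<phi> ^^ n) \<zero>\<^bsub>K\<^esub> = \<zero>\<^bsub>K\<^esub>" for n
    by (rule ring_hom_zero[OF pow K.ring_axioms K.ring_axioms])
  have psum: "(\<phi> ^^ m) (\<Oplus>\<^bsub>K\<^esub>i\<in>{..n::nat}. f i) = (\<Oplus>\<^bsub>K\<^esub>i\<in>{..n}. (\<phi> ^^ m) (f i))"
    if "\<And>i. f i \<in> carrier K" for m n f
    using that by (induction n) (auto simp: Pi_def ring_hom_add[OF pow])
  have c: "p n \<in> carrier K" if "p \<in> up K" for p n using that by auto
  have mcl: "(\<lambda>n. \<Oplus>\<^bsub>K\<^esub>i\<in>{..n}. (\<phi> ^^ (n - i)) (p i) \<otimes>\<^bsub>K\<^esub> q (n - i)) \<in> up K"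
    if pq: "p \<in> up K" "q \<in> up K" for p q
  proof
    fix n show "(\<Oplus>\<^bsub>K\<^esub>i\<in>{..n}. (\<phi> ^^ (n - i)) (p i) \<otimes>\<^bsub>K\<^esub> q (n - i)) \<in> carrier K"
      using c pq by (auto intro!: K.finsum_closed)
  next
    from pq obtain n m where b: "bound \<zero>\<^bsub>K\<^esub> n p" "bound \<zero>\<^bsub>K\<^esub> m q" by blast
    have "(\<Oplus>\<^bsub>K\<^esub>i\<in>{..k}. (\<phi> ^^ (k - i)) (p i) \<otimes>\<^bsub>K\<^esub> q (k - i)) = \<zero>\<^bsub>K\<^esub>" if k: "n + m < k" for k
    proof -
      have "(\<phi> ^^ (k - i)) (p i) \<otimes>\<^bsub>K\<^esub> q (k - i) = \<zero>\<^bsub>K\<^esub>" for i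
      proof (cases "n < i")
        case True
        then show ?thesis using b c pq by (simp add: bound.bound)
      next
        case False
        then have "m < k - i" using k by arith
        then show ?thesis using b c pq by (simp add: bound.bound)
      qed
      then show ?thesis by simp
    qed
    then show "\<exists>k. bound \<zero>\<^bsub>K\<^esub> k (\<lambda>n. \<Oplus>\<^bsub>K\<^esub>i\<in>{..n}. (\<phi> ^^ (n - i)) (p i) \<otimes>\<^bsub>K\<^esub> q (n - i))"
      by blast
  qed
  have car: "carrier (skew_poly K \<phi>) = up K" by (simp add: skew_poly_def)
  show ?thesis
  proof (rule ringI)
    show "abelian_group (skew_poly K \<phi>)"
    proof (rule abelian_groupI, simp_all add: skew_poly_def)
      show "(\<lambda>n. \<zero>\<^bsub>K\<^esub>) \<in> up K" by auto
    qed (auto simp: fun_eq_iff c K.a_ac K.r_neg K.up_add_closed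
        intro!: bexI[OF _ K.up_a_inv_closed])
    show "monoid (skew_poly K \<phi>)"
    proof (rule monoidI, simp_all only: car)
      show "p \<otimes>\<^bsub>skew_poly K \<phi>\<^esub> q \<in> up K" if "p \<in> up K" "q \<in> up K" for p q
        using mcl[OF that] by (simp add: skew_poly_def)
      show "\<one>\<^bsub>skew_poly K \<phi>\<^esub> \<in> up K"
        using K.up_one_closed by (simp add: skew_poly_def)
    next
      fix p q r assume pqr: "p \<in> up K" "q \<in> up K" "r \<in> up K"
      note cs = c[OF pqr(1)] c[OF pqr(2)] c[OF pqr(3)]
      have "(\<lambda>n. \<Oplus>\<^bsub>K\<^esub>i\<in>{..n}. (\<phi> ^^ (n - i))
              (\<Oplus>\<^bsub>K\<^esub>j\<in>{..i}. (\<phi> ^^ (i - j)) (p j) \<otimes>\<^bsub>K\<^esub> q (i - j)) \<otimes>\<^bsub>K\<^esub> r (n - i))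
          = (\<lambda>n. \<Oplus>\<^bsub>K\<^esub>i\<in>{..n}. (\<phi> ^^ (n - i)) (p i) \<otimes>\<^bsub>K\<^esub>
              (\<Oplus>\<^bsub>K\<^esub>j\<in>{..n - i}. (\<phi> ^^ (n - i - j)) (q j) \<otimes>\<^bsub>K\<^esub> r (n - i - j)))" (is "?L = ?R")
      proof
        fix n
        let ?g = "\<lambda>j m. (\<phi> ^^ (n - j)) (p j) \<otimes>\<^bsub>K\<^esub> ((\<phi> ^^ (n - j - m)) (q m) \<otimes>\<^bsub>K\<^esub> r (n - j - m))"
        have "?L n = (\<Oplus>\<^bsub>K\<^esub>i\<in>{..n}. \<Oplus>\<^bsub>K\<^esub>j\<in>{..i}. ?g j (i - j))"
        proof (rule K.finsum_cong')
          fix i assume i: "i \<in> {..n}"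
          have "(\<phi> ^^ (n - i)) (\<Oplus>\<^bsub>K\<^esub>j\<in>{..i}. (\<phi> ^^ (i - j)) (p j) \<otimes>\<^bsub>K\<^esub> q (i - j)) \<otimes>\<^bsub>K\<^esub> r (n - i)
            = (\<Oplus>\<^bsub>K\<^esub>j\<in>{..i}. (\<phi> ^^ (n - i)) ((\<phi> ^^ (i - j)) (p j) \<otimes>\<^bsub>K\<^esub> q (i - j)) \<otimes>\<^bsub>K\<^esub> r (n - i))"
            using cs by (subst psum) (auto intro!: K.finsum_ldistr)
          also have "\<dots> = (\<Oplus>\<^bsub>K\<^esub>j\<in>{..i}. ?g j (i - j))"
            using i cs
            by (intro K.finsum_cong') (auto simp: ring_hom_mult[OF pow] ppow K.m_assoc)
          finally show "(\<phi> ^^ (n - i)) (\<Oplus>\<^bsub>K\<^esub>j\<in>{..i}. (\<phi> ^^ (i - j)) (p j) \<otimes>\<^bsub>K\<^esub> q (i - j)) \<otimes>\<^bsub>K\<^esub> r (n - i)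
            = (\<Oplus>\<^bsub>K\<^esub>j\<in>{..i}. ?g j (i - j))" .
        qed (use cs in \<open>auto intro!: K.finsum_closed\<close>)
        also have "\<dots> = (\<Oplus>\<^bsub>K\<^esub>i\<in>{..n}. \<Oplus>\<^bsub>K\<^esub>j\<in>{..n - i}. ?g i j)"
          by (rule K.finsum_triangle) (use cs in auto)
        also have "\<dots> = ?R n"
          using cs by (intro K.finsum_cong') (auto intro!: K.finsum_rdistr[symmetric] K.finsum_closed)
        finally show "?L n = ?R n" .
      qed
      then show "p \<otimes>\<^bsub>skew_poly K \<phi>\<^esub> q \<otimes>\<^bsub>skew_poly K \<phi>\<^esub> r
          = p \<otimes>\<^bsub>skew_poly K \<phi>\<^esub> (q \<otimes>\<^bsub>skew_poly K \<phi>\<^esub> r)"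
        by (simp add: skew_poly_def)
    next
      fix p assume p: "p \<in> up K"
      note cp = c[OF p]
      have p1: "(\<phi> ^^ n) \<one>\<^bsub>K\<^esub> = \<one>\<^bsub>K\<^esub>" for n by (rule ring_hom_one[OF pow])
      have "(\<lambda>n. \<Oplus>\<^bsub>K\<^esub>i\<in>{..n}. (\<phi> ^^ (n - i)) (if i = 0 then \<one>\<^bsub>K\<^esub> else \<zero>\<^bsub>K\<^esub>) \<otimes>\<^bsub>K\<^esub> p (n - i)) = p"
      proof
        fix n
        have "(\<Oplus>\<^bsub>K\<^esub>i\<in>{..n}. (\<phi> ^^ (n - i)) (if i = 0 then \<one>\<^bsub>K\<^esub> else \<zero>\<^bsub>K\<^esub>) \<otimes>\<^bsub>K\<^esub> p (n - i))
          = (\<Oplus>\<^bsub>K\<^esub>i\<in>{..n}. if 0 = i then p (n - i) else \<zero>\<^bsub>K\<^esub>)"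
          by (rule K.finsum_cong') (auto simp: p1 cp)
        also have "\<dots> = p n"
          using K.finsum_singleton[of 0 "{..n}" "\<lambda>i. p (n - i)"] cp by auto
        finally show "(\<Oplus>\<^bsub>K\<^esub>i\<in>{..n}. (\<phi> ^^ (n - i)) (if i = 0 then \<one>\<^bsub>K\<^esub> else \<zero>\<^bsub>K\<^esub>) \<otimes>\<^bsub>K\<^esub> p (n - i)) = p n" .
      qed
      then show "\<one>\<^bsub>skew_poly K \<phi>\<^esub> \<otimes>\<^bsub>skew_poly K \<phi>\<^esub> p = p"
        by (simp add: skew_poly_def)
      have "(\<lambda>n. \<Oplus>\<^bsub>K\<^esub>i\<in>{..n}. (\<phi> ^^ (n - i)) (p i) \<otimes>\<^bsub>K\<^esub> (if n \<le> i then \<one>\<^bsub>K\<^esub> else \<zero>\<^bsub>K\<^esub>)) = p"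
      proof
        fix n
        have "(\<Oplus>\<^bsub>K\<^esub>i\<in>{..n}. (\<phi> ^^ (n - i)) (p i) \<otimes>\<^bsub>K\<^esub> (if n \<le> i then \<one>\<^bsub>K\<^esub> else \<zero>\<^bsub>K\<^esub>))
          = (\<Oplus>\<^bsub>K\<^esub>i\<in>{..n}. if n = i then p i else \<zero>\<^bsub>K\<^esub>)"
          by (rule K.finsum_cong') (auto simp: cp)
        also have "\<dots> = p n"
          using K.finsum_singleton[of n "{..n}" p] cp by auto
        finally show "(\<Oplus>\<^bsub>K\<^esub>i\<in>{..n}. (\<phi> ^^ (n - i)) (p i) \<otimes>\<^bsub>K\<^esub> (if n \<le> i then \<one>\<^bsub>K\<^esub> else \<zero>\<^bsub>K\<^esub>)) = p n" .
      qed
      then show "p \<otimes>\<^bsub>skew_poly K \<phi>\<^esub> \<one>\<^bsub>skew_poly K \<phi>\<^esub> = p"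
        by (simp add: skew_poly_def)
    qed
  next
    fix p q r assume "p \<in> carrier (skew_poly K \<phi>)" "q \<in> carrier (skew_poly K \<phi>)" "r \<in> carrier (skew_poly K \<phi>)"
    then have u: "p \<in> up K" "q \<in> up K" "r \<in> up K" by (simp_all add: skew_poly_def)
    note cs = c[OF u(1)] c[OF u(2)] c[OF u(3)]
    show "(p \<oplus>\<^bsub>skew_poly K \<phi>\<^esub> q) \<otimes>\<^bsub>skew_poly K \<phi>\<^esub> r
        = p \<otimes>\<^bsub>skew_poly K \<phi>\<^esub> r \<oplus>\<^bsub>skew_poly K \<phi>\<^esub> q \<otimes>\<^bsub>skew_poly K \<phi>\<^esub> r"
      using cs by (auto simp: skew_poly_def ring_hom_add[OF pow] K.l_distr Pi_def
          intro!: ext K.finsum_addf)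
    show "r \<otimes>\<^bsub>skew_poly K \<phi>\<^esub> (p \<oplus>\<^bsub>skew_poly K \<phi>\<^esub> q)
        = r \<otimes>\<^bsub>skew_poly K \<phi>\<^esub> p \<oplus>\<^bsub>skew_poly K \<phi>\<^esub> r \<otimes>\<^bsub>skew_poly K \<phi>\<^esub> q"
      using cs by (auto simp: skew_poly_def K.r_distr Pi_def intro!: ext K.finsum_addf)
  qed
qed

lemma skew_poly_commutation:
  assumes K: "cring K" and \<phi>: "\<phi> \<in> ring_hom K K" and a: "a \<in> carrier K"
  shows "skew_const K a \<otimes>\<^bsub>skew_poly K \<phi>\<^esub> skew_t K
       = skew_t K \<otimes>\<^bsub>skew_poly K \<phi>\<^esub> skew_const K (\<phi> a)"
proof
  interpret K: cring K by fact
  fix n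
  have z: "\<phi> \<zero>\<^bsub>K\<^esub> = \<zero>\<^bsub>K\<^esub>" by (rule ring_hom_zero[OF \<phi> K.ring_axioms K.ring_axioms])
  have z': "(\<phi> ^^ n) \<zero>\<^bsub>K\<^esub> = \<zero>\<^bsub>K\<^esub>" for n by (induction n) (auto simp: z)
  have o: "(\<phi> ^^ n) \<one>\<^bsub>K\<^esub> = \<one>\<^bsub>K\<^esub>" for n by (induction n) (auto simp: ring_hom_one[OF \<phi>])
  have pa: "\<phi> a \<in> carrier K" using ring_hom_closed[OF \<phi> a] .
  have p: "(\<phi> ^^ n) a \<in> carrier K" for n
    by (induction n) (auto simp: a ring_hom_closed[OF \<phi>])
  have "(\<Oplus>\<^bsub>K\<^esub>i\<in>{..n}. (\<phi> ^^ (n - i)) (skew_const K a i) \<otimes>\<^bsub>K\<^esub> skew_t K (n - i))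
     = (\<Oplus>\<^bsub>K\<^esub>i\<in>{..n}. if 0 = i then if n = 1 then \<phi> a else \<zero>\<^bsub>K\<^esub> else \<zero>\<^bsub>K\<^esub>)"
    by (rule K.finsum_cong') (auto simp: skew_const_def skew_t_def z' p pa)
  also have "\<dots> = (if n = 1 then \<phi> a else \<zero>\<^bsub>K\<^esub>)"
    using K.finsum_singleton[of 0 "{..n}" "\<lambda>i. if n = 1 then \<phi> a else \<zero>\<^bsub>K\<^esub>"] pa by auto
  also have "\<dots> = (\<Oplus>\<^bsub>K\<^esub>i\<in>{..n}. if n = i then if n = 1 then \<phi> a else \<zero>\<^bsub>K\<^esub> else \<zero>\<^bsub>K\<^esub>)"
    using K.finsum_singleton[of n "{..n}" "\<lambda>i. if n = 1 then \<phi> a else \<zero>\<^bsub>K\<^esub>"] pa by auto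
  also have "\<dots> = (\<Oplus>\<^bsub>K\<^esub>i\<in>{..n}. (\<phi> ^^ (n - i)) (skew_t K i) \<otimes>\<^bsub>K\<^esub> skew_const K (\<phi> a) (n - i))"
    by (rule K.finsum_cong') (auto simp: skew_const_def skew_t_def z' o pa)
  finally show "(skew_const K a \<otimes>\<^bsub>skew_poly K \<phi>\<^esub> skew_t K) n
       = (skew_t K \<otimes>\<^bsub>skew_poly K \<phi>\<^esub> skew_const K (\<phi> a)) n"
    by (simp add: skew_poly_def)
qed

end

theory Submission
  imports Defs "HOL-Library.Nat_Bijection"
begin

text \<open>
  Formulas over \<open>L\<close> are determined by formulas over \<open>L\<^sub>V\<close> in the values of finitely many module
  terms: such a dependence survives a quantifier over the module. Indeed, the possible values of
  finitely many terms \<open>x r\<^sub>j + e\<^sub>j\<close> in one variable \<open>x\<close> depend only on finitely many comparisons.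
  Writing \<open>e\<^sub>j = - c\<^sub>j r\<^sub>j\<close> by divisibility, the term is \<open>(x - c\<^sub>j) r\<^sub>j\<close>, whose value is determined by
  \<open>v(x - c\<^sub>j)\<close> unless the latter is the fixed point \<open>\<theta>\<close> of \<open>\<tau>\<close>. Away from \<open>\<theta>\<close> only the ultrametric
  inequality and the sizes of the residue groups matter, and the mutual distances of the \<open>c\<^sub>j\<close> are
  read off a common right multiple of the \<open>r\<^sub>j\<close>. At \<open>\<theta>\<close> one has to satisfy finitely many equations
  and inequations in the divisible module of elements of value \<open>\<ge> \<theta>\<close> modulo those of value \<open>> \<theta>\<close>,
  whose torsion is \<open>F\<^sub>t\<^sub>o\<^sub>r\<close> by henselianity; as in the Baur--Monk theorem, their solvability depends
  only on the indices of annihilators, by Neumann's lemma and a count of cosets.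
\<close>

section \<open>Skew polynomials\<close>

text \<open>The obstacle is that a root c_j is determined only up to the annihilator of r_j, whose
  non-zero elements have value \<theta>. A distance of roots below \<theta> does not depend on their
  choice, but above \<theta> it does: from v(y) = \<theta> nothing follows about v(y r_j) except
  that it is at least \<theta>. Hence values are realised in two rounds. The first finds a class
  modulo the elements of value > \<theta> that satisfies the required equations and inequations.
  Only then are roots chosen, inside this class; there they are unique because the action above
  \<theta> is injective, and \<open>x\<close> is adjusted within the class.

  Neither structure is assumed to be saturated, so all comparisons must be finite. Instead of an
  equivalent formula one keeps track of finitely many formulas over the value set on which the two
  structures have to agree. A quantifier over the module becomes a block of quantifiers over values:
  those of the k terms x r_j + e_j, their preimages under the maps that the r_j induce on values,
  and the normalised distances of the roots. For k terms only the predicates R_n with n \<le> k + 1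
  occur, because k centres occupy at most k residue classes and one free class is wanted.\<close>

lemma (in abelian_monoid) finsum_single:
  assumes "finite A" "j \<in> A" "f \<in> A \<rightarrow> carrier G" "\<And>i. i \<in> A \<Longrightarrow> i \<noteq> j \<Longrightarrow> f i = \<zero>"
  shows "finsum G f A = f j"
proof -
  have "finsum G f A = (\<Oplus>i\<in>A. if j = i then f i else \<zero>)"
    using assms by (intro finsum_cong') auto
  then show ?thesis using finsum_singleton[of j A f] assms by auto
qed

lemma (in abelian_group) diff_add_cancel:
  assumes "x \<in> carrier G" "y \<in> carrier G" shows "x \<ominus> y \<oplus> y = x"
  using assms by (simp add: minus_eq a_assoc l_neg)

lemma (in abelian_group) add_diff_cancel:
  assumes "x \<in> carrier G" "y \<in> carrier G" shows "x \<oplus> y \<ominus> x = y"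
  using assms by (simp add: minus_eq a_assoc a_comm[of x y] r_neg)

locale skew_field = K: field K for K :: "('k, 'x) ring_scheme" +
  fixes \<phi> :: "'k \<Rightarrow> 'k"
  assumes hom: "\<phi> \<in> ring_hom K K"
begin

abbreviation R where "R \<equiv> skew_poly K \<phi>"

sublocale R: ring R
  by (rule skew_poly_ring[OF K.cring_axioms hom])

lemma pow_hom: "\<phi> ^^ n \<in> ring_hom K K"
proof (induction n)
  case 0 then show ?case by (simp add: ring_hom_def)
next
  case (Suc n) then show ?case using hom by (auto simp: ring_hom_def Pi_def)
qed

lemma pow_closed[simp]: "a \<in> carrier K \<Longrightarrow> (\<phi> ^^ n) a \<in> carrier K"
  using ring_hom_closed[OF pow_hom] .

lemma pow_zero[simp]: "(\<phi> ^^ n) \<zero>\<^bsub>K\<^esub> = \<zero>\<^bsub>K\<^esub>"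
  by (rule ring_hom_zero[OF pow_hom K.ring_axioms K.ring_axioms])

lemma pow_one[simp]: "(\<phi> ^^ n) \<one>\<^bsub>K\<^esub> = \<one>\<^bsub>K\<^esub>"
  by (rule ring_hom_one[OF pow_hom])

lemma pow_nonzero: "a \<in> carrier K \<Longrightarrow> a \<noteq> \<zero>\<^bsub>K\<^esub> \<Longrightarrow> (\<phi> ^^ n) a \<noteq> \<zero>\<^bsub>K\<^esub>"
proof
  assume a: "a \<in> carrier K" "a \<noteq> \<zero>\<^bsub>K\<^esub>" "(\<phi> ^^ n) a = \<zero>\<^bsub>K\<^esub>"
  then have "(\<phi> ^^ n) (a \<otimes>\<^bsub>K\<^esub> inv\<^bsub>K\<^esub> a) = \<zero>\<^bsub>K\<^esub>"
    using K.field_Units by (subst ring_hom_mult[OF pow_hom]) auto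
  moreover have "a \<otimes>\<^bsub>K\<^esub> inv\<^bsub>K\<^esub> a = \<one>\<^bsub>K\<^esub>"
    using a K.field_Units by auto
  ultimately show False by simp
qed

lemma carrier_R: "carrier R = up K" by (simp add: skew_poly_def)

lemma coeff_closed[simp]: "p \<in> carrier R \<Longrightarrow> p n \<in> carrier K"
  by (auto simp: carrier_R)

lemma coeff_zero[simp]: "\<zero>\<^bsub>R\<^esub> n = \<zero>\<^bsub>K\<^esub>" by (simp add: skew_poly_def)

lemma coeff_add[simp]: "(p \<oplus>\<^bsub>R\<^esub> q) n = p n \<oplus>\<^bsub>K\<^esub> q n" by (simp add: skew_poly_def)

lemma coeff_minus[simp]:
  assumes p: "p \<in> carrier R" shows "(\<ominus>\<^bsub>R\<^esub> p) n = \<ominus>\<^bsub>K\<^esub> p n"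
proof -
  have "p n \<oplus>\<^bsub>K\<^esub> (\<ominus>\<^bsub>R\<^esub> p) n = \<zero>\<^bsub>K\<^esub>"
    using R.r_neg[OF p] by (metis coeff_add coeff_zero)
  then show ?thesis using p by (metis K.minus_equality K.a_comm R.a_inv_closed coeff_closed)
qed

lemma coeff_diff[simp]:
  "p \<in> carrier R \<Longrightarrow> q \<in> carrier R \<Longrightarrow> (p \<ominus>\<^bsub>R\<^esub> q) n = p n \<ominus>\<^bsub>K\<^esub> q n"
  by (simp add: a_minus_def)

lemma coeff_mult:
  "(p \<otimes>\<^bsub>R\<^esub> q) n = (\<Oplus>\<^bsub>K\<^esub>i\<in>{..n}. (\<phi> ^^ (n - i)) (p i) \<otimes>\<^bsub>K\<^esub> q (n - i))"
  by (simp add: skew_poly_def)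

lemma R_I: "(\<And>n. p n \<in> carrier K) \<Longrightarrow> (\<And>i. i \<ge> N \<Longrightarrow> p i = \<zero>\<^bsub>K\<^esub>) \<Longrightarrow> p \<in> carrier R"
  unfolding carrier_R by (intro mem_upI exI[of _ N]) (auto simp: bound_def)

lemma R_bound: assumes "p \<in> carrier R" obtains N where "\<And>i. i \<ge> N \<Longrightarrow> p i = \<zero>\<^bsub>K\<^esub>"
proof -
  obtain n where "bound \<zero>\<^bsub>K\<^esub> n p" using assms K.bound_upD unfolding carrier_R by blast
  then show ?thesis using that[of "Suc n"] by (auto simp: bound_def)
qed

definition skew_monom :: "nat \<Rightarrow> 'k \<Rightarrow> nat \<Rightarrow> 'k" where
  "skew_monom k a = (\<lambda>n. if n = k then a else \<zero>\<^bsub>K\<^esub>)"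

lemma monom_closed[simp]: "a \<in> carrier K \<Longrightarrow> skew_monom k a \<in> carrier R"
  by (rule R_I[of _ "Suc k"]) (auto simp: skew_monom_def)

lemma const_eq_monom: "skew_const K a = skew_monom 0 a"
  by (auto simp: skew_const_def skew_monom_def)

lemma t_eq_monom: "skew_t K = skew_monom 1 \<one>\<^bsub>K\<^esub>"
  by (auto simp: skew_t_def skew_monom_def)

lemma const_closed[simp]: "a \<in> carrier K \<Longrightarrow> skew_const K a \<in> carrier R"
  by (simp add: const_eq_monom)

lemma t_closed[simp]: "skew_t K \<in> carrier R"
  by (simp add: t_eq_monom)

lemma coeff_mult_monom:
  assumes "q \<in> carrier R" "a \<in> carrier K"
  shows "(q \<otimes>\<^bsub>R\<^esub> skew_monom k a) n = (if k \<le> n then (\<phi> ^^ k) (q (n - k)) \<otimes>\<^bsub>K\<^esub> a else \<zero>\<^bsub>K\<^esub>)"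
proof (cases "k \<le> n")
  case True
  have "(q \<otimes>\<^bsub>R\<^esub> skew_monom k a) n = (\<phi> ^^ (n - (n - k))) (q (n - k)) \<otimes>\<^bsub>K\<^esub> skew_monom k a (n - (n - k))"
    unfolding coeff_mult by (rule K.finsum_single) (use assms True in \<open>auto simp: skew_monom_def\<close>)
  then show ?thesis using True by (simp add: skew_monom_def)
next
  case False
  have "(q \<otimes>\<^bsub>R\<^esub> skew_monom k a) n = (\<Oplus>\<^bsub>K\<^esub>i\<in>{..n}. \<zero>\<^bsub>K\<^esub>)"
    unfolding coeff_mult by (rule K.finsum_cong') (use assms False in \<open>auto simp: skew_monom_def\<close>)
  then show ?thesis using False by simp
qed

lemma coeff_t_mult:
  assumes "p \<in> carrier R"
  shows "(skew_t K \<otimes>\<^bsub>R\<^esub> p) n = (case n of 0 \<Rightarrow> \<zero>\<^bsub>K\<^esub> | Suc m \<Rightarrow> p m)"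
proof (cases n)
  case 0
  then show ?thesis using assms by (simp add: coeff_mult skew_t_def)
next
  case (Suc m)
  have "(skew_t K \<otimes>\<^bsub>R\<^esub> p) n = (\<phi> ^^ (n - 1)) (skew_t K 1) \<otimes>\<^bsub>K\<^esub> p (n - 1)"
    unfolding coeff_mult by (rule K.finsum_single) (use assms Suc in \<open>auto simp: skew_t_def\<close>)
  then show ?thesis using assms Suc by (simp add: skew_t_def)
qed

text \<open>Since coefficients stand on the right, \<open>t\<close> splits off on the left without a
  twist by \<phi>. In a module this reads x p = (x t) q + x p_0, which reduces the action of
  \<open>p\<close> to that of a shorter polynomial on the element x t.\<close>

lemma skew_decomp:
  assumes p: "p \<in> carrier R"
  obtains q where "q \<in> carrier R" "\<And>n. q n = p (Suc n)"
    "p = skew_t K \<otimes>\<^bsub>R\<^esub> q \<oplus>\<^bsub>R\<^esub> skew_const K (p 0)"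
proof -
  define q where "q = (\<lambda>n. p (Suc n))"
  obtain N where "\<And>i. i \<ge> N \<Longrightarrow> p i = \<zero>\<^bsub>K\<^esub>" using R_bound[OF p] by blast
  then have q: "q \<in> carrier R" using p by (intro R_I[of _ N]) (auto simp: q_def)
  moreover have "p = skew_t K \<otimes>\<^bsub>R\<^esub> q \<oplus>\<^bsub>R\<^esub> skew_const K (p 0)"
    using p q by (intro ext) (auto simp: coeff_t_mult skew_const_def q_def split: nat.split)
  ultimately show ?thesis using that q_def by auto
qed

lemma R_eqI: "(\<And>n. p n = q n) \<Longrightarrow> p = q" by auto

text \<open>Induction on a bound for the support. As the step passes from \<open>p\<close> acting on
  x to \<open>q\<close> acting on x t, statements about the action have to be proved for all x at
  once.\<close>

lemma skew_poly_induct[consumes 1, case_names zero step]: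
  assumes p: "p \<in> carrier R" and z: "P \<zero>\<^bsub>R\<^esub>"
    and step: "\<And>p q. p \<in> carrier R \<Longrightarrow> q \<in> carrier R \<Longrightarrow> P q \<Longrightarrow> (\<And>n. q n = p (Suc n)) \<Longrightarrow>
      p = skew_t K \<otimes>\<^bsub>R\<^esub> q \<oplus>\<^bsub>R\<^esub> skew_const K (p 0) \<Longrightarrow> P p"
  shows "P p"
proof -
  have "\<forall>p\<in>carrier R. (\<forall>i\<ge>N. p i = \<zero>\<^bsub>K\<^esub>) \<longrightarrow> P p" for N
  proof (induction N)
    case 0
    have "p = \<zero>\<^bsub>R\<^esub>" if "\<forall>i\<ge>0. p i = \<zero>\<^bsub>K\<^esub>" for p using that by (intro R_eqI) auto
    then show ?case using z by blast
  next
    case (Suc N)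
    show ?case
    proof (intro ballI impI)
      fix p assume p: "p \<in> carrier R" and b: "\<forall>i\<ge>Suc N. p i = \<zero>\<^bsub>K\<^esub>"
      obtain q where q: "q \<in> carrier R" "\<And>n. q n = p (Suc n)"
        "p = skew_t K \<otimes>\<^bsub>R\<^esub> q \<oplus>\<^bsub>R\<^esub> skew_const K (p 0)" using skew_decomp[OF p] by blast
      then have "P q" using Suc b by simp
      with step p q show "P p" by blast
    qed
  qed
  then show ?thesis using R_bound[OF p] p by blast
qed

text \<open>Degree and order are the exponents that govern values: in x p the top term has the least
  value if v(x) is below \<theta>, the lowest term if it is above. For p = 0 the degree is 0 and the
  order is unspecified.\<close>

definition sdeg :: "(nat \<Rightarrow> 'k) \<Rightarrow> nat" where
  "sdeg p = (LEAST n. \<forall>i>n. p i = \<zero>\<^bsub>K\<^esub>)"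

definition sord :: "(nat \<Rightarrow> 'k) \<Rightarrow> nat" where
  "sord p = (LEAST n. p n \<noteq> \<zero>\<^bsub>K\<^esub>)"

lemma nonzeroD: assumes "p \<noteq> \<zero>\<^bsub>R\<^esub>" obtains n where "p n \<noteq> \<zero>\<^bsub>K\<^esub>"
  using assms R_eqI[of p "\<zero>\<^bsub>R\<^esub>"] by auto

lemma nonzeroI: "p n \<noteq> \<zero>\<^bsub>K\<^esub> \<Longrightarrow> p \<noteq> \<zero>\<^bsub>R\<^esub>"
  by auto

lemma above_sdeg: assumes "p \<in> carrier R" "i > sdeg p" shows "p i = \<zero>\<^bsub>K\<^esub>"
proof -
  obtain N where "\<And>i. i \<ge> N \<Longrightarrow> p i = \<zero>\<^bsub>K\<^esub>" using R_bound[OF assms(1)] by blast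
  then have "\<forall>i>N. p i = \<zero>\<^bsub>K\<^esub>" by auto
  then have "\<forall>i>sdeg p. p i = \<zero>\<^bsub>K\<^esub>" unfolding sdeg_def by (rule LeastI)
  then show ?thesis using assms by blast
qed

lemma sdeg_nonzero: assumes "p \<in> carrier R" "p \<noteq> \<zero>\<^bsub>R\<^esub>" shows "p (sdeg p) \<noteq> \<zero>\<^bsub>K\<^esub>"
proof
  assume z: "p (sdeg p) = \<zero>\<^bsub>K\<^esub>"
  show False
  proof (cases "sdeg p")
    case 0
    then show False using nonzeroD[OF assms(2)] above_sdeg[OF assms(1)] z by (metis gr0I)
  next
    case (Suc m)
    then have "\<forall>i>m. p i = \<zero>\<^bsub>K\<^esub>"
      using above_sdeg[OF assms(1)] z by (metis Suc_lessI)
    then have "sdeg p \<le> m" unfolding sdeg_def by (rule Least_le)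
    then show False using Suc by simp
  qed
qed

lemma sdeg_eqI: assumes "p n \<noteq> \<zero>\<^bsub>K\<^esub>" "\<And>i. i > n \<Longrightarrow> p i = \<zero>\<^bsub>K\<^esub>" shows "sdeg p = n"
  unfolding sdeg_def using assms by (intro Least_equality) (auto simp: not_less[symmetric])

lemma sdeg_shift:
  assumes "p \<in> carrier R" "q \<in> carrier R" "\<And>n. q n = p (Suc n)"
  shows "sdeg p = (if q = \<zero>\<^bsub>R\<^esub> then 0 else Suc (sdeg q))"
proof (cases "q = \<zero>\<^bsub>R\<^esub>")
  case True
  then have "\<forall>i>0. p i = \<zero>\<^bsub>K\<^esub>" using assms by (metis Suc_pred coeff_zero)
  then have "sdeg p \<le> 0" unfolding sdeg_def by (rule Least_le)
  then show ?thesis using True by simp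
next
  case False
  have "sdeg p = Suc (sdeg q)"
    using sdeg_nonzero[OF assms(2) False] above_sdeg[OF assms(2)] assms(3)
    by (intro sdeg_eqI) (metis, metis Suc_less_eq2)
  then show ?thesis using False by simp
qed

lemma sord_shift:
  assumes "p \<in> carrier R" "q \<in> carrier R" "\<And>n. q n = p (Suc n)" "p \<noteq> \<zero>\<^bsub>R\<^esub>"
  shows "sord p = (if p 0 \<noteq> \<zero>\<^bsub>K\<^esub> then 0 else Suc (sord q))"
proof (cases "p 0 = \<zero>\<^bsub>K\<^esub>")
  case True
  obtain n where "p n \<noteq> \<zero>\<^bsub>K\<^esub>" using nonzeroD assms by blast
  then have "sord p = Suc (LEAST m. p (Suc m) \<noteq> \<zero>\<^bsub>K\<^esub>)"
    unfolding sord_def using True by (intro Least_Suc) auto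
  then show ?thesis using True assms(3) by (simp add: sord_def)
next
  case False
  then show ?thesis by (simp add: sord_def)
qed

text \<open>The coefficient at the sum of the degrees is \<phi>^m(a) b, with \<open>a\<close>,
  \<open>b\<close> the leading coefficients and m the degree of \<open>q\<close>. It survives
  because \<phi>, an endomorphism of a field, is injective.\<close>

lemma R_domain:
  assumes "p \<in> carrier R" "q \<in> carrier R" "p \<noteq> \<zero>\<^bsub>R\<^esub>" "q \<noteq> \<zero>\<^bsub>R\<^esub>"
  shows "p \<otimes>\<^bsub>R\<^esub> q \<noteq> \<zero>\<^bsub>R\<^esub>"
proof (rule nonzeroI)
  let ?n = "sdeg p + sdeg q"
  have "(p \<otimes>\<^bsub>R\<^esub> q) ?n = (\<phi> ^^ (?n - sdeg p)) (p (sdeg p)) \<otimes>\<^bsub>K\<^esub> q (?n - sdeg p)"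
    unfolding coeff_mult
  proof (rule K.finsum_single)
    fix i assume "i \<in> {..?n}" "i \<noteq> sdeg p"
    then consider "i > sdeg p" | "?n - i > sdeg q" by fastforce
    then show "(\<phi> ^^ (?n - i)) (p i) \<otimes>\<^bsub>K\<^esub> q (?n - i) = \<zero>\<^bsub>K\<^esub>"
      by cases (simp_all add: assms above_sdeg)
  qed (use assms in auto)
  then show "(p \<otimes>\<^bsub>R\<^esub> q) ?n \<noteq> \<zero>\<^bsub>K\<^esub>"
    using assms sdeg_nonzero pow_nonzero[of "p (sdeg p)" "sdeg q"] by (simp add: K.integral_iff)
qed

lemma one_neq_zero: "\<one>\<^bsub>R\<^esub> \<noteq> \<zero>\<^bsub>R\<^esub>"
  by (rule nonzeroI[of _ 0]) (simp add: skew_poly_def)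

text \<open>The quotient stands to the right of the divisor. On this side a top coefficient is
  cancelled by dividing by \<phi>^(m-d)(q_d), a unit of \<open>K\<close>; on the other side one
  would need preimages under \<phi>. This is why Euclid's algorithm below concerns right ideals, as
  suits right modules.\<close>

lemma right_division:
  assumes q: "q \<in> carrier R" "q d \<noteq> \<zero>\<^bsub>K\<^esub>" "\<And>i. i > d \<Longrightarrow> q i = \<zero>\<^bsub>K\<^esub>"
    and p: "p \<in> carrier R"
  shows "\<exists>s\<in>carrier R. \<forall>i\<ge>d. (p \<ominus>\<^bsub>R\<^esub> q \<otimes>\<^bsub>R\<^esub> s) i = \<zero>\<^bsub>K\<^esub>"
proof -
  have "\<forall>p\<in>carrier R. (\<forall>i\<ge>N. p i = \<zero>\<^bsub>K\<^esub>) \<longrightarrow>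
    (\<exists>s\<in>carrier R. \<forall>i\<ge>d. (p \<ominus>\<^bsub>R\<^esub> q \<otimes>\<^bsub>R\<^esub> s) i = \<zero>\<^bsub>K\<^esub>)" for N
  proof (induction N)
    case 0
    have "p \<ominus>\<^bsub>R\<^esub> q \<otimes>\<^bsub>R\<^esub> \<zero>\<^bsub>R\<^esub> = p" if "p \<in> carrier R" for p
      using that q by (simp add: R.minus_eq)
    then have "\<forall>i\<ge>d. (p \<ominus>\<^bsub>R\<^esub> q \<otimes>\<^bsub>R\<^esub> \<zero>\<^bsub>R\<^esub>) i = \<zero>\<^bsub>K\<^esub>" if "p \<in> carrier R" "\<forall>i\<ge>0. p i = \<zero>\<^bsub>K\<^esub>" for p
      using that by simp
    then show ?case by blast
  next
    case (Suc m)
    show ?case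
    proof (intro ballI impI)
      fix p assume p: "p \<in> carrier R" and b: "\<forall>i\<ge>Suc m. p i = \<zero>\<^bsub>K\<^esub>"
      show "\<exists>s\<in>carrier R. \<forall>i\<ge>d. (p \<ominus>\<^bsub>R\<^esub> q \<otimes>\<^bsub>R\<^esub> s) i = \<zero>\<^bsub>K\<^esub>"
      proof (cases "d \<le> m")
        case False
        then show ?thesis using q p b
          by (intro bexI[of _ "\<zero>\<^bsub>R\<^esub>"]) (simp_all add: R.minus_eq del: coeff_diff)
      next
        case True
        let ?f = "(\<phi> ^^ (m - d)) (q d)"
        let ?a = "inv\<^bsub>K\<^esub> ?f \<otimes>\<^bsub>K\<^esub> p m"
        have f: "?f \<in> Units K" using q pow_nonzero by (simp add: K.field_Units)
        then have a: "?a \<in> carrier K" using p by simp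
        let ?s = "skew_monom (m - d) ?a"
        let ?p = "p \<ominus>\<^bsub>R\<^esub> q \<otimes>\<^bsub>R\<^esub> ?s"
        have s: "?s \<in> carrier R" using a by simp
        have "?p i = \<zero>\<^bsub>K\<^esub>" if i: "i \<ge> m" for i
        proof (cases "i = m")
          case eq: True
          have "?f \<otimes>\<^bsub>K\<^esub> ?a = p m" using f p q by (simp add: K.m_assoc[symmetric] K.Units_closed)
          then have "(q \<otimes>\<^bsub>R\<^esub> ?s) m = p m"
            using True q a by (simp add: coeff_mult_monom)
          then show ?thesis using p q s eq by (simp add: K.minus_eq K.r_neg)
        next
          case False
          then have "i - (m - d) > d" using i True by arith
          then have "(q \<otimes>\<^bsub>R\<^esub> ?s) i = \<zero>\<^bsub>K\<^esub>" using q a by (simp add: coeff_mult_monom)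
          then show ?thesis using p q s b False i by (simp add: K.minus_eq)
        qed
        then have z: "\<forall>i\<ge>m. ?p i = \<zero>\<^bsub>K\<^esub>" by blast
        have "?p \<in> carrier R" using p q(1) s by simp
        from Suc.IH[THEN bspec, OF this, THEN mp, OF z]
        obtain s' where s': "s' \<in> carrier R" "\<forall>i\<ge>d. (?p \<ominus>\<^bsub>R\<^esub> q \<otimes>\<^bsub>R\<^esub> s') i = \<zero>\<^bsub>K\<^esub>" ..
        have "?p \<ominus>\<^bsub>R\<^esub> q \<otimes>\<^bsub>R\<^esub> s' = p \<ominus>\<^bsub>R\<^esub> q \<otimes>\<^bsub>R\<^esub> (?s \<oplus>\<^bsub>R\<^esub> s')"
          using p q s s'(1) by (simp add: R.minus_eq R.r_distr R.minus_add R.a_assoc)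
        then have "\<forall>i\<ge>d. (p \<ominus>\<^bsub>R\<^esub> q \<otimes>\<^bsub>R\<^esub> (?s \<oplus>\<^bsub>R\<^esub> s')) i = \<zero>\<^bsub>K\<^esub>"
          using s'(2) by metis
        then show ?thesis using s s'(1) by (intro bexI[of _ "?s \<oplus>\<^bsub>R\<^esub> s'"]) (assumption, rule R.a_closed)
      qed
    qed
  qed
  moreover obtain N where "\<And>i. i \<ge> N \<Longrightarrow> p i = \<zero>\<^bsub>K\<^esub>" using R_bound[OF p] by blast
  then have "\<forall>i\<ge>N. p i = \<zero>\<^bsub>K\<^esub>" by blast
  ultimately show ?thesis using p by (metis (no_types))
qed

declare coeff_zero[simp del] coeff_add[simp del] coeff_minus[simp del] coeff_diff[simp del]

text \<open>Every right ideal pR + qR is principal. The remainder of \<open>p\<close> by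
  \<open>q\<close> generates together with \<open>q\<close> the same right ideal and vanishes from
  the degree of \<open>q\<close> on, so the induction is on a bound for the support of the second
  argument.\<close>

lemma bezout:
  assumes "p \<in> carrier R" "q \<in> carrier R"
  shows "\<exists>g\<in>carrier R. \<exists>a\<in>carrier R. \<exists>b\<in>carrier R. \<exists>c\<in>carrier R. \<exists>d\<in>carrier R.
    g = p \<otimes>\<^bsub>R\<^esub> a \<oplus>\<^bsub>R\<^esub> q \<otimes>\<^bsub>R\<^esub> b \<and> p = g \<otimes>\<^bsub>R\<^esub> c \<and> q = g \<otimes>\<^bsub>R\<^esub> d"
proof -
  define P where "P p q \<longleftrightarrow> (\<exists>g\<in>carrier R. \<exists>a\<in>carrier R. \<exists>b\<in>carrier R. \<exists>c\<in>carrier R. \<exists>d\<in>carrier R.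
    g = p \<otimes>\<^bsub>R\<^esub> a \<oplus>\<^bsub>R\<^esub> q \<otimes>\<^bsub>R\<^esub> b \<and> p = g \<otimes>\<^bsub>R\<^esub> c \<and> q = g \<otimes>\<^bsub>R\<^esub> d)" for p q
  have "p \<in> carrier R \<Longrightarrow> q \<in> carrier R \<Longrightarrow> \<forall>i\<ge>N. q i = \<zero>\<^bsub>K\<^esub> \<Longrightarrow> P p q" for N p q
  proof (induction N arbitrary: p q rule: less_induct)
    case (less N)
    note p = less.prems(1) and q = less.prems(2) and b = less.prems(3)
    show ?case
      proof (cases "q = \<zero>\<^bsub>R\<^esub>")
        case True
        show ?thesis unfolding P_def
          by (rule bexI[of _ p], rule bexI[of _ "\<one>\<^bsub>R\<^esub>"], rule bexI[of _ "\<zero>\<^bsub>R\<^esub>"],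
              rule bexI[of _ "\<one>\<^bsub>R\<^esub>"], rule bexI[of _ "\<zero>\<^bsub>R\<^esub>"])
              (use p True in simp_all)
      next
        case False
        let ?d = "sdeg q"
        have d: "q ?d \<noteq> \<zero>\<^bsub>K\<^esub>" using sdeg_nonzero q False by blast
        then have dN: "?d < N" using b by (meson not_less)
        obtain s where s: "s \<in> carrier R" "\<forall>i\<ge>?d. (p \<ominus>\<^bsub>R\<^esub> q \<otimes>\<^bsub>R\<^esub> s) i = \<zero>\<^bsub>K\<^esub>"
          using right_division[OF q d above_sdeg[OF q] p] by blast
        let ?r = "p \<ominus>\<^bsub>R\<^esub> q \<otimes>\<^bsub>R\<^esub> s"
        have r: "?r \<in> carrier R" using p q s(1) by simp
        obtain g a b c d where g: "g \<in> carrier R" "a \<in> carrier R" "b \<in> carrier R" "c \<in> carrier R"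
          "d \<in> carrier R" "g = q \<otimes>\<^bsub>R\<^esub> a \<oplus>\<^bsub>R\<^esub> ?r \<otimes>\<^bsub>R\<^esub> b" "q = g \<otimes>\<^bsub>R\<^esub> c" "?r = g \<otimes>\<^bsub>R\<^esub> d"
          using less.IH[OF dN q r s(2)] unfolding P_def by (elim bexE conjE) (rule that; assumption)
        have "p = ?r \<oplus>\<^bsub>R\<^esub> q \<otimes>\<^bsub>R\<^esub> s"
          using p q s(1) by (simp add: R.diff_add_cancel)
        also have "\<dots> = g \<otimes>\<^bsub>R\<^esub> d \<oplus>\<^bsub>R\<^esub> (g \<otimes>\<^bsub>R\<^esub> c) \<otimes>\<^bsub>R\<^esub> s"
          by (simp only: g(8) g(7)[symmetric])
        also have "\<dots> = g \<otimes>\<^bsub>R\<^esub> (c \<otimes>\<^bsub>R\<^esub> s \<oplus>\<^bsub>R\<^esub> d)"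
          using g(1-5) s(1) by (simp add: R.r_distr R.m_assoc R.a_comm)
        finally have 1: "p = g \<otimes>\<^bsub>R\<^esub> (c \<otimes>\<^bsub>R\<^esub> s \<oplus>\<^bsub>R\<^esub> d)" .
        have "q \<otimes>\<^bsub>R\<^esub> a \<oplus>\<^bsub>R\<^esub> ?r \<otimes>\<^bsub>R\<^esub> b = p \<otimes>\<^bsub>R\<^esub> b \<oplus>\<^bsub>R\<^esub> q \<otimes>\<^bsub>R\<^esub> (a \<ominus>\<^bsub>R\<^esub> s \<otimes>\<^bsub>R\<^esub> b)"
          using p q s(1) g(2,3)
          by (simp add: R.minus_eq R.r_distr R.l_distr R.m_assoc R.l_minus R.r_minus R.a_ac)
        then have 2: "g = p \<otimes>\<^bsub>R\<^esub> b \<oplus>\<^bsub>R\<^esub> q \<otimes>\<^bsub>R\<^esub> (a \<ominus>\<^bsub>R\<^esub> s \<otimes>\<^bsub>R\<^esub> b)" by (rule trans[OF g(6)])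
        show ?thesis unfolding P_def
          by (rule bexI[of _ g], rule bexI[of _ b], rule bexI[of _ "a \<ominus>\<^bsub>R\<^esub> s \<otimes>\<^bsub>R\<^esub> b"],
              rule bexI[of _ "c \<otimes>\<^bsub>R\<^esub> s \<oplus>\<^bsub>R\<^esub> d"], rule bexI[of _ c]) (intro conjI 1 2 g(7), simp_all add: g(1-5) s(1))
      qed
  qed
  moreover obtain N where "\<And>i. i \<ge> N \<Longrightarrow> q i = \<zero>\<^bsub>K\<^esub>" using R_bound[OF assms(2)] by blast
  then have "\<forall>i\<ge>N. q i = \<zero>\<^bsub>K\<^esub>" by blast
  ultimately have "P p q" using assms by blast
  then show ?thesis by (simp only: P_def)
qed

text \<open>From p = g c and g = p a + q b one gets p (1 - a c) = q b c, a non-zero common right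
  multiple if \<open>b\<close> is non-zero. If b = 0, then g = p a, and \<open>q\<close> itself is a
  right multiple of \<open>p\<close>.\<close>

lemma right_Ore:
  assumes p: "p \<in> carrier R" "p \<noteq> \<zero>\<^bsub>R\<^esub>" and q: "q \<in> carrier R" "q \<noteq> \<zero>\<^bsub>R\<^esub>"
  shows "\<exists>s\<in>carrier R. \<exists>u\<in>carrier R. p \<otimes>\<^bsub>R\<^esub> s = q \<otimes>\<^bsub>R\<^esub> u \<and> p \<otimes>\<^bsub>R\<^esub> s \<noteq> \<zero>\<^bsub>R\<^esub>"
proof -
  obtain g a b c d where g: "g \<in> carrier R" "a \<in> carrier R" "b \<in> carrier R" "c \<in> carrier R"
    "d \<in> carrier R" "g = p \<otimes>\<^bsub>R\<^esub> a \<oplus>\<^bsub>R\<^esub> q \<otimes>\<^bsub>R\<^esub> b" "p = g \<otimes>\<^bsub>R\<^esub> c" "q = g \<otimes>\<^bsub>R\<^esub> d"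
    using bezout[OF p(1) q(1)] by blast
  have c: "c \<noteq> \<zero>\<^bsub>R\<^esub>" by (metis R.r_null g(1) g(7) p(2))
  show ?thesis
  proof (cases "b = \<zero>\<^bsub>R\<^esub>")
    case True
    then have "g = p \<otimes>\<^bsub>R\<^esub> a" by (metis R.m_closed R.r_null R.r_zero g(2,6) p(1) q(1))
    then have *: "p \<otimes>\<^bsub>R\<^esub> (a \<otimes>\<^bsub>R\<^esub> d) = q" by (metis R.m_assoc g(2,5,8) p(1))
    have "p \<otimes>\<^bsub>R\<^esub> (a \<otimes>\<^bsub>R\<^esub> d) = q \<otimes>\<^bsub>R\<^esub> \<one>\<^bsub>R\<^esub>" "p \<otimes>\<^bsub>R\<^esub> (a \<otimes>\<^bsub>R\<^esub> d) \<noteq> \<zero>\<^bsub>R\<^esub>"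
      unfolding * using q by simp_all
    then show ?thesis using g(2,5) R.m_closed R.one_closed by blast
  next
    case False
    have "p = g \<otimes>\<^bsub>R\<^esub> c" by fact
    also have "\<dots> = p \<otimes>\<^bsub>R\<^esub> (a \<otimes>\<^bsub>R\<^esub> c) \<oplus>\<^bsub>R\<^esub> q \<otimes>\<^bsub>R\<^esub> (b \<otimes>\<^bsub>R\<^esub> c)"
      using g(2-4) p(1) q(1) by (subst g(6)) (simp add: R.l_distr R.m_assoc)
    finally have "p \<ominus>\<^bsub>R\<^esub> p \<otimes>\<^bsub>R\<^esub> (a \<otimes>\<^bsub>R\<^esub> c)
      = p \<otimes>\<^bsub>R\<^esub> (a \<otimes>\<^bsub>R\<^esub> c) \<oplus>\<^bsub>R\<^esub> q \<otimes>\<^bsub>R\<^esub> (b \<otimes>\<^bsub>R\<^esub> c) \<ominus>\<^bsub>R\<^esub> p \<otimes>\<^bsub>R\<^esub> (a \<otimes>\<^bsub>R\<^esub> c)"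
      by (rule arg_cong)
    also have "\<dots> = q \<otimes>\<^bsub>R\<^esub> (b \<otimes>\<^bsub>R\<^esub> c)"
      using p(1) q(1) g(2-4) by (intro R.add_diff_cancel) simp_all
    finally have "p \<ominus>\<^bsub>R\<^esub> p \<otimes>\<^bsub>R\<^esub> (a \<otimes>\<^bsub>R\<^esub> c) = q \<otimes>\<^bsub>R\<^esub> (b \<otimes>\<^bsub>R\<^esub> c)" .
    then have "p \<otimes>\<^bsub>R\<^esub> (\<one>\<^bsub>R\<^esub> \<ominus>\<^bsub>R\<^esub> a \<otimes>\<^bsub>R\<^esub> c) = q \<otimes>\<^bsub>R\<^esub> (b \<otimes>\<^bsub>R\<^esub> c)"
      using p(1) q(1) g(2-4) by (simp add: R.minus_eq R.r_distr R.r_minus)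
    moreover have "q \<otimes>\<^bsub>R\<^esub> (b \<otimes>\<^bsub>R\<^esub> c) \<noteq> \<zero>\<^bsub>R\<^esub>"
      using R_domain[OF q(1) _ q(2) R_domain[OF g(3,4) False c]] g(3,4) by blast
    moreover have "\<one>\<^bsub>R\<^esub> \<ominus>\<^bsub>R\<^esub> a \<otimes>\<^bsub>R\<^esub> c \<in> carrier R" "b \<otimes>\<^bsub>R\<^esub> c \<in> carrier R"
      using g(2-4) by simp_all
    ultimately show ?thesis by metis
  qed
qed

end

section \<open>Coverings by cosets\<close>

text \<open>A choice of \<open>n\<close> arguments with distinct values replaces the cardinality:
  this form also covers an infinite image and can be written as a first-order sentence.\<close>

lemma ex_inj_on_card_iff:
  "(\<exists>S\<subseteq>A. finite S \<and> card S = n \<and> inj_on f S) \<longleftrightarrow> (finite (f ` A) \<longrightarrow> n \<le> card (f ` A))"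
proof
  assume "\<exists>S\<subseteq>A. finite S \<and> card S = n \<and> inj_on f S"
  then obtain S where S: "S \<subseteq> A" "finite S" "card S = n" "inj_on f S" by blast
  then have "card (f ` S) = n" by (simp add: card_image)
  then show "finite (f ` A) \<longrightarrow> n \<le> card (f ` A)" using S by (metis card_mono image_mono)
next
  assume *: "finite (f ` A) \<longrightarrow> n \<le> card (f ` A)"
  obtain T where T: "T \<subseteq> f ` A" "finite T" "card T = n"
  proof (cases "finite (f ` A)")
    case True
    then show ?thesis using * obtain_subset_with_card_n that by (metis finite_subset)
  next
    case False
    then show ?thesis using infinite_arbitrarily_large that by metis
  qed
  obtain S where S: "S \<subseteq> A" "inj_on f S" "f ` S = T"
    using subset_image_inj[THEN iffD1, OF T(1)] by auto
  then show "\<exists>S\<subseteq>A. finite S \<and> card S = n \<and> inj_on f S"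
    using T by (metis card_image finite_image_iff)
qed

context abelian_group
begin

section \<open>Subgroups, cosets and indices\<close>

definition subgrp :: "'a set \<Rightarrow> bool" where
  "subgrp H \<longleftrightarrow> H \<subseteq> carrier G \<and> \<zero> \<in> H \<and> (\<forall>x\<in>H. \<forall>y\<in>H. x \<ominus> y \<in> H)"

definition cls :: "'a set \<Rightarrow> 'a \<Rightarrow> 'a set" where
  "cls N x = {y \<in> carrier G. y \<ominus> x \<in> N}"

text \<open>For subgroups: the index of H \<inter> N in \<open>H\<close> is at least
  \<open>n\<close>, in a form that makes sense for infinite indices.\<close>

definition sep :: "nat \<Rightarrow> 'a set \<Rightarrow> 'a set \<Rightarrow> bool" where
  "sep n H N \<longleftrightarrow>
    (\<exists>S\<subseteq>H. finite S \<and> card S = n \<and> (\<forall>x\<in>S. \<forall>y\<in>S. x \<noteq> y \<longrightarrow> x \<ominus> y \<notin> N))"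

text \<open>The representatives may lie outside \<open>H\<close>, so that passing to a subset of
  \<open>H\<close> keeps the same \<open>C\<close>.\<close>

definition fin_index :: "'a set \<Rightarrow> 'a set \<Rightarrow> bool" where
  "fin_index H N \<longleftrightarrow> (\<exists>C\<subseteq>carrier G. finite C \<and> (\<forall>h\<in>H. \<exists>c\<in>C. h \<ominus> c \<in> N))"

lemma diff_self[simp]: "x \<in> carrier G \<Longrightarrow> x \<ominus> x = \<zero>"
  by (simp add: minus_eq r_neg)

lemma diff_zero[simp]: "x \<in> carrier G \<Longrightarrow> x \<ominus> \<zero> = x"
  by (simp add: minus_eq)

lemma zero_diff[simp]: "x \<in> carrier G \<Longrightarrow> \<zero> \<ominus> x = \<ominus> x"
  by (simp add: minus_eq)

lemma diff_add_diff:
  "\<lbrakk>x \<in> carrier G; y \<in> carrier G; z \<in> carrier G\<rbrakk> \<Longrightarrow> (x \<ominus> y) \<oplus> (y \<ominus> z) = x \<ominus> z"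
  by (simp add: minus_eq a_assoc r_neg1)

lemma minus_diff: "\<lbrakk>x \<in> carrier G; y \<in> carrier G\<rbrakk> \<Longrightarrow> \<ominus> (x \<ominus> y) = y \<ominus> x"
  by (simp add: minus_eq minus_add a_comm)

lemma diff_diff_cancel:
  "\<lbrakk>x \<in> carrier G; y \<in> carrier G; z \<in> carrier G\<rbrakk> \<Longrightarrow> (x \<ominus> z) \<ominus> (y \<ominus> z) = x \<ominus> y"
  by (metis minus_eq minus_diff diff_add_diff)

lemma diff_add_self: "\<lbrakk>x \<in> carrier G; h \<in> carrier G\<rbrakk> \<Longrightarrow> x \<ominus> (x \<oplus> h) = \<ominus> h"
  by (simp add: minus_eq minus_add r_neg2)

lemma add_diff_add:
  "\<lbrakk>x \<in> carrier G; h \<in> carrier G; c \<in> carrier G\<rbrakk> \<Longrightarrow> (x \<oplus> h) \<ominus> (x \<oplus> c) = h \<ominus> c"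
  using diff_diff_cancel[of h c "\<ominus> x"] by (simp add: minus_eq a_comm)

lemma add_diff_swap:
  "\<lbrakk>h \<in> carrier G; u \<in> carrier G; c \<in> carrier G\<rbrakk> \<Longrightarrow> (h \<oplus> u) \<ominus> c \<ominus> u = h \<ominus> c"
  by (simp add: minus_eq a_assoc a_comm[of "\<ominus> c" "\<ominus> u"] r_neg2)

lemma eq_iff_diff_zero: "\<lbrakk>x \<in> carrier G; y \<in> carrier G\<rbrakk> \<Longrightarrow> x = y \<longleftrightarrow> x \<ominus> y = \<zero>"
  by (metis diff_self minus_closed add_diff_cancel diff_add_cancel l_zero)

context
  fixes H assumes H: "subgrp H"
begin

lemma subgrp_carrier: "x \<in> H \<Longrightarrow> x \<in> carrier G" using H by (auto simp: subgrp_def)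
lemma subgrp_zero: "\<zero> \<in> H" using H by (auto simp: subgrp_def)
lemma subgrp_diff: "x \<in> H \<Longrightarrow> y \<in> H \<Longrightarrow> x \<ominus> y \<in> H" using H by (auto simp: subgrp_def)
lemma subgrp_minus: "x \<in> H \<Longrightarrow> \<ominus> x \<in> H"
  using subgrp_diff[OF subgrp_zero, of x] subgrp_carrier by simp
lemma subgrp_add: "x \<in> H \<Longrightarrow> y \<in> H \<Longrightarrow> x \<oplus> y \<in> H"
  using subgrp_diff[OF _ subgrp_minus, of x y] subgrp_carrier by (simp add: minus_eq)
lemma subgrp_diff_commute:
  "x \<in> carrier G \<Longrightarrow> y \<in> carrier G \<Longrightarrow> x \<ominus> y \<in> H \<longleftrightarrow> y \<ominus> x \<in> H"
  using subgrp_minus minus_diff by metis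
lemma subgrp_diff_trans:
  "x \<in> carrier G \<Longrightarrow> y \<in> carrier G \<Longrightarrow> z \<in> carrier G \<Longrightarrow> x \<ominus> y \<in> H \<Longrightarrow> y \<ominus> z \<in> H \<Longrightarrow> x \<ominus> z \<in> H"
  using subgrp_add diff_add_diff by metis

lemma cls_eq_iff: "x \<in> carrier G \<Longrightarrow> y \<in> carrier G \<Longrightarrow> cls H x = cls H y \<longleftrightarrow> x \<ominus> y \<in> H"
proof
  assume xy: "x \<in> carrier G" "y \<in> carrier G"
  { assume "cls H x = cls H y"
    moreover have "x \<in> cls H x" using xy subgrp_zero by (simp add: cls_def)
    ultimately show "x \<ominus> y \<in> H" by (simp add: cls_def) }
  assume d: "x \<ominus> y \<in> H"
  have "z \<ominus> x \<in> H \<longleftrightarrow> z \<ominus> y \<in> H" if "z \<in> carrier G" for z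
    using subgrp_diff_trans[of z x y] subgrp_diff_trans[of z y x] d subgrp_diff_commute[of x y]
      that xy by auto
  then show "cls H x = cls H y" unfolding cls_def by auto
qed

lemma sep_iff_card:
  assumes "A \<subseteq> carrier G"
  shows "sep n A H \<longleftrightarrow> (finite (cls H ` A) \<longrightarrow> n \<le> card (cls H ` A))"
proof -
  have "inj_on (cls H) S \<longleftrightarrow> (\<forall>x\<in>S. \<forall>y\<in>S. x \<noteq> y \<longrightarrow> x \<ominus> y \<notin> H)" if "S \<subseteq> A" for S
  proof -
    have "cls H x = cls H y \<longleftrightarrow> x \<ominus> y \<in> H" if "x \<in> S" "y \<in> S" for x y
      using \<open>S \<subseteq> A\<close> that assms by (intro cls_eq_iff) auto
    then show ?thesis unfolding inj_on_def by auto
  qed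
  then have "sep n A H \<longleftrightarrow> (\<exists>S\<subseteq>A. finite S \<and> card S = n \<and> inj_on (cls H) S)"
    unfolding sep_def by auto
  then show ?thesis by (simp add: ex_inj_on_card_iff)
qed

lemma fin_index_iff_finite:
  assumes "A \<subseteq> carrier G"
  shows "fin_index A H \<longleftrightarrow> finite (cls H ` A)"
proof
  assume "fin_index A H"
  then obtain C where C: "C \<subseteq> carrier G" "finite C" "\<forall>h\<in>A. \<exists>c\<in>C. h \<ominus> c \<in> H"
    unfolding fin_index_def by (elim exE conjE)
  have "cls H ` A \<subseteq> cls H ` C"
  proof
    fix y assume "y \<in> cls H ` A"
    then obtain h where h: "h \<in> A" "y = cls H h" by blast
    then obtain c where c: "c \<in> C" "h \<ominus> c \<in> H" using C(3) by blast
    then have "cls H h = cls H c" using h C(1) assms cls_eq_iff[of h c] by auto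
    then show "y \<in> cls H ` C" using h c by simp
  qed
  then show "finite (cls H ` A)" using C(2) by (meson finite_imageI finite_subset)
next
  assume "finite (cls H ` A)"
  then obtain C where C: "C \<subseteq> A" "finite C" "cls H ` A = cls H ` C"
    using finite_subset_image[OF _ order_refl, of "cls H" A] by auto
  have "\<exists>c\<in>C. h \<ominus> c \<in> H" if "h \<in> A" for h
  proof -
    have "cls H h \<in> cls H ` C" using C(3) that by blast
    then obtain c where "c \<in> C" "cls H h = cls H c" by auto
    moreover from this have "h \<ominus> c \<in> H" using C(1) assms that cls_eq_iff[of h c] by auto
    ultimately show ?thesis by blast
  qed
  moreover have "C \<subseteq> carrier G" using C(1) assms by (rule subset_trans)
  ultimately show "fin_index A H" using C(2) unfolding fin_index_def by (intro exI[of _ C]) simp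
qed

lemma fin_index_iff_sep:
  assumes "A \<subseteq> carrier G"
  shows "fin_index A H \<longleftrightarrow> \<not> (\<forall>n. sep n A H)"
  using sep_iff_card[OF assms] fin_index_iff_finite[OF assms]
  by (metis Suc_n_not_le_n)

text \<open>A finite index can thus be recovered from the statements \<open>sep\<close>, and these
  are all that two groups will be known to share.\<close>

lemma card_cls_eq_sep:
  assumes "A \<subseteq> carrier G" "fin_index A H"
  shows "card (cls H ` A) = (GREATEST n. sep n A H)"
  using sep_iff_card[OF assms(1)] fin_index_iff_finite[OF assms(1)] assms(2)
  by (intro Greatest_equality[symmetric]) auto

end

lemma fin_index_refl:
  assumes "H \<subseteq> carrier G" shows "fin_index H H"
proof -
  have "h \<ominus> \<zero> \<in> H" if "h \<in> H" for h using that assms by (simp add: subset_iff)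
  then show ?thesis unfolding fin_index_def by (intro exI[of _ "{\<zero>}"]) auto
qed

lemma fin_index_mono:
  assumes "fin_index H N" "H' \<subseteq> H" "N \<subseteq> N'" shows "fin_index H' N'"
proof -
  obtain C where C: "C \<subseteq> carrier G" "finite C" "\<forall>h\<in>H. \<exists>c\<in>C. h \<ominus> c \<in> N"
    using assms(1) unfolding fin_index_def by (elim exE conjE)
  have "\<exists>c\<in>C. h \<ominus> c \<in> N'" if "h \<in> H'" for h
    using C(3) assms(2,3) that by (meson subsetD)
  then show ?thesis using C unfolding fin_index_def by (intro exI[of _ C]) simp
qed

lemma subgrp_Int: "subgrp H \<Longrightarrow> subgrp N \<Longrightarrow> subgrp (H \<inter> N)"
  unfolding subgrp_def by auto

lemma fin_index_trans:
  assumes H: "H \<subseteq> carrier G" and N: "subgrp N" and K: "subgrp K"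
    and 1: "fin_index H N" and 2: "fin_index N K"
  shows "fin_index H K"
proof -
  obtain C where C: "C \<subseteq> carrier G" "finite C" "\<forall>h\<in>H. \<exists>c\<in>C. h \<ominus> c \<in> N"
    using 1 unfolding fin_index_def by blast
  obtain D where D: "D \<subseteq> carrier G" "finite D" "\<forall>h\<in>N. \<exists>c\<in>D. h \<ominus> c \<in> K"
    using 2 unfolding fin_index_def by blast
  let ?E = "(\<lambda>(c, d). c \<oplus> d) ` (C \<times> D)"
  have "\<exists>e\<in>?E. h \<ominus> e \<in> K" if h: "h \<in> H" for h
  proof -
    obtain c where c: "c \<in> C" "h \<ominus> c \<in> N" using C h by blast
    then obtain d where d: "d \<in> D" "h \<ominus> c \<ominus> d \<in> K" using D by blast
    have "h \<ominus> c \<ominus> d = h \<ominus> (c \<oplus> d)"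
      using c d h H C D by (simp add: minus_eq minus_add a_assoc subset_iff)
    then show ?thesis using c d by force
  qed
  moreover have "finite ?E" "?E \<subseteq> carrier G" using C D by auto
  ultimately show ?thesis unfolding fin_index_def by blast
qed

text \<open>A class modulo the intersection is the intersection of a class modulo \<open>N\<close>
  and one modulo \<open>K\<close>, so finitely many classes remain.\<close>

lemma fin_index_Int:
  assumes H: "H \<subseteq> carrier G" and N: "subgrp N" and K: "subgrp K"
    and 1: "fin_index H N" and 2: "fin_index H K"
  shows "fin_index H (N \<inter> K)"
proof -
  have "cls (N \<inter> K) x = cls N x \<inter> cls K x" for x by (auto simp: cls_def)
  then have "cls (N \<inter> K) ` H \<subseteq> (\<lambda>(a, b). a \<inter> b) ` (cls N ` H \<times> cls K ` H)" by auto
  moreover have "finite (cls N ` H \<times> cls K ` H)"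
    using 1 2 fin_index_iff_finite[OF N H] fin_index_iff_finite[OF K H] by simp
  ultimately have "finite (cls (N \<inter> K) ` H)" using finite_surj by blast
  then show ?thesis using fin_index_iff_finite[OF subgrp_Int[OF N K] H] by simp
qed

text \<open>B. H. Neumann: if some coset of \<open>K j\<close> in \<open>H\<close> is missing from the covering, it is covered
  by the cosets of the other subgroups; translating, so is every coset of \<open>K j\<close>, and \<open>K j\<close> can be
  dispensed with.\<close>

lemma Neumann:
  assumes "finite J" and H: "subgrp H"
    and K: "\<And>j. j \<in> J \<Longrightarrow> subgrp (K j)" "\<And>j. j \<in> J \<Longrightarrow> K j \<subseteq> H" "\<And>j. j \<in> J \<Longrightarrow> \<not> fin_index H (K j)"
    and C: "\<And>j. j \<in> J \<Longrightarrow> finite (C j)" "\<And>j. j \<in> J \<Longrightarrow> C j \<subseteq> carrier G"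
  shows "\<exists>h\<in>H. \<forall>j\<in>J. \<forall>c\<in>C j. h \<ominus> c \<notin> K j"
  using assms(1) K C
proof (induction J arbitrary: C rule: finite_induct)
  case empty
  then show ?case using subgrp_zero[OF H] by blast
next
  case (insert i J)
  note Hc = subgrp_carrier[OF H]
  obtain h where h: "h \<in> H" "\<forall>c\<in>C i. h \<ominus> c \<notin> K i"
    using insert.prems(3)[of i] insert.prems(4,5)[of i] unfolding fin_index_def by auto
  define D where "D j = C j \<union> (\<lambda>(k, a). k \<oplus> (a \<ominus> h)) ` (C j \<times> C i)" for j
  have "finite (D j)" "D j \<subseteq> carrier G" if "j \<in> J" for j
    using insert.prems(4,5)[of i] insert.prems(4,5)[of j] that Hc h unfolding D_def
    by (auto simp: subset_iff)
  then obtain z where z: "z \<in> H" "\<forall>j\<in>J. \<forall>c\<in>D j. z \<ominus> c \<notin> K j"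
    using insert.IH[of D] insert.prems(1-3) by auto
  show ?case
  proof (cases "\<exists>a\<in>C i. z \<ominus> a \<in> K i")
    case False
    then show ?thesis using z unfolding D_def by blast
  next
    case True
    then obtain a where a: "a \<in> C i" "z \<ominus> a \<in> K i" by blast
    have ac: "a \<in> carrier G" using a insert.prems(5)[of i] by auto
    have Ki: "subgrp (K i)" "K i \<subseteq> H" using insert.prems by auto
    have za: "z \<ominus> a \<in> H" using a Ki by blast
    let ?h = "h \<oplus> (z \<ominus> a)"
    have "?h \<in> H" using h za subgrp_add[OF H] by blast
    moreover have "?h \<ominus> c \<notin> K j" if j: "j \<in> insert i J" and c: "c \<in> C j" for j c
    proof
      assume *: "?h \<ominus> c \<in> K j"
      have cc: "c \<in> carrier G" using c j insert.prems(5)[of j] by auto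
      show False
      proof (cases "j = i")
        case True
        have "?h \<ominus> c \<ominus> (z \<ominus> a) = h \<ominus> c"
          using Hc[OF h(1)] Hc[OF z(1)] ac cc
          by (simp add: add_diff_swap)
        then show False using * a(2) True h(2) c subgrp_diff[OF Ki(1)] by metis
      next
        case False
        have "?h \<ominus> c = z \<ominus> (c \<oplus> (a \<ominus> h))"
          using Hc[OF h(1)] Hc[OF z(1)] ac cc by (simp add: minus_eq minus_add a_ac)
        moreover have "c \<oplus> (a \<ominus> h) \<in> D j" unfolding D_def using c a by force
        ultimately show False using z(2) j False * by auto
      qed
    qed
    ultimately show ?thesis by blast
  qed
qed

end

text \<open>The frame of the Baur--Monk argument. \<open>X0\<close> is the coset of
  \<open>H0\<close> to which the unknown is confined, and \<open>X j\<close> is the solution set of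
  the j-th equation, whose trace on \<open>X0\<close> is empty or a coset of H0 \<inter> H
  j.\<close>

locale coset_family = abelian_group G for G (structure) +
  fixes H0 :: "'a set" and H :: "nat \<Rightarrow> 'a set" and X0 :: "'a set" and X :: "nat \<Rightarrow> 'a set"
  assumes H0: "subgrp H0" and Hj: "subgrp (H j)"
    and X0_ne: "X0 \<noteq> {}" and X0_carrier: "X0 \<subseteq> carrier G"
    and X0_coset: "x \<in> X0 \<Longrightarrow> y \<in> carrier G \<Longrightarrow> y \<in> X0 \<longleftrightarrow> y \<ominus> x \<in> H0"
    and Xj_coset: "x \<in> X0 \<Longrightarrow> y \<in> X0 \<Longrightarrow> x \<in> X j \<Longrightarrow> y \<in> X j \<longleftrightarrow> y \<ominus> x \<in> H j"
begin

text \<open>With \<open>XA\<close> the solutions of the equations in \<open>A\<close>,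
  \<open>HA\<close> is the homogeneous version; \<open>CA\<close> adds the inequations in
  \<open>J\<close>.\<close>

definition HA where "HA A = {x \<in> H0. \<forall>j\<in>A. x \<in> H j}"
definition XA where "XA A = {x \<in> X0. \<forall>j\<in>A. x \<in> X j}"
definition CA where "CA A J = {x \<in> XA A. \<forall>j\<in>J. x \<notin> X j}"

lemma subgrp_HA: "subgrp (HA A)"
  using H0 Hj unfolding HA_def subgrp_def by auto

lemma HA_carrier: "HA A \<subseteq> carrier G" using subgrp_HA by (auto simp: subgrp_def)

lemma XA_carrier: "XA A \<subseteq> carrier G" using X0_carrier by (auto simp: XA_def)

lemma HA_antimono: "A \<subseteq> B \<Longrightarrow> HA B \<subseteq> HA A" by (auto simp: HA_def)

lemma XA_coset: "x \<in> XA A \<Longrightarrow> y \<in> carrier G \<Longrightarrow> y \<in> XA A \<longleftrightarrow> y \<ominus> x \<in> HA A"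
  using X0_coset[of x y] Xj_coset[of x y] unfolding XA_def HA_def by auto

lemma X_translate: "x \<in> XA A \<Longrightarrow> h \<in> HA A \<Longrightarrow> x \<oplus> h \<in> XA A"
proof -
  assume x: "x \<in> XA A" and h: "h \<in> HA A"
  have c: "x \<in> carrier G" "h \<in> carrier G" using x h XA_carrier HA_carrier by auto
  then show "x \<oplus> h \<in> XA A" using XA_coset[OF x, of "x \<oplus> h"] h by (simp add: add_diff_cancel)
qed

text \<open>Take \<open>x\<close> satisfying the inequations of finite index, \<open>J0\<close>.
  Moving \<open>x\<close> within N = HA (A \<union> J0) changes nothing for \<open>A\<close> and
  \<open>J0\<close>. As \<open>N\<close> has finite index in HA A, each remaining inequation
  excludes at most one coset of a subgroup of infinite index in \<open>N\<close>, and by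
  \<open>Neumann\<close> such cosets do not cover \<open>N\<close>.\<close>

lemma CA_drop_infinite:
  assumes J: "finite J" and ne: "CA A {j \<in> J. fin_index (HA A) (HA (insert j A))} \<noteq> {}"
  shows "CA A J \<noteq> {}"
proof -
  define J0 where "J0 = {j \<in> J. fin_index (HA A) (HA (insert j A))}"
  define N where "N = HA (A \<union> J0)"
  have "finite J0" using J by (simp add: J0_def)
  moreover have "\<And>j. j \<in> J0 \<Longrightarrow> fin_index (HA A) (HA (insert j A))" by (simp add: J0_def)
  ultimately have N_fin: "fin_index (HA A) N" unfolding N_def
  proof (induction J0 rule: finite_induct)
    case empty
    show ?case using fin_index_refl[OF HA_carrier] by simp
  next
    case (insert j F)
    have "HA (A \<union> insert j F) = HA (A \<union> F) \<inter> HA (insert j A)" by (auto simp: HA_def)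
    then show ?case using insert fin_index_Int[OF HA_carrier subgrp_HA subgrp_HA] by simp
  qed
  obtain x where x: "x \<in> CA A J0" using ne J0_def by blast
  then have xX: "x \<in> XA A" "x \<in> carrier G" using XA_carrier by (auto simp: CA_def)
  define B where "B = J - J0"
  define K where "K j = N \<inter> HA (insert j A)" for j
  \<comment> \<open>A representative of the coset that the j-th inequation excludes. If it excludes
    none, the choice is arbitrary; the intersection with \<open>N\<close> below then keeps it inside
    the group.\<close>
  define C where "C j = {SOME c. c \<in> N \<and> x \<oplus> c \<in> X j}" for j
  define C' where "C' j = C j \<inter> N" for j
  have "\<exists>h\<in>N. \<forall>j\<in>B. \<forall>c\<in>C' j. h \<ominus> c \<notin> K j"
  proof (rule Neumann)
    show "finite B" using J by (simp add: B_def)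
    show "subgrp N" by (simp add: N_def subgrp_HA)
    fix j assume j: "j \<in> B"
    show "subgrp (K j)" by (simp add: K_def N_def subgrp_HA subgrp_Int)
    show "K j \<subseteq> N" by (auto simp: K_def)
    show "finite (C' j)" "C' j \<subseteq> carrier G" using HA_carrier by (auto simp: C'_def C_def N_def)
    show "\<not> fin_index N (K j)"
    proof
      assume "fin_index N (K j)"
      then have "fin_index N (HA (insert j A))" by (rule fin_index_mono) (auto simp: K_def)
      then have "fin_index (HA A) (HA (insert j A))"
        using fin_index_trans[OF HA_carrier _ subgrp_HA N_fin] by (simp add: N_def subgrp_HA)
      then show False using j by (simp add: B_def J0_def)
    qed
  qed
  then obtain h where h: "h \<in> N" "\<forall>j\<in>B. \<forall>c\<in>C' j. h \<ominus> c \<notin> K j" by blast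
  have hA: "h \<in> HA A" "h \<in> carrier G"
    using h HA_antimono[of A "A \<union> J0"] HA_carrier[of A] by (auto simp: N_def)
  let ?y = "x \<oplus> h"
  have y: "?y \<in> XA A" using X_translate xX hA by blast
  have "?y \<notin> X j" if j: "j \<in> J" for j
  proof
    assume yj: "?y \<in> X j"
    show False
    proof (cases "j \<in> J0")
      case True
      have "x \<in> X0" "?y \<in> X0" "\<ominus> h \<in> H j"
        using xX y h True subgrp_minus[OF Hj] by (auto simp: XA_def N_def HA_def)
      moreover have "x \<ominus> ?y = \<ominus> h" using xX hA by (simp add: diff_add_self)
      ultimately have "x \<in> X j" using Xj_coset[of ?y x j] yj by simp
      then show False using x True by (auto simp: CA_def)
    next
      case False
      define c where "c = (SOME c. c \<in> N \<and> x \<oplus> c \<in> X j)"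
      have "c \<in> N \<and> x \<oplus> c \<in> X j"
        unfolding c_def by (rule someI[of _ h]) (use h yj in simp)
      then have c: "c \<in> N" "x \<oplus> c \<in> X j" by simp_all
      then have cA: "c \<in> HA A" "c \<in> carrier G"
        using HA_antimono[of A "A \<union> J0"] HA_carrier[of A] by (auto simp: N_def)
      have "x \<oplus> c \<in> XA (insert j A)" "?y \<in> XA (insert j A)"
        using X_translate[OF xX(1) cA(1)] c(2) y yj by (auto simp: XA_def)
      then have "?y \<ominus> (x \<oplus> c) \<in> HA (insert j A)"
        using XA_coset[of "x \<oplus> c" "insert j A" ?y] xX hA by simp
      moreover have "?y \<ominus> (x \<oplus> c) = h \<ominus> c"
        using xX hA cA by (simp add: add_diff_add)
      moreover have "h \<ominus> c \<in> N" using subgrp_diff[of N] h c subgrp_HA by (simp add: N_def)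
      ultimately have "h \<ominus> c \<in> K j" by (simp add: K_def)
      moreover have "c \<in> C' j" using c by (simp add: C'_def C_def c_def)
      ultimately show False using h(2) j False by (auto simp: B_def)
    qed
  qed
  then show ?thesis using y by (auto simp: CA_def)
qed

text \<open>Solutions split according to whether they satisfy the j-th equation, and a coset of
  \<open>N\<close> never meets both parts because \<open>N\<close> is contained in H j. So the
  numbers of cosets add up.\<close>

lemma card_CA_insert:
  assumes fin: "finite (cls N ` XA A)" and N: "N = HA D" and sub: "insert j (A \<union> J) \<subseteq> D"
  shows "card (cls N ` CA A (insert j J)) + card (cls N ` CA (insert j A) J) = card (cls N ` CA A J)"
proof -
  have "CA A J = CA A (insert j J) \<union> CA (insert j A) J" by (auto simp: CA_def XA_def)
  then have 1: "cls N ` CA A J = cls N ` CA A (insert j J) \<union> cls N ` CA (insert j A) J" by blast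
  have "cls N ` CA A (insert j J) \<inter> cls N ` CA (insert j A) J = {}"
  proof -
    have False if x: "x \<in> CA A (insert j J)" and y: "y \<in> CA (insert j A) J"
      and eq: "cls N x = cls N y" for x y
    proof -
      have c: "x \<in> X0" "y \<in> X0" "x \<in> carrier G" "y \<in> carrier G"
        using x y X0_carrier by (auto simp: CA_def XA_def)
      then have "x \<ominus> y \<in> H j" using eq cls_eq_iff[OF subgrp_HA] sub unfolding N by (auto simp: HA_def)
      then have "x \<in> X j" using c y Xj_coset[of y x j] by (auto simp: CA_def XA_def)
      then show False using x by (auto simp: CA_def)
    qed
    then show ?thesis by blast
  qed
  moreover have "finite (cls N ` CA A J)"
    by (rule finite_subset[OF _ fin]) (auto simp: CA_def)
  ultimately show ?thesis using 1 by (simp add: card_Un_disjoint)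
qed

text \<open>Translation by an element of \<open>XA A\<close> carries \<open>HA A\<close> onto
  \<open>XA A\<close> and cosets of \<open>N\<close> to cosets of \<open>N\<close>.\<close>

lemma card_XA:
  assumes "XA A \<noteq> {}" and N: "N = HA D"
  shows "card (cls N ` XA A) = card (cls N ` HA A)" "finite (cls N ` XA A) \<longleftrightarrow> finite (cls N ` HA A)"
proof -
  obtain x where x: "x \<in> XA A" using assms(1) by blast
  then have xc: "x \<in> carrier G" using XA_carrier[of A] by blast
  let ?g = "\<lambda>S. (\<lambda>h. x \<oplus> h) ` S"
  have cls: "cls N (x \<oplus> h) = ?g (cls N h)" if h: "h \<in> carrier G" for h
  proof -
    have 1: "y \<ominus> (x \<oplus> h) = (y \<ominus> x) \<ominus> h" if "y \<in> carrier G" for y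
      using that xc h by (simp add: minus_eq minus_add a_assoc)
    have 2: "x \<oplus> (y \<ominus> x) = y" if "y \<in> carrier G" for y
      using that xc diff_add_cancel[of y x] by (simp add: a_comm)
    have 3: "x \<oplus> z \<ominus> x = z" if "z \<in> carrier G" for z
      using that xc by (simp add: add_diff_cancel)
    show ?thesis
    proof
      show "cls N (x \<oplus> h) \<subseteq> ?g (cls N h)"
      proof
        fix y assume y: "y \<in> cls N (x \<oplus> h)"
        then have "y \<ominus> x \<in> cls N h" using 1[of y] xc by (simp add: cls_def)
        moreover have "y = x \<oplus> (y \<ominus> x)" using 2 y by (simp add: cls_def)
        ultimately show "y \<in> ?g (cls N h)" by (rule rev_image_eqI)
      qed
      show "?g (cls N h) \<subseteq> cls N (x \<oplus> h)"
        using 1 3 xc by (auto simp: cls_def)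
    qed
  qed
  have "XA A = ?g (HA A)"
  proof
    show "XA A \<subseteq> ?g (HA A)"
    proof
      fix y assume y: "y \<in> XA A"
      then have yc: "y \<in> carrier G" using XA_carrier[of A] by blast
      then have "y = x \<oplus> (y \<ominus> x)" using xc diff_add_cancel[of y x] by (simp add: a_comm)
      moreover have "y \<ominus> x \<in> HA A" using y XA_coset[OF x yc] by simp
      ultimately show "y \<in> ?g (HA A)" by (rule image_eqI)
    qed
    show "?g (HA A) \<subseteq> XA A" using X_translate[OF x] by auto
  qed
  then have "cls N ` XA A = ?g ` (cls N ` HA A)"
    using cls HA_carrier by (simp add: image_image subset_iff cong: image_cong_simp)
  moreover have "inj_on ?g (cls N ` HA A)"
  proof (rule inj_onI)
    fix S T assume "S \<in> cls N ` HA A" "T \<in> cls N ` HA A" "?g S = ?g T"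
    then show "S = T" using inj_on_image_eq_iff[of "\<lambda>h. x \<oplus> h" "carrier G" S T] xc
      by (auto simp: cls_def inj_on_def)
  qed
  ultimately show "card (cls N ` XA A) = card (cls N ` HA A)"
    "finite (cls N ` XA A) \<longleftrightarrow> finite (cls N ` HA A)"
    by (simp_all add: card_image finite_image_iff)
qed

end

text \<open>Inequations of infinite index are harmless by Neumann's lemma. Let \<open>D\<close>
  consist of \<open>A\<close> and the others. A solution set is then a union of finitely many cosets
  of HA D, whose number is computed by inclusion and exclusion from two data: the indices, and which
  systems of equations are solvable. Both agree for the two groups, hence so does the question
  whether the number is zero.\<close>

lemma coset_transfer:
  assumes F1: "coset_family G H0 H X0 X" and F2: "coset_family G' H0' H' X0' X'"
    and J: "finite J"
    and ne: "\<And>B. B \<subseteq> A \<union> J \<Longrightarrow> coset_family.XA X0 X B \<noteq> {} \<longleftrightarrow> coset_family.XA X0' X' B \<noteq> {}"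
    and idx: "\<And>B D n. B \<subseteq> D \<Longrightarrow> D \<subseteq> A \<union> J \<Longrightarrow>
      abelian_group.sep G n (coset_family.HA H0 H B) (coset_family.HA H0 H D) \<longleftrightarrow>
      abelian_group.sep G' n (coset_family.HA H0' H' B) (coset_family.HA H0' H' D)"
    and C: "coset_family.CA X0 X A J \<noteq> {}"
  shows "coset_family.CA X0' X' A J \<noteq> {}"
proof -
  interpret F: coset_family G H0 H X0 X by fact
  interpret F': coset_family G' H0' H' X0' X' by fact
  have fin_iff: "F.fin_index (F.HA B) (F.HA D) \<longleftrightarrow> F'.fin_index (F'.HA B) (F'.HA D)"
    if "B \<subseteq> D" "D \<subseteq> A \<union> J" for B D
    using idx[OF that] F.fin_index_iff_sep[OF F.subgrp_HA F.HA_carrier]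
      F'.fin_index_iff_sep[OF F'.subgrp_HA F'.HA_carrier] by simp
  define J0 where "J0 = {j \<in> J. F.fin_index (F.HA A) (F.HA (insert j A))}"
  have J0': "J0 = {j \<in> J. F'.fin_index (F'.HA A) (F'.HA (insert j A))}"
    unfolding J0_def using fin_iff[of A "insert _ A"] by auto
  have fJ0: "finite J0" using J by (simp add: J0_def)
  define D where "D = A \<union> J0"
  have DJ: "D \<subseteq> A \<union> J" by (auto simp: D_def J0_def)
  have finD: "F.fin_index (F.HA A) (F.HA D)"
  proof -
    have "F.fin_index (F.HA A) (F.HA (A \<union> E))" if "finite E" "E \<subseteq> J0" for E
      using that
    proof (induction E rule: finite_induct)
      case empty
      show ?case using F.fin_index_refl[OF F.HA_carrier] by simp
    next
      case (insert j E)
      have "F.HA (A \<union> insert j E) = F.HA (A \<union> E) \<inter> F.HA (insert j A)" by (auto simp: F.HA_def)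
      then show ?case
        using insert F.fin_index_Int[OF F.HA_carrier F.subgrp_HA F.subgrp_HA] J0_def by simp
    qed
    then show ?thesis using fJ0 by (simp add: D_def)
  qed
  have finB: "F.fin_index (F.HA B) (F.HA D)" if "A \<subseteq> B" for B
    by (rule F.fin_index_mono[OF finD F.HA_antimono[OF that] order_refl])
  have finB': "F'.fin_index (F'.HA B) (F'.HA D)" if "A \<subseteq> B" "B \<subseteq> D" for B
    using finB[OF that(1)] fin_iff[OF that(2) DJ] by simp
  have base: "card (F.cls (F.HA D) ` F.XA B) = card (F'.cls (F'.HA D) ` F'.XA B)"
    "finite (F.cls (F.HA D) ` F.XA B)" "finite (F'.cls (F'.HA D) ` F'.XA B)"
    if B: "A \<subseteq> B" "B \<subseteq> D" for B
  proof -
    have BJ: "B \<subseteq> A \<union> J" using B DJ by blast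
    have f: "finite (F.cls (F.HA D) ` F.HA B)" "finite (F'.cls (F'.HA D) ` F'.HA B)"
      using finB[OF B(1)] finB'[OF B] F.fin_index_iff_finite[OF F.subgrp_HA F.HA_carrier]
        F'.fin_index_iff_finite[OF F'.subgrp_HA F'.HA_carrier] by simp_all
    have "card (F.cls (F.HA D) ` F.HA B) = card (F'.cls (F'.HA D) ` F'.HA B)"
      using F.card_cls_eq_sep[OF F.subgrp_HA F.HA_carrier finB[OF B(1)]]
        F'.card_cls_eq_sep[OF F'.subgrp_HA F'.HA_carrier finB'[OF B]] idx[OF B(2) DJ] by simp
    then show "card (F.cls (F.HA D) ` F.XA B) = card (F'.cls (F'.HA D) ` F'.XA B)"
      "finite (F.cls (F.HA D) ` F.XA B)" "finite (F'.cls (F'.HA D) ` F'.XA B)"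
      using ne[OF BJ] F.card_XA[of B "F.HA D" D] F'.card_XA[of B "F'.HA D" D] f
      by (cases "F.XA B = {}"; simp)+
  qed
  \<comment> \<open>\<open>B\<close> is kept general because eliminating the inequation
    \<open>j\<close> also produces the system in which \<open>j\<close> has become an
    equation.\<close>
  have "card (F.cls (F.HA D) ` F.CA B E) = card (F'.cls (F'.HA D) ` F'.CA B E)"
    if "finite E" "E \<subseteq> J0" "A \<subseteq> B" "B \<subseteq> D" for B E
    using that
  proof (induction E arbitrary: B rule: finite_induct)
    case empty
    have "F.CA B {} = F.XA B" "F'.CA B {} = F'.XA B" by (auto simp: F.CA_def F'.CA_def)
    then show ?case using base empty by simp
  next
    case (insert j E)
    have j: "j \<in> D" using insert.prems by (auto simp: D_def)
    have sub: "insert j (B \<union> E) \<subseteq> D" using insert.prems by (auto simp: D_def)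
    have B: "A \<subseteq> B" "B \<subseteq> D" using insert.prems by auto
    note F.card_CA_insert[OF base(2)[OF B] refl sub] F'.card_CA_insert[OF base(3)[OF B] refl sub]
    moreover have "card (F.cls (F.HA D) ` F.CA (insert j B) E) = card (F'.cls (F'.HA D) ` F'.CA (insert j B) E)"
      "card (F.cls (F.HA D) ` F.CA B E) = card (F'.cls (F'.HA D) ` F'.CA B E)"
      using insert.IH[of "insert j B"] insert.IH[of B] B j insert.prems by auto
    ultimately show ?case by simp
  qed
  then have eq: "card (F.cls (F.HA D) ` F.CA A J0) = card (F'.cls (F'.HA D) ` F'.CA A J0)"
    using fJ0 by (simp add: D_def)
  have "F.CA A J0 \<noteq> {}" using C by (auto simp: F.CA_def J0_def)
  moreover have "finite (F.cls (F.HA D) ` F.CA A J0)"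
    by (rule finite_subset[OF _ base(2)[of A]]) (auto simp: F.CA_def D_def)
  ultimately have "card (F.cls (F.HA D) ` F.CA A J0) \<noteq> 0" by simp
  then have "F'.CA A J0 \<noteq> {}" using eq by (metis card.empty image_empty)
  then show ?thesis using F'.CA_drop_infinite[OF J] unfolding J0' by blast
qed

section \<open>Valued modules\<close>

context tau_chain
begin

text \<open>Outside the carrier the order is extended arbitrarily, so that order reasoning needs no
  membership side conditions.\<close>

definition junk_order :: "'d rel" where
  "junk_order = (SOME r. well_order_on UNIV r)"

definition cle :: "'d \<Rightarrow> 'd \<Rightarrow> bool" (infix \<open>\<sqsubseteq>\<close> 50) where
  "x \<sqsubseteq> y \<longleftrightarrow> (if x \<in> carrier \<Delta> \<and> y \<in> carrier \<Delta> then (x, y) \<in> le_rel \<Delta>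
    else if x \<notin> carrier \<Delta> \<and> y \<notin> carrier \<Delta> then (x, y) \<in> junk_order else y \<in> carrier \<Delta>)"

definition clt :: "'d \<Rightarrow> 'd \<Rightarrow> bool" (infix \<open>\<sqsubset>\<close> 50) where
  "x \<sqsubset> y \<longleftrightarrow> x \<sqsubseteq> y \<and> x \<noteq> y"

lemma le_rel_order:
  "x \<in> carrier \<Delta> \<Longrightarrow> (x, x) \<in> le_rel \<Delta>"
  "(x, y) \<in> le_rel \<Delta> \<Longrightarrow> (y, x) \<in> le_rel \<Delta> \<Longrightarrow> x = y"
  "(x, y) \<in> le_rel \<Delta> \<Longrightarrow> (y, z) \<in> le_rel \<Delta> \<Longrightarrow> (x, z) \<in> le_rel \<Delta>"
  "x \<in> carrier \<Delta> \<Longrightarrow> y \<in> carrier \<Delta> \<Longrightarrow> (x, y) \<in> le_rel \<Delta> \<or> (y, x) \<in> le_rel \<Delta>"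
  using linear_order unfolding order_on_defs refl_on_def antisym_def trans_def total_on_def
  by (metis)+

lemma junk_order:
  "(x, x) \<in> junk_order"
  "(x, y) \<in> junk_order \<Longrightarrow> (y, x) \<in> junk_order \<Longrightarrow> x = y"
  "(x, y) \<in> junk_order \<Longrightarrow> (y, z) \<in> junk_order \<Longrightarrow> (x, z) \<in> junk_order"
  "(x, y) \<in> junk_order \<or> (y, x) \<in> junk_order"
proof -
  have "well_order_on UNIV junk_order" unfolding junk_order_def by (rule someI_ex[OF well_order_on])
  then have "refl junk_order" "antisym junk_order" "trans junk_order" "total junk_order"
    unfolding well_order_on_def order_on_defs by auto
  then show "(x, x) \<in> junk_order"
    "(x, y) \<in> junk_order \<Longrightarrow> (y, x) \<in> junk_order \<Longrightarrow> x = y"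
    "(x, y) \<in> junk_order \<Longrightarrow> (y, z) \<in> junk_order \<Longrightarrow> (x, z) \<in> junk_order"
    "(x, y) \<in> junk_order \<or> (y, x) \<in> junk_order"
    unfolding refl_on_def antisym_def trans_def total_on_def by (metis UNIV_I)+
qed

sublocale ord: linorder cle clt
proof
  show "x \<sqsubset> y \<longleftrightarrow> x \<sqsubseteq> y \<and> \<not> y \<sqsubseteq> x" for x y
    unfolding clt_def cle_def using le_rel_order(2) junk_order(2) le_rel_order(1) junk_order(1)
    by (auto split: if_splits)
  show "x \<sqsubseteq> x" for x unfolding cle_def using le_rel_order(1) junk_order(1) by auto
  show "x \<sqsubseteq> z" if "x \<sqsubseteq> y" "y \<sqsubseteq> z" for x y z
    using that le_rel_order(3)[of x y z] junk_order(3)[of x y z] unfolding cle_def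
    by (auto split: if_splits)
  show "x = y" if "x \<sqsubseteq> y" "y \<sqsubseteq> x" for x y
    using that le_rel_order(2)[of x y] junk_order(2)[of x y] unfolding cle_def
    by (auto split: if_splits)
  show "x \<sqsubseteq> y \<or> y \<sqsubseteq> x" for x y
    using le_rel_order(4)[of x y] junk_order(4)[of x y] unfolding cle_def by auto
qed

lemma le_rel_iff: "x \<in> carrier \<Delta> \<Longrightarrow> y \<in> carrier \<Delta> \<Longrightarrow> (x, y) \<in> le_rel \<Delta> \<longleftrightarrow> x \<sqsubseteq> y"
  by (simp add: cle_def)

lemma chain_less_iff: "x \<in> carrier \<Delta> \<Longrightarrow> y \<in> carrier \<Delta> \<Longrightarrow> chain_less \<Delta> x y \<longleftrightarrow> x \<sqsubset> y"
  by (simp add: chain_less_def clt_def le_rel_iff)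

abbreviation \<tau> where "\<tau> \<equiv> tau \<Delta>"
abbreviation inf (\<open>\<infinity>\<close>) where "\<infinity> \<equiv> infty \<Delta>"

lemma le_inf[simp]: "x \<sqsubseteq> \<infinity>"
  using infty_max infty_closed by (simp add: cle_def)

lemma tau_less: "x \<in> carrier \<Delta> \<Longrightarrow> y \<in> carrier \<Delta> \<Longrightarrow> \<tau> x \<sqsubset> \<tau> y \<longleftrightarrow> x \<sqsubset> y"
proof -
  assume c: "x \<in> carrier \<Delta>" "y \<in> carrier \<Delta>"
  have *: "\<tau> x \<sqsubset> \<tau> y" if "x \<sqsubset> y" "x \<in> carrier \<Delta>" "y \<in> carrier \<Delta>" for x y
    using tau_strict_mono[of x y] that by (simp add: chain_less_iff tau_closed)
  show ?thesis using *[of x y] *[of y x] c ord.less_linear[of x y] ord.less_asym ord.less_irrefl by metis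
qed

lemma tau_le: "x \<in> carrier \<Delta> \<Longrightarrow> y \<in> carrier \<Delta> \<Longrightarrow> \<tau> x \<sqsubseteq> \<tau> y \<longleftrightarrow> x \<sqsubseteq> y"
  using tau_less[of y x] by (simp add: ord.not_less[symmetric])

lemma tau_eq: "x \<in> carrier \<Delta> \<Longrightarrow> y \<in> carrier \<Delta> \<Longrightarrow> \<tau> x = \<tau> y \<longleftrightarrow> x = y"
  using tau_le[of x y] tau_le[of y x] by (metis ord.order.eq_iff)

text \<open>The positions below, above and at the fixed point \<theta>. Such a point need not exist:
  \<open>mid\<close> may be empty, and \<theta> is then only the cut between the two other sets. By
  convention \<infinity> lies above.\<close>

definition neg where "neg x \<longleftrightarrow> \<tau> x \<sqsubset> x"
definition pos where "pos x \<longleftrightarrow> x \<sqsubset> \<tau> x \<or> x = \<infinity>"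
definition mid where "mid x \<longleftrightarrow> \<tau> x = x \<and> x \<noteq> \<infinity>"

lemma chain_pos_iff: "x \<in> carrier \<Delta> \<Longrightarrow> x \<in> chain_pos \<Delta> \<longleftrightarrow> pos x"
  by (auto simp: chain_pos_def pos_def chain_less_iff tau_closed)

lemma pos_inf[simp]: "pos \<infinity>" by (simp add: pos_def)

lemma neg_not_pos: "neg x \<Longrightarrow> \<not> pos x"
  using ord.less_asym tau_infty ord.less_irrefl unfolding neg_def pos_def by metis

lemma trichotomy: "neg x \<or> pos x \<or> mid x"
  unfolding neg_def pos_def mid_def using ord.less_linear by blast

lemma mid_iff: "mid x \<longleftrightarrow> \<not> neg x \<and> \<not> pos x"
  using trichotomy neg_not_pos unfolding mid_def neg_def pos_def by (metis ord.less_irrefl)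

lemma below_nonpos: "\<not> pos x \<Longrightarrow> y \<sqsubset> x \<Longrightarrow> x \<in> carrier \<Delta> \<Longrightarrow> y \<in> carrier \<Delta> \<Longrightarrow> neg y"
  using tau_below[of x y] unfolding pos_def neg_def
  by (simp add: chain_less_iff tau_closed le_rel_iff ord.not_less)

lemma neg_down: "neg x \<Longrightarrow> y \<sqsubseteq> x \<Longrightarrow> x \<in> carrier \<Delta> \<Longrightarrow> y \<in> carrier \<Delta> \<Longrightarrow> neg y"
  using below_nonpos[of x y] neg_not_pos ord.le_less by blast

lemma pos_up: "pos x \<Longrightarrow> x \<sqsubseteq> y \<Longrightarrow> x \<in> carrier \<Delta> \<Longrightarrow> y \<in> carrier \<Delta> \<Longrightarrow> pos y"
  using below_nonpos[of y x] neg_not_pos ord.le_less by blast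

lemma neg_less: "neg x \<Longrightarrow> \<not> neg y \<Longrightarrow> x \<in> carrier \<Delta> \<Longrightarrow> y \<in> carrier \<Delta> \<Longrightarrow> x \<sqsubset> y"
  using neg_down[of x y] ord.not_less by blast

lemma mid_unique: "mid x \<Longrightarrow> mid y \<Longrightarrow> x \<in> carrier \<Delta> \<Longrightarrow> y \<in> carrier \<Delta> \<Longrightarrow> x = y"
  using below_nonpos[of x y] below_nonpos[of y x] ord.less_linear[of x y] unfolding mid_iff by blast

lemma pow_tau_closed[simp]: "x \<in> carrier \<Delta> \<Longrightarrow> (\<tau> ^^ n) x \<in> carrier \<Delta>"
  by (induction n) (auto simp: tau_closed)

lemma neg_tau: "x \<in> carrier \<Delta> \<Longrightarrow> neg (\<tau> x) \<longleftrightarrow> neg x"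
  unfolding neg_def by (simp add: tau_less tau_closed)

lemma pos_tau: "x \<in> carrier \<Delta> \<Longrightarrow> pos (\<tau> x) \<longleftrightarrow> pos x"
  unfolding pos_def using tau_infty infty_closed tau_eq[of x \<infinity>] by (simp add: tau_less tau_closed)

lemma neg_pow: "x \<in> carrier \<Delta> \<Longrightarrow> neg ((\<tau> ^^ n) x) \<longleftrightarrow> neg x"
  by (induction n) (auto simp: neg_tau)

lemma pos_pow: "x \<in> carrier \<Delta> \<Longrightarrow> pos ((\<tau> ^^ n) x) \<longleftrightarrow> pos x"
  by (induction n) (auto simp: pos_tau)

lemma pow_eq: "x \<in> carrier \<Delta> \<Longrightarrow> y \<in> carrier \<Delta> \<Longrightarrow> (\<tau> ^^ n) x = (\<tau> ^^ n) y \<longleftrightarrow> x = y"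
  by (induction n) (auto simp: tau_eq)

lemma pow_inf: "(\<tau> ^^ n) \<infinity> = \<infinity>" by (induction n) (auto simp: tau_infty)

lemma pow_mid: "mid x \<Longrightarrow> (\<tau> ^^ n) x = x" by (induction n) (auto simp: mid_def)

lemma neg_pow_le: "x \<in> carrier \<Delta> \<Longrightarrow> neg x \<Longrightarrow> (\<tau> ^^ Suc n) x \<sqsubset> x"
proof (induction n)
  case 0 then show ?case by (simp add: neg_def)
next
  case (Suc n)
  then have "\<tau> ((\<tau> ^^ Suc n) x) \<sqsubset> (\<tau> ^^ Suc n) x" using neg_pow[of x "Suc n"] by (simp only: neg_def)
  then show ?case using Suc ord.less_trans by auto
qed

end

lemma (in abelian_group) diff_diff_add:
  assumes "a \<in> carrier G" "b \<in> carrier G" "c \<in> carrier G" "d \<in> carrier G"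
  shows "(a \<ominus> b \<ominus> (c \<ominus> d)) \<oplus> (b \<ominus> d) = a \<ominus> c"
proof -
  have "(a \<ominus> b \<ominus> (c \<ominus> d)) \<oplus> (b \<ominus> d) = (a \<ominus> b) \<oplus> ((b \<ominus> d) \<oplus> (d \<ominus> c))"
    using assms minus_diff[of c d] minus_eq[of "a \<ominus> b" "c \<ominus> d"] by (simp add: a_ac)
  then show ?thesis using assms by (simp add: diff_add_diff)
qed

section \<open>Arithmetic of the action and the valuation\<close>

locale vmod = skew_field K \<phi> + henselian_valued_module K \<phi> M \<Delta> v
  for K :: "('k, 'x) ring_scheme" and \<phi> :: "'k \<Rightarrow> 'k"
    and M :: "(nat \<Rightarrow> 'k, 'm, 'y) rmodule_scheme" (structure)
    and \<Delta> :: "('d, 'z) chain_scheme" and v :: "'m \<Rightarrow> 'd" +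
  assumes div: "divisible R M"
begin

declare ract_closed[simp, intro]

lemma val_closed[simp, intro]: "x \<in> carrier M \<Longrightarrow> v x \<in> carrier \<Delta>"
  using val_surj by blast

lemma act_zero[simp]: "x \<in> carrier M \<Longrightarrow> x \<cdot> \<zero>\<^bsub>R\<^esub> = \<zero>"
proof -
  assume x: "x \<in> carrier M"
  have "x \<cdot> \<zero>\<^bsub>R\<^esub> \<oplus> x \<cdot> \<zero>\<^bsub>R\<^esub> = x \<cdot> \<zero>\<^bsub>R\<^esub>"
    using ract_add_right[OF x R.zero_closed R.zero_closed] by simp
  then show ?thesis using x by (metis M.add.l_cancel_one' R.zero_closed ract_closed)
qed

lemma zero_act[simp]: "r \<in> carrier R \<Longrightarrow> \<zero> \<cdot> r = \<zero>"
proof -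
  assume r: "r \<in> carrier R"
  have "\<zero> \<cdot> r \<oplus> \<zero> \<cdot> r = \<zero> \<cdot> r"
    using ract_add_left[OF M.zero_closed M.zero_closed r] by simp
  then show ?thesis using r by (metis M.add.l_cancel_one' M.zero_closed ract_closed)
qed

lemma minus_act: "x \<in> carrier M \<Longrightarrow> r \<in> carrier R \<Longrightarrow> (\<ominus> x) \<cdot> r = \<ominus> (x \<cdot> r)"
  using ract_add_left[of "\<ominus> x" x r] by (metis M.a_inv_closed M.l_neg M.minus_equality ract_closed zero_act)

lemma diff_act:
  "x \<in> carrier M \<Longrightarrow> y \<in> carrier M \<Longrightarrow> r \<in> carrier R \<Longrightarrow> (x \<ominus> y) \<cdot> r = x \<cdot> r \<ominus> y \<cdot> r"
  by (simp add: M.minus_eq ract_add_left minus_act)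

lemma act_minus: "x \<in> carrier M \<Longrightarrow> r \<in> carrier R \<Longrightarrow> x \<cdot> (\<ominus>\<^bsub>R\<^esub> r) = \<ominus> (x \<cdot> r)"
  using ract_add_right[of x "\<ominus>\<^bsub>R\<^esub> r" r]
  by (metis R.a_inv_closed R.l_neg M.minus_equality ract_closed act_zero)

lemma act_diff:
  "x \<in> carrier M \<Longrightarrow> r \<in> carrier R \<Longrightarrow> s \<in> carrier R \<Longrightarrow> x \<cdot> (r \<ominus>\<^bsub>R\<^esub> s) = x \<cdot> r \<ominus> x \<cdot> s"
  by (simp add: M.minus_eq R.minus_eq ract_add_right act_minus)

lemma div_obtain:
  assumes "x \<in> carrier M" "r \<in> carrier R" "r \<noteq> \<zero>\<^bsub>R\<^esub>"
  obtains y where "y \<in> carrier M" "y \<cdot> r = x"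
proof -
  have "(\<lambda>x. x \<cdot> r) ` carrier M = carrier M" using div assms unfolding divisible_def by auto
  then have "x \<in> (\<lambda>x. x \<cdot> r) ` carrier M" using assms by simp
  then show ?thesis using that by auto
qed

lemma val_zero[simp]: "v \<zero> = \<infinity>" using val_infty[of \<zero>] by simp

lemma val_add_ge: "x \<in> carrier M \<Longrightarrow> y \<in> carrier M \<Longrightarrow> \<gamma> \<sqsubseteq> v x \<Longrightarrow> \<gamma> \<sqsubseteq> v y \<Longrightarrow> \<gamma> \<sqsubseteq> v (x \<oplus> y)"
  using val_add[of x y] unfolding chain_min_def
  by (auto simp: le_rel_iff split: if_splits intro: ord.order_trans)

lemma val_diff_ge: "x \<in> carrier M \<Longrightarrow> y \<in> carrier M \<Longrightarrow> \<gamma> \<sqsubseteq> v x \<Longrightarrow> \<gamma> \<sqsubseteq> v y \<Longrightarrow> \<gamma> \<sqsubseteq> v (x \<ominus> y)"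
  using val_diff[of x y] unfolding chain_min_def
  by (auto simp: le_rel_iff split: if_splits intro: ord.order_trans)

lemma val_add_gt: "x \<in> carrier M \<Longrightarrow> y \<in> carrier M \<Longrightarrow> \<gamma> \<sqsubset> v x \<Longrightarrow> \<gamma> \<sqsubset> v y \<Longrightarrow> \<gamma> \<sqsubset> v (x \<oplus> y)"
  using val_add[of x y] unfolding chain_min_def
  by (auto simp: le_rel_iff split: if_splits intro: ord.less_le_trans)

lemma val_diff_gt: "x \<in> carrier M \<Longrightarrow> y \<in> carrier M \<Longrightarrow> \<gamma> \<sqsubset> v x \<Longrightarrow> \<gamma> \<sqsubset> v y \<Longrightarrow> \<gamma> \<sqsubset> v (x \<ominus> y)"
  using val_diff[of x y] unfolding chain_min_def
  by (auto simp: le_rel_iff split: if_splits intro: ord.less_le_trans)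

lemma val_minus[simp]: "x \<in> carrier M \<Longrightarrow> v (\<ominus> x) = v x"
proof -
  have *: "v x \<sqsubseteq> v (\<ominus> x)" if "x \<in> carrier M" for x
    using val_diff_ge[of \<zero> x "v x"] that by (simp add: M.zero_diff)
  assume "x \<in> carrier M"
  then show ?thesis using *[of x] *[of "\<ominus> x"] by (simp add: ord.order.antisym)
qed

lemma val_diff_commute: "x \<in> carrier M \<Longrightarrow> y \<in> carrier M \<Longrightarrow> v (x \<ominus> y) = v (y \<ominus> x)"
  using val_minus[of "x \<ominus> y"] by (simp add: M.minus_diff)

lemma val_add_eq:
  assumes x: "x \<in> carrier M" and y: "y \<in> carrier M" and l: "v x \<sqsubset> v y"
  shows "v (x \<oplus> y) = v x" "v (y \<oplus> x) = v x"
proof -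
  have "v x \<sqsubseteq> v (x \<oplus> y)" using val_add_ge[OF x y] l by (simp add: ord.less_imp_le)
  moreover have "\<not> v x \<sqsubset> v (x \<oplus> y)"
  proof
    assume "v x \<sqsubset> v (x \<oplus> y)"
    then have "v x \<sqsubset> v (x \<oplus> y \<ominus> y)" using val_diff_gt[of "x \<oplus> y" y] x y l by simp
    moreover have "x \<oplus> y \<ominus> y = x" using x y M.add_diff_cancel[of y x] by (simp add: M.a_comm)
    ultimately show False by simp
  qed
  ultimately show "v (x \<oplus> y) = v x" using ord.less_le by metis
  then show "v (y \<oplus> x) = v x" using x y by (simp add: M.a_comm)
qed

lemma val_diff_eq:
  assumes "x \<in> carrier M" "y \<in> carrier M" "z \<in> carrier M" "v (x \<ominus> y) \<sqsubset> v (y \<ominus> z)"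
  shows "v (x \<ominus> z) = v (x \<ominus> y)"
  using val_add_eq(1)[of "x \<ominus> y" "y \<ominus> z"] assms M.diff_add_diff[of x y z] by simp

lemma val_diff_trans_ge:
  assumes "x \<in> carrier M" "y \<in> carrier M" "z \<in> carrier M" "\<gamma> \<sqsubseteq> v (x \<ominus> y)" "\<gamma> \<sqsubseteq> v (y \<ominus> z)"
  shows "\<gamma> \<sqsubseteq> v (x \<ominus> z)"
  using val_add_ge[of "x \<ominus> y" "y \<ominus> z"] assms M.diff_add_diff[of x y z] by simp

lemma val_diff_trans_gt:
  assumes "x \<in> carrier M" "y \<in> carrier M" "z \<in> carrier M" "\<gamma> \<sqsubset> v (x \<ominus> y)" "\<gamma> \<sqsubset> v (y \<ominus> z)"
  shows "\<gamma> \<sqsubset> v (x \<ominus> z)"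
  using val_add_gt[of "x \<ominus> y" "y \<ominus> z"] assms M.diff_add_diff[of x y z] by simp

lemma val_inf_iff: "x \<in> carrier M \<Longrightarrow> v x = \<infinity> \<longleftrightarrow> x = \<zero>"
  by (rule val_infty)

lemma act_decomp:
  assumes x: "x \<in> carrier M" and q: "q \<in> carrier R" and a: "a \<in> carrier K"
    and p: "p = skew_t K \<otimes>\<^bsub>R\<^esub> q \<oplus>\<^bsub>R\<^esub> skew_const K a"
  shows "x \<cdot> p = (x \<cdot> skew_t K) \<cdot> q \<oplus> x \<cdot> skew_const K a"
  using x q a unfolding p by (simp add: ract_add_right ract_mult)

lemma const_zero: "skew_const K \<zero>\<^bsub>K\<^esub> = \<zero>\<^bsub>R\<^esub>"
  by (rule R_eqI) (simp add: skew_const_def coeff_zero)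

section \<open>The effect of a scalar on values\<close>

lemma val_act_ge:
  assumes "r \<in> carrier R" "x \<in> carrier M" "\<not> neg (v x)"
  shows "v x \<sqsubseteq> v (x \<cdot> r)"
  using assms
proof (induction r arbitrary: x rule: skew_poly_induct)
  case zero
  then show ?case by simp
next
  case (step p q)
  have "v x \<sqsubseteq> \<tau> (v x)" using step.prems(2) by (simp add: neg_def ord.not_less)
  moreover have "\<tau> (v x) \<sqsubseteq> v ((x \<cdot> skew_t K) \<cdot> q)"
    using step.IH[of "x \<cdot> skew_t K"] step.prems val_t[of x] by (simp add: neg_tau)
  moreover have "v x \<sqsubseteq> v (x \<cdot> skew_const K (p 0))"
    using val_const[of x "p 0"] step by (cases "p 0 = \<zero>\<^bsub>K\<^esub>") (simp_all add: const_zero)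
  ultimately have "v x \<sqsubseteq> v ((x \<cdot> skew_t K) \<cdot> q \<oplus> x \<cdot> skew_const K (p 0))"
    using step by (intro val_add_ge) (auto intro: ord.order_trans)
  then show ?case using act_decomp[OF step.prems(1) step.hyps(2) _ step.hyps(4)] step.hyps(1) by simp
qed

text \<open>Above \<theta> the values of x, x t, x t^2, ... increase strictly for x \<noteq> 0, so
  the lowest non-zero term of \<open>r\<close> decides.\<close>

lemma val_act_pos:
  assumes "r \<in> carrier R" "x \<in> carrier M" "pos (v x)" "r \<noteq> \<zero>\<^bsub>R\<^esub>"
  shows "v (x \<cdot> r) = (\<tau> ^^ sord r) (v x)"
  using assms
proof (induction r arbitrary: x rule: skew_poly_induct)
  case zero
  then show ?case by simp
next
  case (step p q)
  have d: "x \<cdot> p = (x \<cdot> skew_t K) \<cdot> q \<oplus> x \<cdot> skew_const K (p 0)"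
    using act_decomp[OF step.prems(1) step.hyps(2) _ step.hyps(4)] step.hyps(1) by simp
  have t: "v (x \<cdot> skew_t K) = \<tau> (v x)" using val_t step.prems by simp
  show ?case
  proof (cases "x = \<zero>")
    case True
    then show ?thesis using step.hyps(1) by (simp add: pow_inf)
  next
    case nz: False
    show ?thesis
    proof (cases "p 0 = \<zero>\<^bsub>K\<^esub>")
      case True
      have q: "q \<noteq> \<zero>\<^bsub>R\<^esub>"
      proof
        assume "q = \<zero>\<^bsub>R\<^esub>"
        then have "p = \<zero>\<^bsub>R\<^esub>" using step.hyps(4) True by (simp add: const_zero)
        then show False using step.prems by simp
      qed
      have "v (x \<cdot> p) = v ((x \<cdot> skew_t K) \<cdot> q)" using d True step by (simp add: const_zero)
      also have "\<dots> = (\<tau> ^^ sord q) (\<tau> (v x))"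
        using step.IH[of "x \<cdot> skew_t K"] t step.prems q by (simp add: pos_tau)
      also have "\<dots> = (\<tau> ^^ sord p) (v x)"
        using sord_shift[OF step.hyps(1,2,3)] step.prems True by (simp add: funpow_swap1)
      finally show ?thesis .
    next
      case False
      have c: "v (x \<cdot> skew_const K (p 0)) = v x" using val_const step.prems step.hyps(1) False by simp
      have "v x \<sqsubset> \<tau> (v x)" using step.prems nz val_infty by (auto simp: pos_def)
      moreover have "\<tau> (v x) \<sqsubseteq> v ((x \<cdot> skew_t K) \<cdot> q)"
        using val_act_ge[of q "x \<cdot> skew_t K"] t step.prems step.hyps(2) neg_not_pos[of "v x"]
        by (auto simp: neg_tau)
      ultimately have "v x \<sqsubset> v ((x \<cdot> skew_t K) \<cdot> q)" using ord.less_le_trans by metis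
      then have "v (x \<cdot> p) = v x"
        using val_add_eq(2)[of "x \<cdot> skew_const K (p 0)" "(x \<cdot> skew_t K) \<cdot> q"] c d step by simp
      then show ?thesis using sord_shift[OF step.hyps(1,2,3)] step.prems False by simp
    qed
  qed
qed

text \<open>Below \<theta> the values of x, x t, x t^2, ... decrease strictly, so the term of
  highest degree decides.\<close>

lemma val_act_neg:
  assumes "r \<in> carrier R" "x \<in> carrier M" "neg (v x)" "r \<noteq> \<zero>\<^bsub>R\<^esub>"
  shows "v (x \<cdot> r) = (\<tau> ^^ sdeg r) (v x)"
  using assms
proof (induction r arbitrary: x rule: skew_poly_induct)
  case zero
  then show ?case by simp
next
  case (step p q)
  have d: "x \<cdot> p = (x \<cdot> skew_t K) \<cdot> q \<oplus> x \<cdot> skew_const K (p 0)"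
    using act_decomp[OF step.prems(1) step.hyps(2) _ step.hyps(4)] step.hyps(1) by simp
  have t: "v (x \<cdot> skew_t K) = \<tau> (v x)" using val_t step.prems by simp
  have c: "x \<cdot> skew_const K (p 0) \<in> carrier M" using step by simp
  have c': "v x \<sqsubseteq> v (x \<cdot> skew_const K (p 0))"
    using val_const[of x "p 0"] step by (cases "p 0 = \<zero>\<^bsub>K\<^esub>") (simp_all add: const_zero)
  show ?case
  proof (cases "q = \<zero>\<^bsub>R\<^esub>")
    case True
    then have "p = skew_const K (p 0)" using step.hyps(1,4) by simp
    then have "p 0 \<noteq> \<zero>\<^bsub>K\<^esub>" using step.prems const_zero by metis
    moreover have "(x \<cdot> skew_t K) \<cdot> q = \<zero>" using True step.prems(1) by simp
    ultimately have "v (x \<cdot> p) = v x"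
      using d step.prems(1) step.hyps(1) val_const c by simp
    then show ?thesis using sdeg_shift[OF step.hyps(1,2,3)] True by simp
  next
    case False
    have e: "v ((x \<cdot> skew_t K) \<cdot> q) = (\<tau> ^^ sdeg p) (v x)"
      using step.IH[of "x \<cdot> skew_t K"] t step.prems False sdeg_shift[OF step.hyps(1,2,3)]
      by (simp add: neg_tau funpow_swap1)
    have "(\<tau> ^^ sdeg p) (v x) \<sqsubset> v x"
      using neg_pow_le[of "v x" "sdeg q"] step.prems False sdeg_shift[OF step.hyps(1,2,3)] by simp
    then have "v ((x \<cdot> skew_t K) \<cdot> q) \<sqsubset> v (x \<cdot> skew_const K (p 0))"
      using e c' ord.less_le_trans by metis
    then show ?thesis using val_add_eq(1)[OF _ c, of "(x \<cdot> skew_t K) \<cdot> q"] d e step by simp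
  qed
qed

text \<open>The map that \<open>r\<close> induces on values different from \<theta>. At \<theta> it
  is set to \<theta>, although v(x r) may exceed \<theta> when v(x) = \<theta>.\<close>

definition lam :: "(nat \<Rightarrow> 'k) \<Rightarrow> 'd \<Rightarrow> 'd" where
  "lam r \<gamma> = (if neg \<gamma> then (\<tau> ^^ sdeg r) \<gamma> else (\<tau> ^^ sord r) \<gamma>)"

lemma lam_closed[simp]: "\<gamma> \<in> carrier \<Delta> \<Longrightarrow> lam r \<gamma> \<in> carrier \<Delta>" by (simp add: lam_def)

lemma neg_lam: "\<gamma> \<in> carrier \<Delta> \<Longrightarrow> neg (lam r \<gamma>) \<longleftrightarrow> neg \<gamma>" by (simp add: lam_def neg_pow)

lemma pos_lam: "\<gamma> \<in> carrier \<Delta> \<Longrightarrow> pos (lam r \<gamma>) \<longleftrightarrow> pos \<gamma>" by (simp add: lam_def pos_pow)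

lemma lam_mid: "mid \<gamma> \<Longrightarrow> lam r \<gamma> = \<gamma>" by (simp add: lam_def pow_mid)

lemma lam_inj:
  assumes "\<gamma> \<in> carrier \<Delta>" "\<delta> \<in> carrier \<Delta>" "lam r \<gamma> = lam r \<delta>" shows "\<gamma> = \<delta>"
proof -
  have "neg \<gamma> \<longleftrightarrow> neg \<delta>" using neg_lam assms by metis
  then show ?thesis using assms unfolding lam_def by (auto simp: pow_eq split: if_splits)
qed

text \<open>This is divisibility by \<open>t\<close>, seen on the value set.\<close>

lemma tau_surj: "\<gamma> \<in> carrier \<Delta> \<Longrightarrow> \<exists>\<delta>\<in>carrier \<Delta>. \<tau> \<delta> = \<gamma>"
proof -
  assume "\<gamma> \<in> carrier \<Delta>"
  then obtain x where x: "x \<in> carrier M" "v x = \<gamma>" using val_surj by (metis imageE)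
  have "skew_t K \<noteq> \<zero>\<^bsub>R\<^esub>" by (rule nonzeroI[of _ 1]) (simp add: skew_t_def)
  then obtain y where "y \<in> carrier M" "y \<cdot> skew_t K = x" using div_obtain[OF x(1) t_closed] by blast
  then show ?thesis using x val_t[of y] by (intro bexI[of _ "v y"]) auto
qed

lemma pow_tau_surj: "\<gamma> \<in> carrier \<Delta> \<Longrightarrow> \<exists>\<delta>\<in>carrier \<Delta>. (\<tau> ^^ n) \<delta> = \<gamma>"
proof (induction n arbitrary: \<gamma>)
  case 0 then show ?case by auto
next
  case (Suc n)
  obtain \<delta> where "\<delta> \<in> carrier \<Delta>" "\<tau> \<delta> = \<gamma>" using tau_surj Suc by blast
  moreover obtain \<epsilon> where "\<epsilon> \<in> carrier \<Delta>" "(\<tau> ^^ n) \<epsilon> = \<delta>" using Suc calculation by blast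
  ultimately show ?case by auto
qed

text \<open>Together with \<open>lam_inj\<close> this allows every value of x r + e, even \<theta>,
  to be written as \<open>lam r\<close> of a unique normalised value.\<close>

lemma lam_surj: "\<gamma> \<in> carrier \<Delta> \<Longrightarrow> \<exists>\<delta>\<in>carrier \<Delta>. lam r \<delta> = \<gamma>"
proof -
  assume g: "\<gamma> \<in> carrier \<Delta>"
  show ?thesis
  proof (cases "neg \<gamma>")
    case True
    obtain \<delta> where "\<delta> \<in> carrier \<Delta>" "(\<tau> ^^ sdeg r) \<delta> = \<gamma>" using pow_tau_surj g by blast
    then show ?thesis using True neg_pow[of \<delta> "sdeg r"] by (intro bexI[of _ \<delta>]) (auto simp: lam_def)
  next
    case False
    obtain \<delta> where "\<delta> \<in> carrier \<Delta>" "(\<tau> ^^ sord r) \<delta> = \<gamma>" using pow_tau_surj g by blast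
    then show ?thesis using False neg_pow[of \<delta> "sord r"] by (intro bexI[of _ \<delta>]) (auto simp: lam_def)
  qed
qed

lemma val_act:
  assumes "r \<in> carrier R" "x \<in> carrier M" "\<not> mid (v x)" "r \<noteq> \<zero>\<^bsub>R\<^esub>"
  shows "v (x \<cdot> r) = lam r (v x)"
  using val_act_pos[OF assms(1,2)] val_act_neg[OF assms(1,2)] assms(3,4) neg_not_pos
  by (auto simp: lam_def mid_iff)

section \<open>The residue module \<open>ge0\<close>/\<open>gt0\<close> at \<theta>\<close>

definition ge0 where "ge0 = {x \<in> carrier M. \<not> neg (v x)}"
definition gt0 where "gt0 = {x \<in> carrier M. pos (v x)}"

lemma gt0_sub_ge0: "gt0 \<subseteq> ge0" using neg_not_pos by (auto simp: gt0_def ge0_def)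

lemma ge0_carrier: "x \<in> ge0 \<Longrightarrow> x \<in> carrier M" by (simp add: ge0_def)
lemma gt0_carrier: "x \<in> gt0 \<Longrightarrow> x \<in> carrier M" by (simp add: gt0_def)

lemma subgrp_gt0: "M.subgrp gt0"
  unfolding M.subgrp_def
proof (intro conjI ballI)
  fix x y assume *: "x \<in> gt0" "y \<in> gt0"
  then have c: "x \<in> carrier M" "y \<in> carrier M" "pos (v x)" "pos (v y)" by (auto simp: gt0_def)
  show "x \<ominus> y \<in> gt0"
    using val_diff_ge[OF c(1,2), of "v x"] val_diff_ge[OF c(1,2), of "v y"] ord.linear[of "v x" "v y"]
      pos_up[of "v x" "v (x \<ominus> y)"] pos_up[of "v y" "v (x \<ominus> y)"] c unfolding gt0_def by auto
qed (auto simp: gt0_def)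

lemma subgrp_ge0: "M.subgrp ge0"
  unfolding M.subgrp_def
proof (intro conjI ballI)
  fix x y assume *: "x \<in> ge0" "y \<in> ge0"
  then have c: "x \<in> carrier M" "y \<in> carrier M" "\<not> neg (v x)" "\<not> neg (v y)" by (auto simp: ge0_def)
  show "x \<ominus> y \<in> ge0"
    using val_diff_ge[OF c(1,2), of "v x"] val_diff_ge[OF c(1,2), of "v y"] ord.linear[of "v x" "v y"]
      neg_down[of "v (x \<ominus> y)" "v x"] neg_down[of "v (x \<ominus> y)" "v y"] c unfolding ge0_def by auto
qed (auto simp: ge0_def neg_def tau_infty)

lemma ge0_act: "x \<in> ge0 \<Longrightarrow> r \<in> carrier R \<Longrightarrow> x \<cdot> r \<in> ge0"
  using val_act_ge[of r x] neg_down[of "v (x \<cdot> r)" "v x"] by (auto simp: ge0_def)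

lemma gt0_act: "x \<in> gt0 \<Longrightarrow> r \<in> carrier R \<Longrightarrow> x \<cdot> r \<in> gt0"
  using val_act_ge[of r x] pos_up[of "v x" "v (x \<cdot> r)"] neg_not_pos by (auto simp: gt0_def)

text \<open>There is no torsion above \<theta>, because \<tau> is injective and fixes
  \<infinity>.\<close>

lemma gt0_act_iff_zero:
  assumes "x \<in> gt0" "r \<in> carrier R" "r \<noteq> \<zero>\<^bsub>R\<^esub>" "x \<cdot> r = \<zero>" shows "x = \<zero>"
proof -
  have c: "x \<in> carrier M" "pos (v x)" using assms by (auto simp: gt0_def)
  have "(\<tau> ^^ sord r) (v x) = v (x \<cdot> r)"
    by (rule val_act_pos[OF assms(2) c assms(3), symmetric])
  also have "\<dots> = (\<tau> ^^ sord r) \<infinity>" by (simp only: assms(4) val_zero pow_inf)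
  finally have "(\<tau> ^^ sord r) (v x) = (\<tau> ^^ sord r) \<infinity>" .
  then have "v x = \<infinity>" using c pow_eq[of "v x" \<infinity>] infty_closed by blast
  then show ?thesis using c val_infty by simp
qed

text \<open>Factors \<open>t\<close> are removed by divisibility of the whole module, since v(z t) =
  \<tau>(v(z)) is positive only if v(z) is; for the separable factor that remains, the claim is
  henselianity. As \<open>gt0\<close> has no torsion, the root is also unique.\<close>

lemma gt0_div:
  assumes "r \<in> carrier R" "x \<in> gt0" "r \<noteq> \<zero>\<^bsub>R\<^esub>"
  shows "\<exists>y\<in>gt0. y \<cdot> r = x"
  using assms
proof (induction r arbitrary: x rule: skew_poly_induct)
  case zero
  then show ?case by simp
next
  case (step p q)
  show ?case
  proof (cases "p 0 = \<zero>\<^bsub>K\<^esub>")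
    case True
    then have p: "p = skew_t K \<otimes>\<^bsub>R\<^esub> q" using step.hyps(2,4) by (simp add: const_zero)
    then have "q \<noteq> \<zero>\<^bsub>R\<^esub>" using step.prems by auto
    then obtain y where y: "y \<in> gt0" "y \<cdot> q = x" using step by blast
    have "skew_t K \<noteq> \<zero>\<^bsub>R\<^esub>" by (rule nonzeroI[of _ 1]) (simp add: skew_t_def)
    then obtain z where z: "z \<in> carrier M" "z \<cdot> skew_t K = y"
      using div_obtain[OF gt0_carrier[OF y(1)] t_closed] by blast
    then have "z \<in> gt0" using y(1) val_t[of z] by (auto simp: gt0_def pos_tau)
    moreover have "z \<cdot> p = x" unfolding p using z y step.hyps(2) by (simp add: ract_mult)
    ultimately show ?thesis by blast
  next
    case False
    then show ?thesis using henselian[OF step.hyps(1), of x] step.prems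
      by (auto simp: separable_def gt0_def chain_pos_iff)
  qed
qed

text \<open>A root of an element of value \<ge> \<theta> cannot have value below \<theta>, because
  non-zero scalars keep negative values negative.\<close>

lemma ge0_div:
  assumes "r \<in> carrier R" "x \<in> ge0" "r \<noteq> \<zero>\<^bsub>R\<^esub>"
  shows "\<exists>y\<in>ge0. y \<cdot> r = x"
proof -
  obtain y where y: "y \<in> carrier M" "y \<cdot> r = x" using div_obtain assms ge0_carrier by metis
  have "y \<in> ge0"
  proof (rule ccontr)
    assume "y \<notin> ge0"
    then have n: "neg (v y)" using y by (simp add: ge0_def)
    then have "neg (v x)" using val_act_neg[OF assms(1) y(1) n assms(3)] y neg_pow[of "v y"] by simp
    then show False using assms by (simp add: ge0_def)
  qed
  then show ?thesis using y by blast
qed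

lemma act_ge0_imp:
  assumes "r \<in> carrier R" "x \<in> carrier M" "r \<noteq> \<zero>\<^bsub>R\<^esub>" "x \<cdot> r \<in> ge0" shows "x \<in> ge0"
proof (rule ccontr)
  assume "x \<notin> ge0"
  then have n: "neg (v x)" using assms by (simp add: ge0_def)
  then have "neg (v (x \<cdot> r))" using val_act_neg[OF assms(1,2) n assms(3)] assms neg_pow[of "v x"] by simp
  then show False using assms by (simp add: ge0_def)
qed

text \<open>The annihilator of \<open>r\<close> in the residue module, pulled back to
  \<open>ge0\<close>.\<close>

definition Pset where "Pset r = {x \<in> ge0. x \<cdot> r \<in> gt0}"

text \<open>As \<open>gt0\<close> is uniquely divisible, every class of \<open>Pset r\<close> modulo
  \<open>gt0\<close> contains exactly one element annihilated by \<open>r\<close>. The annihilator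
  in the residue module is thus the annihilator in the whole module, and congruence modulo
  \<open>Pset g\<close> becomes equality after multiplication by \<open>g\<close>.\<close>

lemma sep_Pset_torsion:
  assumes r: "r \<in> carrier R" "r \<noteq> \<zero>\<^bsub>R\<^esub>" and g: "g \<in> carrier R"
  shows "M.sep n (Pset r) (Pset g) \<longleftrightarrow>
    (\<exists>S\<subseteq>{x \<in> carrier M. x \<cdot> r = \<zero>}. finite S \<and> card S = n \<and> inj_on (\<lambda>x. x \<cdot> g) S)"
proof -
  let ?T = "{x \<in> carrier M. x \<cdot> r = \<zero>}"
  have ann: "x \<in> ge0" if "x \<in> ?T" for x
    using act_ge0_imp[OF r(1) _ r(2)] that M.subgrp_zero[OF subgrp_ge0] by auto
  have sep_T: "x \<cdot> g = y \<cdot> g \<longleftrightarrow> x \<ominus> y \<in> Pset g" if xy: "x \<in> ?T" "y \<in> ?T" for x y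
  proof -
    have c: "x \<in> carrier M" "y \<in> carrier M" "x \<ominus> y \<in> ge0"
      using xy ann M.subgrp_diff[OF subgrp_ge0] by auto
    have e: "x \<cdot> g = y \<cdot> g \<longleftrightarrow> (x \<ominus> y) \<cdot> g = \<zero>"
      using c g M.eq_iff_diff_zero[of "x \<cdot> g" "y \<cdot> g"] by (simp add: diff_act)
    have "(x \<ominus> y) \<cdot> g = \<zero>" if w: "(x \<ominus> y) \<cdot> g \<in> gt0"
    proof (cases "g = \<zero>\<^bsub>R\<^esub>")
      case True
      then show ?thesis using c by simp
    next
      case False
      \<comment> \<open>As g s = r u, the scalar \<open>s\<close> annihilates (x - y) g; but a
        non-zero element of \<open>gt0\<close> is annihilated by no non-zero scalar.\<close>
      obtain s u where su: "s \<in> carrier R" "u \<in> carrier R" "g \<otimes>\<^bsub>R\<^esub> s = r \<otimes>\<^bsub>R\<^esub> u" "g \<otimes>\<^bsub>R\<^esub> s \<noteq> \<zero>\<^bsub>R\<^esub>"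
        using right_Ore[OF g False r] by (elim bexE conjE)
      have "s \<noteq> \<zero>\<^bsub>R\<^esub>" using su(4) g by auto
      have "((x \<ominus> y) \<cdot> g) \<cdot> s = (x \<ominus> y) \<cdot> (r \<otimes>\<^bsub>R\<^esub> u)"
        using c g su by (simp add: ract_mult[symmetric])
      also have "\<dots> = ((x \<ominus> y) \<cdot> r) \<cdot> u" using c r su by (simp add: ract_mult)
      also have "\<dots> = \<zero>" using c xy r su by (simp add: diff_act)
      finally show ?thesis using gt0_act_iff_zero[OF w su(1) \<open>s \<noteq> \<zero>\<^bsub>R\<^esub>\<close>] by simp
    qed
    then show ?thesis using e c M.subgrp_zero[OF subgrp_gt0] by (auto simp: Pset_def)
  qed
  show ?thesis
  proof
    assume "M.sep n (Pset r) (Pset g)"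
    then obtain S where S: "S \<subseteq> Pset r" "finite S" "card S = n"
      "\<And>x y. x \<in> S \<Longrightarrow> y \<in> S \<Longrightarrow> x \<noteq> y \<Longrightarrow> x \<ominus> y \<notin> Pset g" unfolding M.sep_def by auto
    \<comment> \<open>Subtracting z from \<open>x\<close> will give an element of the same class
      modulo \<open>gt0\<close> that is annihilated by \<open>r\<close>.\<close>
    have "\<exists>z. z \<in> gt0 \<and> z \<cdot> r = x \<cdot> r" if "x \<in> S" for x
      using gt0_div[OF r(1) _ r(2), of "x \<cdot> r"] S(1) that by (auto simp: Pset_def)
    then obtain z where z: "\<And>x. x \<in> S \<Longrightarrow> z x \<in> gt0 \<and> z x \<cdot> r = x \<cdot> r" by metis
    have zc: "x \<in> carrier M" "z x \<in> carrier M" "x \<ominus> z x \<in> ?T" if "x \<in> S" for x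
    proof -
      show 1: "x \<in> carrier M" "z x \<in> carrier M"
        using that z[OF that] S(1) ge0_carrier gt0_carrier by (auto simp: Pset_def)
      then show "x \<ominus> z x \<in> ?T" using z[OF that] r by (simp add: diff_act)
    qed
    have inj: "x = y" if xy: "x \<in> S" "y \<in> S" "(x \<ominus> z x) \<cdot> g = (y \<ominus> z y) \<cdot> g" for x y
    proof (rule ccontr)
      assume ne: "x \<noteq> y"
      have "x \<ominus> z x \<ominus> (y \<ominus> z y) \<in> Pset g" using sep_T zc xy by blast
      moreover have "z x \<ominus> z y \<in> Pset g"
        using z[OF xy(1)] z[OF xy(2)] M.subgrp_diff[OF subgrp_gt0, of "z x" "z y"] gt0_sub_ge0 gt0_act[OF _ g]
        by (auto simp: Pset_def)
      moreover have "M.subgrp (Pset g)"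
        unfolding M.subgrp_def Pset_def
        using M.subgrp_zero[OF subgrp_ge0] M.subgrp_diff[OF subgrp_ge0] M.subgrp_zero[OF subgrp_gt0]
          M.subgrp_diff[OF subgrp_gt0] ge0_carrier g by (auto simp: diff_act)
      ultimately have "(x \<ominus> z x \<ominus> (y \<ominus> z y)) \<oplus> (z x \<ominus> z y) \<in> Pset g"
        using M.subgrp_add by blast
      moreover have "(x \<ominus> z x \<ominus> (y \<ominus> z y)) \<oplus> (z x \<ominus> z y) = x \<ominus> y"
        using zc[OF xy(1)] zc[OF xy(2)] by (simp add: M.diff_diff_add)
      ultimately show False using S(4) xy ne by auto
    qed
    let ?S = "(\<lambda>x. x \<ominus> z x) ` S"
    have "inj_on (\<lambda>x. x \<ominus> z x) S" using inj by (intro inj_onI) auto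
    then have "card ?S = n" using S by (simp add: card_image)
    moreover have "inj_on (\<lambda>x. x \<cdot> g) ?S" using inj by (auto simp: inj_on_def)
    moreover have "?S \<subseteq> ?T" using zc by auto
    ultimately show "\<exists>S\<subseteq>?T. finite S \<and> card S = n \<and> inj_on (\<lambda>x. x \<cdot> g) S"
      using S(2) by (intro exI[of _ ?S]) auto
  next
    assume "\<exists>S\<subseteq>?T. finite S \<and> card S = n \<and> inj_on (\<lambda>x. x \<cdot> g) S"
    then obtain S where S: "S \<subseteq> ?T" "finite S" "card S = n" "inj_on (\<lambda>x. x \<cdot> g) S" by blast
    have "S \<subseteq> Pset r" using S(1) ann M.subgrp_zero[OF subgrp_gt0] by (auto simp: Pset_def)
    moreover have "\<forall>x\<in>S. \<forall>y\<in>S. x \<noteq> y \<longrightarrow> x \<ominus> y \<notin> Pset g"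
      using sep_T S(1,4) by (auto simp: inj_on_def subset_iff)
    ultimately show "M.sep n (Pset r) (Pset g)" using S unfolding M.sep_def by (intro exI[of _ S]) simp
  qed
qed

text \<open>If the residue module at \<open>\<theta>\<close> were finite, two powers of \<open>t\<close> would act on it in the same way,
  so that their difference would annihilate it, against divisibility.\<close>

lemma residue_infinite:
  assumes "b \<in> ge0" "b \<notin> gt0"
  shows "infinite (M.cls gt0 ` ge0)"
proof
  assume fin: "finite (M.cls gt0 ` ge0)"
  have cls: "M.cls gt0 x = M.cls gt0 y \<longleftrightarrow> x \<ominus> y \<in> gt0" if "x \<in> ge0" "y \<in> ge0" for x y
    using that M.cls_eq_iff[OF subgrp_gt0] ge0_carrier by simp
  obtain C where C: "C \<subseteq> ge0" "finite C" "M.cls gt0 ` ge0 = M.cls gt0 ` C"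
    using finite_subset_image[OF fin order_refl] by auto
  define F where "F i = (\<lambda>x\<in>C. M.cls gt0 (x \<cdot> skew_monom i \<one>\<^bsub>K\<^esub>))" for i :: nat
  have "F i \<in> C \<rightarrow>\<^sub>E M.cls gt0 ` ge0" for i
    using C(1) ge0_act[OF _ monom_closed] unfolding F_def by (auto intro!: imageI)
  then have "finite (range F)"
    using finite_PiE[OF C(2), of "\<lambda>_. M.cls gt0 ` ge0"] fin by (auto intro: finite_subset)
  then have "\<not> inj F" using finite_imageD[of F UNIV] by auto
  then obtain i j where ij: "F i = F j" "i \<noteq> j" by (auto simp: inj_def)
  let ?r = "skew_monom i \<one>\<^bsub>K\<^esub> \<ominus>\<^bsub>R\<^esub> skew_monom j \<one>\<^bsub>K\<^esub>"
  have rR: "?r \<in> carrier R" by simp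
  have "?r i = skew_monom i \<one>\<^bsub>K\<^esub> i \<ominus>\<^bsub>K\<^esub> skew_monom j \<one>\<^bsub>K\<^esub> i"
    by (rule coeff_diff) simp_all
  then have "?r i = \<one>\<^bsub>K\<^esub>" using ij(2) by (simp add: skew_monom_def K.minus_eq)
  then have r0: "?r \<noteq> \<zero>\<^bsub>R\<^esub>" by (intro nonzeroI[of _ i]) simp
  have kill: "x \<cdot> ?r \<in> gt0" if x: "x \<in> ge0" for x
  proof -
    have "M.cls gt0 x \<in> M.cls gt0 ` C" using C(3) x by blast
    then obtain c where c: "c \<in> C" "M.cls gt0 x = M.cls gt0 c" by auto
    then have d: "x \<ominus> c \<in> gt0" using cls x C(1) by auto
    have cg: "c \<in> ge0" "c \<in> carrier M" "x \<in> carrier M" using c C(1) ge0_carrier x by auto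
    have "M.cls gt0 (c \<cdot> skew_monom i \<one>\<^bsub>K\<^esub>) = M.cls gt0 (c \<cdot> skew_monom j \<one>\<^bsub>K\<^esub>)"
      using fun_cong[OF ij(1), of c] c by (simp add: F_def)
    then have 1: "c \<cdot> ?r \<in> gt0"
      using cls ge0_act[OF cg(1) monom_closed] cg(2) by (simp add: act_diff)
    have 2: "(x \<ominus> c) \<cdot> ?r \<in> gt0" using gt0_act[OF d rR] .
    have "(x \<ominus> c) \<cdot> ?r \<oplus> c \<cdot> ?r = x \<cdot> ?r"
      using cg rR ract_add_left[of "x \<ominus> c" c ?r] M.diff_add_cancel[of x c] by simp
    then show ?thesis using M.subgrp_add[OF subgrp_gt0 2 1] by simp
  qed
  obtain x where "x \<in> ge0" "x \<cdot> ?r = b" using ge0_div[OF rR assms(1) r0] by blast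
  then show False using kill assms(2) by auto
qed

text \<open>Multiplication by \<open>g\<close> maps \<open>ge0\<close> onto itself and identifies
  ge0/Pset g with ge0/gt0, which is infinite. The element \<open>b\<close> witnesses that \<theta>
  is a value.\<close>

lemma sep_ge0_Pset:
  assumes "b \<in> ge0" "b \<notin> gt0" "g \<in> carrier R" "g \<noteq> \<zero>\<^bsub>R\<^esub>"
  shows "M.sep n ge0 (Pset g)"
proof -
  have "M.sep n ge0 gt0"
    using M.sep_iff_card[OF subgrp_gt0, of ge0] residue_infinite[OF assms(1,2)] ge0_carrier by blast
  then obtain S where S: "S \<subseteq> ge0" "finite S" "card S = n"
    "\<And>x y. x \<in> S \<Longrightarrow> y \<in> S \<Longrightarrow> x \<noteq> y \<Longrightarrow> x \<ominus> y \<notin> gt0" unfolding M.sep_def by auto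
  have "\<exists>y. y \<in> ge0 \<and> y \<cdot> g = x" if "x \<in> S" for x
    using ge0_div[OF assms(3) _ assms(4), of x] S(1) that by auto
  then obtain h where h: "\<And>x. x \<in> S \<Longrightarrow> h x \<in> ge0 \<and> h x \<cdot> g = x" by metis
  have "inj_on h S" using h by (intro inj_onI) metis
  moreover have "h x \<ominus> h y \<notin> Pset g" if "x \<in> S" "y \<in> S" "h x \<noteq> h y" for x y
  proof -
    have "(h x \<ominus> h y) \<cdot> g = x \<ominus> y" using h that ge0_carrier assms(3) by (simp add: diff_act)
    moreover have "x \<noteq> y" using that by auto
    ultimately show ?thesis using S(4) that by (simp add: Pset_def)
  qed
  ultimately show ?thesis unfolding M.sep_def using h S
    by (intro exI[of _ "h ` S"]) (auto simp: card_image)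
qed

section \<open>The residue predicates through representatives\<close>

lemma val_gt_eq: "\<gamma> \<in> carrier \<Delta> \<Longrightarrow> val_gt M \<Delta> v \<gamma> = {x \<in> carrier M. \<gamma> \<sqsubset> v x}"
  by (auto simp: val_gt_def chain_less_iff)

lemma subgrp_val_gt:
  assumes "\<gamma> \<in> carrier \<Delta>" "\<gamma> \<noteq> \<infinity>" shows "M.subgrp (val_gt M \<Delta> v \<gamma>)"
proof -
  have "\<gamma> \<sqsubset> \<infinity>" using assms by (simp add: clt_def)
  then show ?thesis unfolding M.subgrp_def val_gt_eq[OF assms(1)] using val_diff_gt by auto
qed

lemma res_pred_iff:
  assumes g: "\<gamma> \<in> carrier \<Delta>"
  shows "res_pred (value_set M \<Delta> v) n \<gamma> \<longleftrightarrow> \<gamma> \<noteq> \<infinity> \<and> (\<exists>S. S \<subseteq> carrier M \<and> finite S \<and> card S = n \<and>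
    (\<forall>x\<in>S. \<gamma> \<sqsubseteq> v x) \<and> (\<forall>x\<in>S. \<forall>y\<in>S. x \<noteq> y \<longrightarrow> \<not> \<gamma> \<sqsubset> v (x \<ominus> y)))"
proof (cases "\<gamma> = \<infinity>")
  case True
  then show ?thesis by (simp add: value_set_def)
next
  case False
  let ?A = "val_ge M \<Delta> v \<gamma>" and ?N = "val_gt M \<Delta> v \<gamma>"
  have A: "?A \<subseteq> carrier M" by (auto simp: val_ge_def)
  have N: "M.subgrp ?N" using subgrp_val_gt g False .
  have NA: "?N \<subseteq> ?A" unfolding val_gt_def val_ge_def chain_less_def by auto
  have "carrier (val_quot M \<Delta> v \<gamma>) = M.cls ?N ` ?A"
  proof -
    have "?N +>\<^bsub>M\<lparr>carrier := ?A\<rparr>\<^esub> a = M.cls ?N a" if a: "a \<in> ?A" for a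
    proof -
      have ac: "a \<in> carrier M" using a A by auto
      show ?thesis
        unfolding a_r_coset_def r_coset_def M.cls_def
      proof (simp, intro equalityI subsetI)
        fix y assume "y \<in> (\<Union>h\<in>?N. {h \<oplus> a})"
        then obtain h where h: "h \<in> ?N" "y = h \<oplus> a" by auto
        then have hc: "h \<in> carrier M" by (simp add: val_gt_def)
        then have "y \<ominus> a = h" using h ac M.add_diff_cancel[of a h] by (simp add: M.a_comm)
        then show "y \<in> {y \<in> carrier M. y \<ominus> a \<in> ?N}" using h hc ac by simp
      next
        fix y assume y: "y \<in> {y \<in> carrier M. y \<ominus> a \<in> ?N}"
        then have "y = (y \<ominus> a) \<oplus> a" using ac M.diff_add_cancel[of y a] by simp
        then show "y \<in> (\<Union>h\<in>?N. {h \<oplus> a})" using y by blast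
      qed
    qed
    then show ?thesis
      unfolding val_quot_def A_FactGroup_def FactGroup_def A_RCOSETS_def RCOSETS_def a_r_coset_def
      by (auto simp: r_coset_def)
  qed
  then have "res_pred (value_set M \<Delta> v) n \<gamma> \<longleftrightarrow> M.sep n ?A ?N"
    using M.sep_iff_card[OF N A, of n] False by (simp add: value_set_def)
  also have "\<dots> \<longleftrightarrow> (\<exists>S. S \<subseteq> carrier M \<and> finite S \<and> card S = n \<and>
    (\<forall>x\<in>S. \<gamma> \<sqsubseteq> v x) \<and> (\<forall>x\<in>S. \<forall>y\<in>S. x \<noteq> y \<longrightarrow> \<not> \<gamma> \<sqsubset> v (x \<ominus> y)))" (is "?L \<longleftrightarrow> ?R")
  proof -
    have "S \<subseteq> ?A \<longleftrightarrow> S \<subseteq> carrier M \<and> (\<forall>x\<in>S. \<gamma> \<sqsubseteq> v x)" for S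
      using g by (auto simp: val_ge_def le_rel_iff subset_iff)
    moreover have "x \<ominus> y \<in> ?N \<longleftrightarrow> \<gamma> \<sqsubset> v (x \<ominus> y)" if "x \<in> carrier M" "y \<in> carrier M" for x y
      using that g by (simp add: val_gt_def chain_less_iff)
    ultimately show ?thesis unfolding M.sep_def by (smt (verit, best) subset_iff)
  qed
  finally show ?thesis using False by simp
qed

end

section \<open>Linear systems modulo positive values\<close>

context skew_field
begin

primrec rlc :: "(nat \<Rightarrow> nat \<Rightarrow> 'k) \<Rightarrow> (nat \<Rightarrow> nat \<Rightarrow> 'k) \<Rightarrow> nat \<Rightarrow> nat \<Rightarrow> 'k" where
  "rlc r a 0 = \<zero>\<^bsub>R\<^esub>"
| "rlc r a (Suc n) = rlc r a n \<oplus>\<^bsub>R\<^esub> r n \<otimes>\<^bsub>R\<^esub> a n"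

lemma rlc_closed[simp]: "(\<And>i. r i \<in> carrier R) \<Longrightarrow> (\<And>i. a i \<in> carrier R) \<Longrightarrow> rlc r a n \<in> carrier R"
  by (induction n) auto

lemma rlc_mult:
  assumes "\<And>i. r i \<in> carrier R" "\<And>i. a i \<in> carrier R" "p \<in> carrier R"
  shows "rlc r (\<lambda>i. a i \<otimes>\<^bsub>R\<^esub> p) n = rlc r a n \<otimes>\<^bsub>R\<^esub> p"
  using assms by (induction n) (simp_all add: R.l_distr R.m_assoc)

lemma rlc_cong: "(\<And>i. i < n \<Longrightarrow> a i = b i) \<Longrightarrow> rlc r a n = rlc r b n"
  by (induction n) auto

text \<open>By iterated \<open>bezout\<close> the r_i with i in \<open>A\<close> generate a
  principal right ideal g R, where g = \<Sum> r_i a_i. Setting a_i = 0 outside \<open>A\<close> lets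
  all sums run over the indices below \<open>k\<close>, whatever \<open>A\<close> is.\<close>

lemma common_left_divisor:
  assumes r: "\<And>i. r i \<in> carrier R" and "A \<subseteq> {..<k}"
  shows "\<exists>a c. (\<forall>i. a i \<in> carrier R) \<and> (\<forall>i. c i \<in> carrier R) \<and> (\<forall>i. i \<notin> A \<longrightarrow> a i = \<zero>\<^bsub>R\<^esub>) \<and>
    (\<forall>i\<in>A. r i = rlc r a k \<otimes>\<^bsub>R\<^esub> c i)"
  using assms(2)
proof (induction k arbitrary: A)
  case 0
  then show ?case by (intro exI[of _ "\<lambda>_. \<zero>\<^bsub>R\<^esub>"]) auto
next
  case (Suc k)
  have "A - {k} \<subseteq> {..<k}" using Suc.prems by auto
  from Suc.IH[OF this] obtain a c where ac: "\<forall>i. a i \<in> carrier R" "\<forall>i. c i \<in> carrier R"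
    "\<forall>i. i \<notin> A - {k} \<longrightarrow> a i = \<zero>\<^bsub>R\<^esub>" "\<forall>i\<in>A - {k}. r i = rlc r a k \<otimes>\<^bsub>R\<^esub> c i"
    by (elim exE conjE)
  have a: "a i \<in> carrier R" and c: "c i \<in> carrier R" for i using ac(1,2) by simp_all
  have a0: "a i = \<zero>\<^bsub>R\<^esub>" if "i \<notin> A - {k}" for i using ac(3) that by blast
  have rc: "r i = rlc r a k \<otimes>\<^bsub>R\<^esub> c i" if "i \<in> A - {k}" for i using ac(4) that by blast
  show ?case
  proof (cases "k \<in> A")
    case False
    have "rlc r a (Suc k) = rlc r a k" using a0[of k] r a by simp
    moreover have "A - {k} = A" using False by blast
    ultimately show ?thesis using ac by (intro exI[of _ a] exI[of _ c]) (simp only: simp_thms)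
  next
    case True
    obtain h p q u w where h: "h \<in> carrier R" "p \<in> carrier R" "q \<in> carrier R" "u \<in> carrier R"
      "w \<in> carrier R" "h = rlc r a k \<otimes>\<^bsub>R\<^esub> p \<oplus>\<^bsub>R\<^esub> r k \<otimes>\<^bsub>R\<^esub> q" "rlc r a k = h \<otimes>\<^bsub>R\<^esub> u" "r k = h \<otimes>\<^bsub>R\<^esub> w"
      using bezout[OF rlc_closed[of r a k, OF r a] r[of k]] by (elim bexE conjE) (rule that; assumption)
    \<comment> \<open>As h = (\<Sum> r_i a_i) p + r_k q, the old coefficients receive the factor
      \<open>p\<close> on the right and the new one is \<open>q\<close>; dually, the old quotients
      receive \<open>u\<close> on the left.\<close>
    define b where "b i = (if i = k then q else a i \<otimes>\<^bsub>R\<^esub> p)" for i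
    define d where "d i = (if i = k then w else u \<otimes>\<^bsub>R\<^esub> c i)" for i
    have "rlc r b k = rlc r (\<lambda>i. a i \<otimes>\<^bsub>R\<^esub> p) k" by (rule rlc_cong) (simp add: b_def)
    then have hb: "rlc r b (Suc k) = h"
      using rlc_mult[of r a p k, OF r a h(2)] by (simp add: h(6)[symmetric] b_def)
    have "r i = h \<otimes>\<^bsub>R\<^esub> d i" if "i \<in> A" for i
    proof (cases "i = k")
      case True
      then show ?thesis using h(8) by (simp add: d_def)
    next
      case False
      have "r i = (h \<otimes>\<^bsub>R\<^esub> u) \<otimes>\<^bsub>R\<^esub> c i" using rc[of i] that False by (simp add: h(7)[symmetric])
      then show ?thesis using False h(1,4) c[of i] by (simp add: d_def R.m_assoc)
    qed
    moreover have "b i \<in> carrier R" "d i \<in> carrier R" for i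
      using a c h(2-5) by (simp_all add: b_def d_def)
    moreover have "b i = \<zero>\<^bsub>R\<^esub>" if "i \<notin> A" for i
      using that True a0[of i] h(2) by (auto simp: b_def)
    ultimately show ?thesis
      by (intro exI[of _ b] exI[of _ d] conjI allI ballI impI) (simp_all only: hb)
  qed
qed

text \<open>The coefficients are chosen once and for all from \<open>r\<close>, \<open>k\<close> and
  \<open>A\<close>, so that the same scalars serve in both modules and may occur in terms of the
  language.\<close>

definition sys :: "(nat \<Rightarrow> nat \<Rightarrow> 'k) \<Rightarrow> nat \<Rightarrow> nat set \<Rightarrow> (nat \<Rightarrow> nat \<Rightarrow> 'k) \<times> (nat \<Rightarrow> nat \<Rightarrow> 'k)" where
  "sys r k A = (SOME ac. (\<forall>i. fst ac i \<in> carrier R) \<and> (\<forall>i. snd ac i \<in> carrier R) \<and>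
    (\<forall>i. i \<notin> A \<longrightarrow> fst ac i = \<zero>\<^bsub>R\<^esub>) \<and> (\<forall>i\<in>A. r i = rlc r (fst ac) k \<otimes>\<^bsub>R\<^esub> snd ac i))"

definition sys_a where "sys_a r k A = fst (sys r k A)"
definition sys_c where "sys_c r k A = snd (sys r k A)"

context
  fixes r :: "nat \<Rightarrow> nat \<Rightarrow> 'k" and k :: nat and A
  assumes r: "\<And>i. r i \<in> carrier R" and A: "A \<subseteq> {..<k}"
begin

lemma sys_spec:
  "(\<forall>i. sys_a r k A i \<in> carrier R) \<and> (\<forall>i. sys_c r k A i \<in> carrier R) \<and>
    (\<forall>i. i \<notin> A \<longrightarrow> sys_a r k A i = \<zero>\<^bsub>R\<^esub>) \<and> (\<forall>i\<in>A. r i = rlc r (sys_a r k A) k \<otimes>\<^bsub>R\<^esub> sys_c r k A i)"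
proof -
  let ?P = "\<lambda>ac. (\<forall>i. fst ac i \<in> carrier R) \<and> (\<forall>i. snd ac i \<in> carrier R) \<and>
    (\<forall>i. i \<notin> A \<longrightarrow> fst ac i = \<zero>\<^bsub>R\<^esub>) \<and> (\<forall>i\<in>A. r i = rlc r (fst ac) k \<otimes>\<^bsub>R\<^esub> snd ac i)"
  from common_left_divisor[of r A k, OF r A]
  obtain a c where "(\<forall>i. a i \<in> carrier R) \<and> (\<forall>i. c i \<in> carrier R) \<and>
    (\<forall>i. i \<notin> A \<longrightarrow> a i = \<zero>\<^bsub>R\<^esub>) \<and> (\<forall>i\<in>A. r i = rlc r a k \<otimes>\<^bsub>R\<^esub> c i)"
    by (elim exE)
  then have "?P (a, c)" unfolding fst_conv snd_conv .
  then have "?P (SOME ac. ?P ac)" by (rule someI[where P = ?P])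
  then show ?thesis unfolding sys_a_def sys_c_def sys_def .
qed

lemma sys_a_closed[simp]: "sys_a r k A i \<in> carrier R" using sys_spec by simp
lemma sys_c_closed[simp]: "sys_c r k A i \<in> carrier R" using sys_spec by simp
lemma sys_a_outside: "i \<notin> A \<Longrightarrow> sys_a r k A i = \<zero>\<^bsub>R\<^esub>" using sys_spec by simp
lemma sys_div: "i \<in> A \<Longrightarrow> r i = rlc r (sys_a r k A) k \<otimes>\<^bsub>R\<^esub> sys_c r k A i" using sys_spec by blast

end
end

context vmod
begin

primrec mlc :: "(nat \<Rightarrow> 'm) \<Rightarrow> (nat \<Rightarrow> nat \<Rightarrow> 'k) \<Rightarrow> nat \<Rightarrow> 'm" where
  "mlc e a 0 = \<zero>"
| "mlc e a (Suc n) = mlc e a n \<oplus> e n \<cdot> a n"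

lemma mlc_closed[simp]: "(\<And>i. e i \<in> carrier M) \<Longrightarrow> (\<And>i. a i \<in> carrier R) \<Longrightarrow> mlc e a n \<in> carrier M"
  by (induction n) auto

lemma act_rlc:
  assumes "x \<in> carrier M" "\<And>i. r i \<in> carrier R" "\<And>i. a i \<in> carrier R"
  shows "x \<cdot> rlc r a n = mlc (\<lambda>i. x \<cdot> r i) a n"
  using assms by (induction n) (simp_all add: ract_add_right ract_mult)

lemma mlc_add:
  assumes "\<And>i. e i \<in> carrier M" "\<And>i. f i \<in> carrier M" "\<And>i. a i \<in> carrier R"
  shows "mlc (\<lambda>i. e i \<oplus> f i) a n = mlc e a n \<oplus> mlc f a n"
  using assms by (induction n) (simp_all add: ract_add_left M.a_ac)

lemma mlc_gt0:
  assumes "\<And>i. e i \<in> carrier M" "\<And>i. a i \<in> carrier R" "\<And>i. i \<notin> A \<Longrightarrow> a i = \<zero>\<^bsub>R\<^esub>"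
    "\<And>i. i \<in> A \<Longrightarrow> e i \<in> gt0"
  shows "mlc e a n \<in> gt0"
proof (induction n)
  case 0
  then show ?case using M.subgrp_zero[OF subgrp_gt0] by simp
next
  case (Suc n)
  have "e n \<cdot> a n \<in> gt0"
    using assms(1,3)[of n] gt0_act[OF assms(4) assms(2), of n n] M.subgrp_zero[OF subgrp_gt0]
    by (cases "n \<in> A") simp_all
  then show ?case using Suc M.subgrp_add[OF subgrp_gt0] by simp
qed

text \<open>The obstruction to solving x r_i = - e_i for all i in \<open>A\<close>: with g = \<Sum>
  r_j a_j a solution has x g = - \<Sum> e_j a_j, and r_i = g c_i then forces (\<Sum> e_j a_j) c_i =
  e_i.\<close>

definition kappa :: "(nat \<Rightarrow> nat \<Rightarrow> 'k) \<Rightarrow> nat \<Rightarrow> (nat \<Rightarrow> 'm) \<Rightarrow> nat set \<Rightarrow> nat \<Rightarrow> 'm" where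
  "kappa r k e A i = mlc e (sys_a r k A) k \<cdot> sys_c r k A i \<ominus> e i"

text \<open>When the obstructions vanish modulo \<open>gt0\<close>, any x with x g = - \<Sum> e_j
  a_j is a solution. Such an x exists by divisibility, as g is a left divisor of a non-zero r_i and
  hence non-zero. The other direction is the computation behind \<open>kappa\<close>, read modulo
  \<open>gt0\<close>.\<close>

lemma system_solvable:
  assumes r: "\<And>i. r i \<in> carrier R" and A: "A \<subseteq> {..<k}" "A \<noteq> {}" "\<And>i. i \<in> A \<Longrightarrow> r i \<noteq> \<zero>\<^bsub>R\<^esub>"
    and e: "\<And>i. e i \<in> carrier M"
  shows "(\<exists>x\<in>carrier M. \<forall>i\<in>A. x \<cdot> r i \<oplus> e i \<in> gt0) \<longleftrightarrow> (\<forall>i\<in>A. kappa r k e A i \<in> gt0)"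
proof -
  let ?a = "sys_a r k A" and ?c = "sys_c r k A"
  let ?g = "rlc r ?a k" and ?E = "mlc e ?a k"
  note a = sys_a_closed[where r = r, OF r A(1)] and c = sys_c_closed[where r = r, OF r A(1)]
    and dv = sys_div[where r = r, OF r A(1)]
  have gR: "?g \<in> carrier R" using r a by simp
  have EM: "?E \<in> carrier M" using e a by simp
  show ?thesis
  proof
    assume "\<exists>x\<in>carrier M. \<forall>i\<in>A. x \<cdot> r i \<oplus> e i \<in> gt0"
    then obtain x where x: "x \<in> carrier M" "\<And>i. i \<in> A \<Longrightarrow> x \<cdot> r i \<oplus> e i \<in> gt0" by auto
    have "x \<cdot> ?g \<oplus> ?E = mlc (\<lambda>i. x \<cdot> r i \<oplus> e i) ?a k"
      using x(1) r a e by (simp add: act_rlc mlc_add)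
    moreover have "mlc (\<lambda>i. x \<cdot> r i \<oplus> e i) ?a k \<in> gt0"
      using x r a e sys_a_outside[where r = r, OF r A(1)] by (intro mlc_gt0[of _ _ A]) auto
    ultimately have 1: "x \<cdot> ?g \<oplus> ?E \<in> gt0" by simp
    show "\<forall>i\<in>A. kappa r k e A i \<in> gt0"
    proof
      fix i assume i: "i \<in> A"
      have "(x \<cdot> ?g \<oplus> ?E) \<cdot> ?c i = x \<cdot> (?g \<otimes>\<^bsub>R\<^esub> ?c i) \<oplus> ?E \<cdot> ?c i"
        using x(1) gR EM c by (simp add: ract_add_left ract_mult)
      also have "\<dots> = x \<cdot> r i \<oplus> ?E \<cdot> ?c i" using dv[OF i] by simp
      finally have "(x \<cdot> ?g \<oplus> ?E) \<cdot> ?c i \<ominus> (x \<cdot> r i \<oplus> e i) = ?E \<cdot> ?c i \<ominus> e i"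
        using x(1) r e EM c by (simp add: M.add_diff_add)
      moreover have "(x \<cdot> ?g \<oplus> ?E) \<cdot> ?c i \<ominus> (x \<cdot> r i \<oplus> e i) \<in> gt0"
        using M.subgrp_diff[OF subgrp_gt0 gt0_act[OF 1 c] x(2)[OF i]] .
      ultimately show "kappa r k e A i \<in> gt0" by (simp add: kappa_def)
    qed
  next
    assume kap: "\<forall>i\<in>A. kappa r k e A i \<in> gt0"
    obtain i0 where i0: "i0 \<in> A" using A(2) by blast
    have g0: "?g \<noteq> \<zero>\<^bsub>R\<^esub>"
    proof
      assume "?g = \<zero>\<^bsub>R\<^esub>"
      then have "r i0 = \<zero>\<^bsub>R\<^esub>" using dv[OF i0] c by simp
      then show False using A(3) i0 by blast
    qed
    obtain x where x: "x \<in> carrier M" "x \<cdot> ?g = \<ominus> ?E"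
      using div_obtain[OF M.a_inv_closed[OF EM] gR g0] .
    have "x \<cdot> r i \<oplus> e i \<in> gt0" if i: "i \<in> A" for i
    proof -
      have "x \<cdot> r i = x \<cdot> (?g \<otimes>\<^bsub>R\<^esub> ?c i)" using dv[OF i] by simp
      also have "\<dots> = \<ominus> (?E \<cdot> ?c i)" using x gR c EM by (simp add: ract_mult minus_act)
      finally have "x \<cdot> r i \<oplus> e i = \<ominus> kappa r k e A i"
        using EM c e by (simp add: kappa_def M.minus_diff) (simp add: M.minus_eq M.a_comm)
      then show ?thesis using kap i M.subgrp_minus[OF subgrp_gt0] by simp
    qed
    then show "\<exists>x\<in>carrier M. \<forall>i\<in>A. x \<cdot> r i \<oplus> e i \<in> gt0" using x by blast
  qed
qed

text \<open>The scalars r_i with i in \<open>A\<close> generate the same right ideal as g, so they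
  annihilate the same elements. All indices that occur in the coset argument thereby become indices
  of annihilators of single scalars.\<close>

lemma Pset_system:
  assumes r: "\<And>i. r i \<in> carrier R" and A: "A \<subseteq> {..<k}"
  shows "{x \<in> ge0. \<forall>i\<in>A. x \<cdot> r i \<in> gt0} = Pset (rlc r (sys_a r k A) k)"
proof -
  let ?a = "sys_a r k A" and ?c = "sys_c r k A"
  let ?g = "rlc r ?a k"
  note a = sys_a_closed[where r = r, OF r A] and c = sys_c_closed[where r = r, OF r A]
    and dv = sys_div[where r = r, OF r A]
  have gR: "?g \<in> carrier R" using r a by simp
  have "(\<forall>i\<in>A. x \<cdot> r i \<in> gt0) \<longleftrightarrow> x \<cdot> ?g \<in> gt0" if x: "x \<in> carrier M" for x
  proof
    assume "\<forall>i\<in>A. x \<cdot> r i \<in> gt0"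
    then have "mlc (\<lambda>i. x \<cdot> r i) ?a k \<in> gt0"
      using x r a sys_a_outside[where r = r, OF r A] by (intro mlc_gt0[of _ _ A]) auto
    then show "x \<cdot> ?g \<in> gt0" using act_rlc[of x r ?a k] x r a by simp
  next
    assume g: "x \<cdot> ?g \<in> gt0"
    show "\<forall>i\<in>A. x \<cdot> r i \<in> gt0"
    proof
      fix i assume i: "i \<in> A"
      have "x \<cdot> r i = x \<cdot> (?g \<otimes>\<^bsub>R\<^esub> ?c i)" using dv[OF i] by simp
      then show "x \<cdot> r i \<in> gt0" using gt0_act[OF g c[of i]] x gR c by (simp add: ract_mult)
    qed
  qed
  then show ?thesis using ge0_carrier unfolding Pset_def by auto
qed

text \<open>The element \<open>p\<close> anchors the coset of \<open>ge0\<close> in which the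
  unknown is sought; the equations are meant modulo \<open>gt0\<close>.\<close>

lemma residue_family:
  assumes r: "\<And>i. r i \<in> carrier R" and e: "\<And>i. e i \<in> carrier M" and p: "p \<in> carrier M"
  shows "coset_family M ge0 (\<lambda>j. {x \<in> carrier M. x \<cdot> r j \<in> gt0})
    {x \<in> carrier M. x \<ominus> p \<in> ge0} (\<lambda>j. {x \<in> carrier M. x \<cdot> r j \<oplus> e j \<in> gt0})"
proof
  show "M.subgrp ge0" by (rule subgrp_ge0)
  show "M.subgrp {x \<in> carrier M. x \<cdot> r j \<in> gt0}" for j
    unfolding M.subgrp_def using r M.subgrp_zero[OF subgrp_gt0] M.subgrp_diff[OF subgrp_gt0]
    by (auto simp: diff_act)
  show "{x \<in> carrier M. x \<ominus> p \<in> ge0} \<noteq> {}" using p M.subgrp_zero[OF subgrp_ge0] by auto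
  show "{x \<in> carrier M. x \<ominus> p \<in> ge0} \<subseteq> carrier M" by blast
  show "y \<in> {x \<in> carrier M. x \<ominus> p \<in> ge0} \<longleftrightarrow> y \<ominus> x \<in> ge0"
    if x: "x \<in> {x \<in> carrier M. x \<ominus> p \<in> ge0}" and y: "y \<in> carrier M" for x y
    using x y p M.subgrp_diff_trans[OF subgrp_ge0, of y x p] M.subgrp_diff_trans[OF subgrp_ge0, of y p x]
      M.subgrp_diff_commute[OF subgrp_ge0, of x p] by auto
  fix x y j
  assume x: "x \<in> {x \<in> carrier M. x \<ominus> p \<in> ge0}" and y: "y \<in> {x \<in> carrier M. x \<ominus> p \<in> ge0}"
    and xj: "x \<in> {x \<in> carrier M. x \<cdot> r j \<oplus> e j \<in> gt0}"
  have c: "x \<in> carrier M" "y \<in> carrier M" using x y by auto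
  have "(y \<ominus> x) \<cdot> r j = (e j \<oplus> y \<cdot> r j) \<ominus> (e j \<oplus> x \<cdot> r j)"
    using c r e by (simp add: diff_act M.add_diff_add)
  then have eq: "(y \<ominus> x) \<cdot> r j = (y \<cdot> r j \<oplus> e j) \<ominus> (x \<cdot> r j \<oplus> e j)"
    using c r e by (simp add: M.a_comm)
  have eq2: "y \<cdot> r j \<oplus> e j = ((y \<ominus> x) \<cdot> r j) \<oplus> (x \<cdot> r j \<oplus> e j)"
    unfolding eq using c r e by (simp add: M.diff_add_cancel)
  show "y \<in> {x \<in> carrier M. x \<cdot> r j \<oplus> e j \<in> gt0} \<longleftrightarrow> y \<ominus> x \<in> {x \<in> carrier M. x \<cdot> r j \<in> gt0}"
  proof
    assume "y \<in> {x \<in> carrier M. x \<cdot> r j \<oplus> e j \<in> gt0}"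
    then show "y \<ominus> x \<in> {x \<in> carrier M. x \<cdot> r j \<in> gt0}"
      using xj M.subgrp_diff[OF subgrp_gt0, of "y \<cdot> r j \<oplus> e j" "x \<cdot> r j \<oplus> e j"] c eq by simp
  next
    assume "y \<ominus> x \<in> {x \<in> carrier M. x \<cdot> r j \<in> gt0}"
    then have "((y \<ominus> x) \<cdot> r j) \<oplus> (x \<cdot> r j \<oplus> e j) \<in> gt0"
      using xj M.subgrp_add[OF subgrp_gt0, of "(y \<ominus> x) \<cdot> r j" "x \<cdot> r j \<oplus> e j"] by simp
    then show "y \<in> {x \<in> carrier M. x \<cdot> r j \<oplus> e j \<in> gt0}" using c eq2 by simp
  qed
qed

text \<open>For non-empty \<open>B\<close> the confinement to the coset of \<open>p\<close> is
  automatic: a solution \<open>x\<close> makes (x - p) r_i an element of \<open>ge0\<close>, and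
  then x - p lies in \<open>ge0\<close> since r_i is non-zero.\<close>

lemma residue_family_nonempty:
  assumes r: "\<And>i. r i \<in> carrier R" and e: "\<And>i. e i \<in> carrier M" and p: "p \<in> carrier M"
    and B: "B \<subseteq> {..<k}" "\<And>i. i \<in> B \<Longrightarrow> r i \<noteq> \<zero>\<^bsub>R\<^esub>" "\<And>i. i \<in> B \<Longrightarrow> p \<cdot> r i \<oplus> e i \<in> ge0"
  shows "coset_family.XA {x \<in> carrier M. x \<ominus> p \<in> ge0} (\<lambda>j. {x \<in> carrier M. x \<cdot> r j \<oplus> e j \<in> gt0}) B \<noteq> {}
    \<longleftrightarrow> B = {} \<or> (\<forall>i\<in>B. kappa r k e B i \<in> gt0)"
proof -
  interpret C: coset_family M ge0 "\<lambda>j. {x \<in> carrier M. x \<cdot> r j \<in> gt0}"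
    "{x \<in> carrier M. x \<ominus> p \<in> ge0}" "\<lambda>j. {x \<in> carrier M. x \<cdot> r j \<oplus> e j \<in> gt0}"
    by (rule residue_family[OF r e p])
  show ?thesis
  proof (cases "B = {}")
    case True
    then show ?thesis using C.X0_ne by (simp add: C.XA_def)
  next
    case False
    then obtain i where i: "i \<in> B" by blast
    have "x \<ominus> p \<in> ge0" if x: "x \<in> carrier M" "x \<cdot> r i \<oplus> e i \<in> gt0" for x
    proof -
      have "(x \<ominus> p) \<cdot> r i = (e i \<oplus> x \<cdot> r i) \<ominus> (e i \<oplus> p \<cdot> r i)"
        using x p r e by (simp add: diff_act M.add_diff_add)
      then have "(x \<ominus> p) \<cdot> r i = (x \<cdot> r i \<oplus> e i) \<ominus> (p \<cdot> r i \<oplus> e i)"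
        using x p r e by (simp add: M.a_comm)
      moreover have "x \<cdot> r i \<oplus> e i \<in> ge0" using x(2) gt0_sub_ge0 by blast
      ultimately have "(x \<ominus> p) \<cdot> r i \<in> ge0" using B(3)[OF i] M.subgrp_diff[OF subgrp_ge0] by simp
      then show ?thesis using act_ge0_imp[OF r _ B(2)[OF i]] x p by simp
    qed
    then have "C.XA B \<noteq> {} \<longleftrightarrow> (\<exists>x\<in>carrier M. \<forall>i\<in>B. x \<cdot> r i \<oplus> e i \<in> gt0)"
      using i unfolding C.XA_def by auto
    then show ?thesis using system_solvable[where r = r and e = e, OF r B(1) False B(2) e] False by simp
  qed
qed

lemma residue_family_HA:
  assumes r: "\<And>i. r i \<in> carrier R" and B: "B \<subseteq> {..<k}"
  shows "coset_family.HA ge0 (\<lambda>j. {x \<in> carrier M. x \<cdot> r j \<in> gt0}) B = Pset (rlc r (sys_a r k B) k)"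
proof -
  interpret C: coset_family M ge0 "\<lambda>j. {x \<in> carrier M. x \<cdot> r j \<in> gt0}"
    "{x \<in> carrier M. x \<ominus> \<zero> \<in> ge0}" "\<lambda>j. {x \<in> carrier M. x \<cdot> r j \<oplus> \<zero> \<in> gt0}"
    by (rule residue_family[OF r]) auto
  show ?thesis unfolding C.HA_def Pset_system[where r = r, OF r B, symmetric]
    using ge0_carrier by auto
qed

section \<open>Normalised values and the choice of roots\<close>

lemma lam_val_neg:
  assumes "r \<in> carrier R" "r \<noteq> \<zero>\<^bsub>R\<^esub>" "y \<in> carrier M" "\<alpha> \<in> carrier \<Delta>" "lam r \<alpha> = v (y \<cdot> r)"
  shows "neg \<alpha> \<longleftrightarrow> neg (v y)" "neg \<alpha> \<Longrightarrow> v y = \<alpha>"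
proof -
  show 1: "neg \<alpha> \<longleftrightarrow> neg (v y)"
  proof -
    have "neg (v (y \<cdot> r)) \<longleftrightarrow> neg (v y)"
      using val_act[OF assms(1,3) _ assms(2)] neg_lam[of "v y" r] ge0_act[of y r] assms(1,3)
      by (auto simp: ge0_def mid_iff)
    then show ?thesis using neg_lam[OF assms(4), of r] assms(5) by simp
  qed
  assume "neg \<alpha>"
  then have "lam r (v y) = lam r \<alpha>"
    using 1 val_act[OF assms(1,3) _ assms(2)] assms(5) by (simp add: mid_iff)
  then show "v y = \<alpha>" using lam_inj assms(3,4) by blast
qed

text \<open>That v(y) is positive must be known beforehand: if v(y) = \<theta>, then y r may have a
  value above \<theta>, and \<alpha> lies above v(y).\<close>

lemma lam_val_pos:
  assumes "r \<in> carrier R" "r \<noteq> \<zero>\<^bsub>R\<^esub>" "y \<in> carrier M" "\<alpha> \<in> carrier \<Delta>" "lam r \<alpha> = v (y \<cdot> r)" "pos (v y)"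
  shows "v y = \<alpha>"
proof -
  have "lam r (v y) = lam r \<alpha>"
    using val_act[OF assms(1,3) _ assms(2)] assms(5,6) by (simp add: mid_iff)
  then show ?thesis using lam_inj assms(3,4) by blast
qed

text \<open>Either \<delta> and v(y) are equal and below \<theta>, or both are at least \<theta> and
  thus above the negative \<alpha>.\<close>

lemma lam_val_compare:
  assumes "r \<in> carrier R" "r \<noteq> \<zero>\<^bsub>R\<^esub>" "y \<in> carrier M" "\<delta> \<in> carrier \<Delta>" "lam r \<delta> = v (y \<cdot> r)"
    "neg \<alpha>" "\<alpha> \<in> carrier \<Delta>"
  shows "v y \<sqsubset> \<alpha> \<longleftrightarrow> \<delta> \<sqsubset> \<alpha>" "\<alpha> \<sqsubset> v y \<longleftrightarrow> \<alpha> \<sqsubset> \<delta>"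
proof -
  have "v y \<sqsubset> \<alpha> \<longleftrightarrow> \<delta> \<sqsubset> \<alpha>" "\<alpha> \<sqsubset> v y \<longleftrightarrow> \<alpha> \<sqsubset> \<delta>" if "\<not> neg \<delta>"
    using that lam_val_neg(1)[OF assms(1-5)] neg_less[OF assms(6) _ assms(7), of "v y"]
      neg_less[OF assms(6) _ assms(7), of \<delta>] assms(3,4) by (auto dest: ord.less_asym)
  then show "v y \<sqsubset> \<alpha> \<longleftrightarrow> \<delta> \<sqsubset> \<alpha>" "\<alpha> \<sqsubset> v y \<longleftrightarrow> \<alpha> \<sqsubset> \<delta>"
    using lam_val_neg(2)[OF assms(1-5)] by (cases "neg \<delta>"; simp)+
qed

lemma act_root:
  assumes "x \<in> carrier M" "c \<in> carrier M" "r \<in> carrier R" "e \<in> carrier M" "c \<cdot> r = \<ominus> e"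
  shows "x \<cdot> r \<oplus> e = (x \<ominus> c) \<cdot> r"
  using assms M.minus_eq[of "x \<cdot> r" "\<ominus> e"] by (simp add: diff_act)

text \<open>As \<open>gt0\<close> is divisible, x r + e = z r for some z in \<open>gt0\<close>, and
  x - z is a root close to \<open>x\<close>. An arbitrary root might be at distance \<theta> from
  \<open>x\<close>.\<close>

lemma root_near:
  assumes r: "r \<in> carrier R" "r \<noteq> \<zero>\<^bsub>R\<^esub>" and x: "x \<in> carrier M" and e: "e \<in> carrier M"
    and g: "x \<cdot> r \<oplus> e \<in> gt0"
  shows "\<exists>c\<in>carrier M. c \<cdot> r = \<ominus> e \<and> x \<ominus> c \<in> gt0"
proof -
  obtain z where z: "z \<in> gt0" "z \<cdot> r = x \<cdot> r \<oplus> e" using gt0_div[OF r(1) g r(2)] by blast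
  have zc: "z \<in> carrier M" using z gt0_carrier by blast
  have "(x \<ominus> z) \<cdot> r = \<ominus> e"
    using x e r zc z(2) M.diff_add_self[of "x \<cdot> r" e] by (simp add: diff_act)
  moreover have "x \<ominus> (x \<ominus> z) = z" using x zc M.diff_add_self[of x "\<ominus> z"] by (simp add: M.minus_eq)
  ultimately show ?thesis using x zc z(1) by (intro bexI[of _ "x \<ominus> z"]) auto
qed

text \<open>After multiplication by a common right multiple the difference of two roots becomes, up
  to sign, an expression in the constant terms alone, whichever roots were chosen. This is how
  distances of roots become values of terms.\<close>

lemma root_difference:
  assumes "c \<in> carrier M" "d \<in> carrier M" "e \<in> carrier M" "f \<in> carrier M"
    "r \<in> carrier R" "s \<in> carrier R" "q \<in> carrier R" "u \<in> carrier R"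
    "c \<cdot> r = \<ominus> e" "d \<cdot> q = \<ominus> f" "r \<otimes>\<^bsub>R\<^esub> s = q \<otimes>\<^bsub>R\<^esub> u"
  shows "v ((c \<ominus> d) \<cdot> (r \<otimes>\<^bsub>R\<^esub> s)) = v (e \<cdot> s \<ominus> f \<cdot> u)"
proof -
  have "(c \<ominus> d) \<cdot> (r \<otimes>\<^bsub>R\<^esub> s) = c \<cdot> (r \<otimes>\<^bsub>R\<^esub> s) \<ominus> d \<cdot> (q \<otimes>\<^bsub>R\<^esub> u)"
    using assms by (simp add: diff_act)
  also have "\<dots> = \<ominus> (e \<cdot> s) \<ominus> \<ominus> (f \<cdot> u)"
    using assms(1-10) by (simp add: ract_mult minus_act)
  also have "\<dots> = \<ominus> (e \<cdot> s \<ominus> f \<cdot> u)"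
    using assms by (simp add: M.minus_eq M.minus_add)
  finally show ?thesis using assms by simp
qed

end

section \<open>Transfer of distances\<close>

lemma (in abelian_group) sep_self: "subgrp H \<Longrightarrow> sep n H H \<longleftrightarrow> n \<le> 1"
proof
  assume H: "subgrp H" and s: "sep n H H"
  then obtain S where S: "S \<subseteq> H" "finite S" "card S = n" "\<forall>x\<in>S. \<forall>y\<in>S. x \<noteq> y \<longrightarrow> x \<ominus> y \<notin> H"
    unfolding sep_def by auto
  then have "\<forall>x\<in>S. \<forall>y\<in>S. x = y" using subgrp_diff[OF H] by (meson subsetD)
  then show "n \<le> 1" using S(2,3) card_le_Suc0_iff_eq by auto
next
  assume H: "subgrp H" and n: "n \<le> 1"
  then consider "n = 0" | "n = 1" by linarith
  then show "sep n H H"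
  proof cases
    case 1
    then show ?thesis unfolding sep_def by (intro exI[of _ "{}"]) auto
  next
    case 2
    then show ?thesis unfolding sep_def using subgrp_zero[OF H] by (intro exI[of _ "{\<zero>}"]) auto
  qed
qed

context vmod
begin

lemma Pset_zero: "Pset \<zero>\<^bsub>R\<^esub> = ge0"
  using ge0_carrier M.subgrp_zero[OF subgrp_gt0] by (auto simp: Pset_def)

text \<open>The scalar r = 0 escapes \<open>sep_Pset_torsion\<close>, its annihilator being all of
  \<open>ge0\<close>. There the index of \<open>Pset g\<close> is infinite if \<theta> is a value
  and g \<noteq> 0, and otherwise it is 1.\<close>

lemma sep_Pset_zero:
  assumes "g \<in> carrier R"
  shows "M.sep n (Pset \<zero>\<^bsub>R\<^esub>) (Pset g) \<longleftrightarrow>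
    n \<le> 1 \<or> (g \<noteq> \<zero>\<^bsub>R\<^esub> \<and> (\<exists>\<gamma>\<in>carrier \<Delta>. mid \<gamma>))"
proof (cases "g \<noteq> \<zero>\<^bsub>R\<^esub> \<and> (\<exists>\<gamma>\<in>carrier \<Delta>. mid \<gamma>)")
  case True
  then obtain \<gamma> where "\<gamma> \<in> carrier \<Delta>" "mid \<gamma>" by blast
  moreover from this(1) obtain b where "b \<in> carrier M" "v b = \<gamma>" using val_surj by (metis imageE)
  ultimately have "b \<in> ge0" "b \<notin> gt0" by (auto simp: ge0_def gt0_def mid_iff)
  then show ?thesis using sep_ge0_Pset assms True by (simp add: Pset_zero)
next
  case False
  have "Pset g = ge0"
  proof (cases "g = \<zero>\<^bsub>R\<^esub>")
    case True
    then show ?thesis by (simp add: Pset_zero)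
  next
    case g: False
    have "ge0 = gt0" using False g by (auto simp: ge0_def gt0_def mid_iff dest: neg_not_pos)
    then show ?thesis using gt0_act assms by (auto simp: Pset_def)
  qed
  then have "M.sep n (Pset \<zero>\<^bsub>R\<^esub>) (Pset g) \<longleftrightarrow> n \<le> 1"
    using M.sep_self[OF subgrp_ge0] by (simp add: Pset_zero)
  then show ?thesis using False by blast
qed

lemma max_exists:
  assumes "finite I" "I \<noteq> {}"
  shows "\<exists>p\<in>I. \<forall>i\<in>I. f i \<sqsubseteq> f p"
  using assms
proof (induction I rule: finite_ne_induct)
  case (singleton x)
  then show ?case by simp
next
  case (insert x I)
  then obtain p where p: "p \<in> I" "\<forall>i\<in>I. f i \<sqsubseteq> f p" by blast
  show ?case
  proof (cases "f x \<sqsubseteq> f p")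
    case True
    then show ?thesis using p by blast
  next
    case False
    then have "f p \<sqsubseteq> f x" using ord.linear by blast
    then have "\<forall>i\<in>insert x I. f i \<sqsubseteq> f x" using p(2) ord.order_trans by auto
    then show ?thesis by blast
  qed
qed

text \<open>Pigeonhole: |J| + 1 classes modulo the values > \<gamma> cannot all be occupied by the
  |J| elements c_j - c_p. A free one, translated by c_p, is at distance exactly \<gamma> from every
  c_j.\<close>

lemma new_class:
  assumes c: "\<And>j. j \<in> J \<Longrightarrow> c j \<in> carrier M" and p: "p \<in> J" and J: "finite J"
    and g: "\<gamma> \<in> carrier \<Delta>" "res_pred (value_set M \<Delta> v) (Suc (card J)) \<gamma>"
    and near: "\<And>j. j \<in> J \<Longrightarrow> \<gamma> \<sqsubseteq> v (c j \<ominus> c p)"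
  shows "\<exists>x\<in>carrier M. \<forall>j\<in>J. v (x \<ominus> c j) = \<gamma>"
proof -
  have cp: "c p \<in> carrier M" using c p by blast
  obtain S where S: "S \<subseteq> carrier M" "finite S" "card S = Suc (card J)" "\<forall>x\<in>S. \<gamma> \<sqsubseteq> v x"
    "\<forall>x\<in>S. \<forall>y\<in>S. x \<noteq> y \<longrightarrow> \<not> \<gamma> \<sqsubset> v (x \<ominus> y)"
    using res_pred_iff[OF g(1)] g(2) by auto
  have "\<exists>y\<in>S. \<forall>j\<in>J. \<not> \<gamma> \<sqsubset> v (y \<ominus> (c j \<ominus> c p))"
  proof (rule ccontr)
    assume "\<not> ?thesis"
    then have "\<forall>y\<in>S. \<exists>j. j \<in> J \<and> \<gamma> \<sqsubset> v (y \<ominus> (c j \<ominus> c p))" by auto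
    then obtain h where h: "\<And>y. y \<in> S \<Longrightarrow> h y \<in> J" "\<And>y. y \<in> S \<Longrightarrow> \<gamma> \<sqsubset> v (y \<ominus> (c (h y) \<ominus> c p))"
      by metis
    have "card (h ` S) \<le> card J" using h(1) J by (intro card_mono) auto
    then have "\<not> inj_on h S" using S(3) card_image[of h S] by auto
    then obtain y z where yz: "y \<in> S" "z \<in> S" "h y = h z" "y \<noteq> z" unfolding inj_on_def by auto
    have cc: "y \<in> carrier M" "z \<in> carrier M" "c (h y) \<ominus> c p \<in> carrier M"
      using yz S(1) h(1) c cp by auto
    have "\<gamma> \<sqsubset> v ((c (h y) \<ominus> c p) \<ominus> z)"
      using h(2)[OF yz(2)] yz(3) val_diff_commute[OF cc(3,2)] by simp
    then have "\<gamma> \<sqsubset> v (y \<ominus> z)"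
      using val_diff_trans_gt[OF cc(1,3,2) h(2)[OF yz(1)]] by blast
    then show False using S(5) yz by blast
  qed
  then obtain y where y: "y \<in> S" "\<forall>j\<in>J. \<not> \<gamma> \<sqsubset> v (y \<ominus> (c j \<ominus> c p))" by blast
  have yc: "y \<in> carrier M" "\<gamma> \<sqsubseteq> v y" using y S by auto
  have "v ((y \<oplus> c p) \<ominus> c j) = \<gamma>" if j: "j \<in> J" for j
  proof -
    have cj: "c j \<in> carrier M" using c j by blast
    have "y \<ominus> (c j \<ominus> c p) = (y \<oplus> c p) \<ominus> c j"
      using yc cj cp by (simp add: M.minus_eq M.minus_add M.a_ac)
    moreover have "\<gamma> \<sqsubseteq> v (y \<ominus> (c j \<ominus> c p))" using val_diff_ge[of y "c j \<ominus> c p"] near[OF j] yc cj cp by simp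
    ultimately show ?thesis using y(2) j ord.le_less by metis
  qed
  then show ?thesis using yc cp by (intro bexI[of _ "y \<oplus> c p"]) auto
qed

text \<open>Zero and the differences c_j - x are |J| + 1 pairwise incongruent elements of value at
  least \<gamma>. This is a converse to \<open>new_class\<close> with the same index |J| +
  1.\<close>

lemma res_pred_witness:
  assumes c: "\<And>j. j \<in> J \<Longrightarrow> c j \<in> carrier M" and J: "finite J" "p \<in> J" and x: "x \<in> carrier M"
    and v: "\<And>j. j \<in> J \<Longrightarrow> v (x \<ominus> c j) = \<gamma>" and g: "\<gamma> \<noteq> \<infinity>"
    and apart: "\<And>i j. i \<in> J \<Longrightarrow> j \<in> J \<Longrightarrow> i \<noteq> j \<Longrightarrow> \<not> \<gamma> \<sqsubset> v (c i \<ominus> c j)"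
  shows "res_pred (value_set M \<Delta> v) (Suc (card J)) \<gamma>"
proof -
  have gc: "\<gamma> \<in> carrier \<Delta>" using v[OF J(2)] x c[OF J(2)] val_closed[of "x \<ominus> c p"] by simp
  have cp: "c p \<in> carrier M" using c J by blast
  let ?f = "\<lambda>j. c j \<ominus> x"
  have v': "v (?f j) = \<gamma>" if "j \<in> J" for j using v[OF that] val_diff_commute[OF x c[OF that]] by simp
  let ?S = "insert \<zero> (?f ` J)"
  have diff: "?f i \<ominus> ?f j = c i \<ominus> c j" if "i \<in> J" "j \<in> J" for i j
    using M.diff_diff_cancel c x that by simp
  have inj: "inj_on ?f J"
  proof (rule inj_onI, rule ccontr)
    fix i j assume ij: "i \<in> J" "j \<in> J" "?f i = ?f j" "i \<noteq> j"
    then have "c i \<ominus> c j = \<zero>" using diff[OF ij(1,2)] c x by simp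
    then have "\<not> \<gamma> \<sqsubset> \<infinity>" using apart[OF ij(1,2,4)] by simp
    then show False using g by (simp add: clt_def)
  qed
  have z: "\<zero> \<notin> ?f ` J" using v' g by (metis (no_types, lifting) imageE val_zero)
  have "card ?S = Suc (card J)" using inj z J by (simp add: card_image)
  moreover have "\<forall>a\<in>?S. \<gamma> \<sqsubseteq> v a" using v' by auto
  moreover have "\<forall>a\<in>?S. \<forall>b\<in>?S. a \<noteq> b \<longrightarrow> \<not> \<gamma> \<sqsubset> v (a \<ominus> b)"
  proof (intro ballI impI)
    fix a b assume a: "a \<in> ?S" and b: "b \<in> ?S" and ab: "a \<noteq> b"
    have "v (c j \<ominus> x \<ominus> \<zero>) = \<gamma>" "v (\<zero> \<ominus> (c j \<ominus> x)) = \<gamma>" if "j \<in> J" for j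
      using v'[OF that] c[OF that] x by simp_all
    moreover have "\<not> \<gamma> \<sqsubset> v (?f i \<ominus> ?f j)" if "i \<in> J" "j \<in> J" "?f i \<noteq> ?f j" for i j
      using apart[OF that(1,2)] diff[OF that(1,2)] that(3) by auto
    ultimately show "\<not> \<gamma> \<sqsubset> v (a \<ominus> b)" using a b ab by auto
  qed
  moreover have "?S \<subseteq> carrier M" "finite ?S" using c x J by auto
  ultimately show ?thesis unfolding res_pred_iff[OF gc] using g by (intro conjI exI[of _ ?S]) auto
qed

end

text \<open>The trace that the two elementary equivalences leave on the residue modules at \<theta>.
  In \<open>idx\<close> the scalar \<open>r\<close> is non-zero, since only then is the index
  visible in the torsion submodules; for r = 0 it is \<open>mid_transfer\<close> that
  decides.\<close>

locale vmod_pair =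
  A: vmod K \<phi> F \<Delta> v + B: vmod K \<phi> G \<Gamma> w
  for K :: "('k, 'x) ring_scheme" and \<phi> :: "'k \<Rightarrow> 'k"
    and F :: "(nat \<Rightarrow> 'k, 'm, 'y) rmodule_scheme" and \<Delta> :: "('d, 'z) chain_scheme" and v :: "'m \<Rightarrow> 'd"
    and G :: "(nat \<Rightarrow> 'k, 'n, 'y2) rmodule_scheme" and \<Gamma> :: "('e, 'z2) chain_scheme" and w :: "'n \<Rightarrow> 'e" +
  assumes idx: "\<And>r g n. r \<in> carrier (skew_poly K \<phi>) \<Longrightarrow> r \<noteq> \<zero>\<^bsub>skew_poly K \<phi>\<^esub> \<Longrightarrow> g \<in> carrier (skew_poly K \<phi>) \<Longrightarrow>
      A.M.sep n (A.Pset r) (A.Pset g) \<longleftrightarrow> B.M.sep n (B.Pset r) (B.Pset g)"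
    and mid_transfer: "(\<exists>\<gamma>\<in>carrier \<Delta>. A.mid \<gamma>) \<longleftrightarrow> (\<exists>\<gamma>\<in>carrier \<Gamma>. B.mid \<gamma>)"
begin

lemma idx': "r \<in> carrier A.R \<Longrightarrow> g \<in> carrier A.R \<Longrightarrow>
  A.M.sep n (A.Pset r) (A.Pset g) \<longleftrightarrow> B.M.sep n (B.Pset r) (B.Pset g)"
  using idx[of r g n] A.sep_Pset_zero[of g n] B.sep_Pset_zero[of g n] mid_transfer
  by (cases "r = \<zero>\<^bsub>A.R\<^esub>") simp_all

text \<open>An instance of \<open>coset_transfer\<close> with equations \<open>I\<close> and
  inequations \<open>J\<close>. The obstructions are compared for all subsets of I \<union> J
  because the solvability of every subsystem enters the count of cosets.\<close>

lemma residue_transfer: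
  assumes r: "\<And>i. r i \<in> carrier A.R" and IJ: "I \<union> J \<subseteq> {..<k}" "\<And>i. i \<in> I \<union> J \<Longrightarrow> r i \<noteq> \<zero>\<^bsub>A.R\<^esub>"
    and e: "\<And>i. e i \<in> carrier F" and e': "\<And>i. e' i \<in> carrier G"
    and p: "p \<in> carrier F" "\<And>i. i \<in> I \<union> J \<Longrightarrow> p \<cdot>\<^bsub>F\<^esub> r i \<oplus>\<^bsub>F\<^esub> e i \<in> A.ge0"
    and p': "p' \<in> carrier G" "\<And>i. i \<in> I \<union> J \<Longrightarrow> p' \<cdot>\<^bsub>G\<^esub> r i \<oplus>\<^bsub>G\<^esub> e' i \<in> B.ge0"
    and kap: "\<And>C i. C \<subseteq> I \<union> J \<Longrightarrow> i \<in> C \<Longrightarrow> A.kappa r k e C i \<in> A.gt0 \<longleftrightarrow> B.kappa r k e' C i \<in> B.gt0"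
    and x: "x \<in> carrier F" "x \<ominus>\<^bsub>F\<^esub> p \<in> A.ge0" "\<And>i. i \<in> I \<Longrightarrow> x \<cdot>\<^bsub>F\<^esub> r i \<oplus>\<^bsub>F\<^esub> e i \<in> A.gt0"
      "\<And>j. j \<in> J \<Longrightarrow> x \<cdot>\<^bsub>F\<^esub> r j \<oplus>\<^bsub>F\<^esub> e j \<notin> A.gt0"
  shows "\<exists>x'\<in>carrier G. x' \<ominus>\<^bsub>G\<^esub> p' \<in> B.ge0 \<and> (\<forall>i\<in>I. x' \<cdot>\<^bsub>G\<^esub> r i \<oplus>\<^bsub>G\<^esub> e' i \<in> B.gt0) \<and>
    (\<forall>j\<in>J. x' \<cdot>\<^bsub>G\<^esub> r j \<oplus>\<^bsub>G\<^esub> e' j \<notin> B.gt0)"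
proof -
  let ?HA = "\<lambda>j. {x \<in> carrier F. x \<cdot>\<^bsub>F\<^esub> r j \<in> A.gt0}" and ?HB = "\<lambda>j. {x \<in> carrier G. x \<cdot>\<^bsub>G\<^esub> r j \<in> B.gt0}"
  let ?XAb = "{x \<in> carrier F. x \<ominus>\<^bsub>F\<^esub> p \<in> A.ge0}" and ?XBb = "{x \<in> carrier G. x \<ominus>\<^bsub>G\<^esub> p' \<in> B.ge0}"
  let ?XA = "\<lambda>j. {x \<in> carrier F. x \<cdot>\<^bsub>F\<^esub> r j \<oplus>\<^bsub>F\<^esub> e j \<in> A.gt0}"
  let ?XB = "\<lambda>j. {x \<in> carrier G. x \<cdot>\<^bsub>G\<^esub> r j \<oplus>\<^bsub>G\<^esub> e' j \<in> B.gt0}"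
  have FA: "coset_family F A.ge0 ?HA ?XAb ?XA" by (rule A.residue_family[of r e p, OF r e p(1)])
  have FB: "coset_family G B.ge0 ?HB ?XBb ?XB" by (rule B.residue_family[of r e' p', OF r e' p'(1)])
  interpret FA: coset_family F A.ge0 ?HA ?XAb ?XA by (rule FA)
  interpret FB: coset_family G B.ge0 ?HB ?XBb ?XB by (rule FB)
  have "FB.CA I J \<noteq> {}"
  proof (rule coset_transfer[OF FA FB, of J I])
    show "finite J" using IJ(1) finite_subset by auto
    show "FA.XA C \<noteq> {} \<longleftrightarrow> FB.XA C \<noteq> {}" if C: "C \<subseteq> I \<union> J" for C
    proof -
      have Ck: "C \<subseteq> {..<k}" using C IJ(1) by blast
      have C3: "r i \<noteq> \<zero>\<^bsub>A.R\<^esub>" "p \<cdot>\<^bsub>F\<^esub> r i \<oplus>\<^bsub>F\<^esub> e i \<in> A.ge0" "p' \<cdot>\<^bsub>G\<^esub> r i \<oplus>\<^bsub>G\<^esub> e' i \<in> B.ge0"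
        if "i \<in> C" for i using that C IJ(2) p(2) p'(2) by auto
      have "FA.XA C \<noteq> {} \<longleftrightarrow> C = {} \<or> (\<forall>i\<in>C. A.kappa r k e C i \<in> A.gt0)"
        by (rule A.residue_family_nonempty[of r e p C k, OF r e p(1) Ck C3(1,2)])
      moreover have "FB.XA C \<noteq> {} \<longleftrightarrow> C = {} \<or> (\<forall>i\<in>C. B.kappa r k e' C i \<in> B.gt0)"
        by (rule B.residue_family_nonempty[of r e' p' C k, OF r e' p'(1) Ck C3(1,3)])
      ultimately show ?thesis using kap[OF C] by simp
    qed
    show "A.M.sep n (FA.HA C) (FA.HA D) \<longleftrightarrow> B.M.sep n (FB.HA C) (FB.HA D)"
      if CD: "C \<subseteq> D" "D \<subseteq> I \<union> J" for C D n
    proof -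
      have k: "C \<subseteq> {..<k}" "D \<subseteq> {..<k}" using CD IJ(1) by auto
      show ?thesis
        unfolding A.residue_family_HA[of r C k, OF r k(1)] A.residue_family_HA[of r D k, OF r k(2)]
          B.residue_family_HA[of r C k, OF r k(1)] B.residue_family_HA[of r D k, OF r k(2)]
        using A.sys_a_closed[of r C k, OF r k(1)] A.sys_a_closed[of r D k, OF r k(2)] r
        by (intro idx') simp_all
    qed
    have "x \<in> FA.CA I J" unfolding FA.CA_def FA.XA_def using x by auto
    then show "FA.CA I J \<noteq> {}" by blast
  qed
  then obtain x' where "x' \<in> FB.CA I J" by blast
  then show ?thesis unfolding FB.CA_def FB.XA_def by (intro bexI[of _ x']) auto
qed

text \<open>A one-point extension of ultrametric spaces. Let c_p be a centre closest to
  \<open>x\<close>. The centres equally close fall into finitely many classes modulo values above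
  that distance, and \<open>x\<close> represents a further class, so a residue predicate holds; it
  transfers and yields a free class on the other side. The distance to any farther centre is then
  forced by the ultrametric inequality.\<close>

lemma level_transfer:
  assumes I: "finite I" "I \<noteq> {}" and c: "\<And>i. i \<in> I \<Longrightarrow> c i \<in> carrier F" "\<And>i. i \<in> I \<Longrightarrow> c' i \<in> carrier G"
    and x: "x \<in> carrier F" "\<And>i. i \<in> I \<Longrightarrow> v (x \<ominus>\<^bsub>F\<^esub> c i) = \<alpha> i" and a': "\<And>i. i \<in> I \<Longrightarrow> \<alpha>' i \<in> carrier \<Gamma>"
    and 1: "\<And>i j. i \<in> I \<Longrightarrow> j \<in> I \<Longrightarrow> A.clt (\<alpha> i) (\<alpha> j) \<longleftrightarrow> B.clt (\<alpha>' i) (\<alpha>' j)"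
    and 2: "\<And>i j l. i \<in> I \<Longrightarrow> j \<in> I \<Longrightarrow> l \<in> I \<Longrightarrow>
        A.clt (v (c i \<ominus>\<^bsub>F\<^esub> c j)) (\<alpha> l) \<longleftrightarrow> B.clt (w (c' i \<ominus>\<^bsub>G\<^esub> c' j)) (\<alpha>' l)"
      "\<And>i j l. i \<in> I \<Longrightarrow> j \<in> I \<Longrightarrow> l \<in> I \<Longrightarrow>
        A.clt (\<alpha> l) (v (c i \<ominus>\<^bsub>F\<^esub> c j)) \<longleftrightarrow> B.clt (\<alpha>' l) (w (c' i \<ominus>\<^bsub>G\<^esub> c' j))"
    and 3: "\<And>i. i \<in> I \<Longrightarrow> \<alpha> i = infty \<Delta> \<longleftrightarrow> \<alpha>' i = infty \<Gamma>"
      "\<And>i n. i \<in> I \<Longrightarrow> n \<le> Suc (card I) \<Longrightarrow>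
        res_pred (value_set F \<Delta> v) n (\<alpha> i) \<longleftrightarrow> res_pred (value_set G \<Gamma> w) n (\<alpha>' i)"
  shows "\<exists>x'\<in>carrier G. \<forall>i\<in>I. w (x' \<ominus>\<^bsub>G\<^esub> c' i) = \<alpha>' i"
proof -
  obtain p where p: "p \<in> I" "\<And>i. i \<in> I \<Longrightarrow> A.cle (\<alpha> i) (\<alpha> p)"
    using A.max_exists[OF I, of \<alpha>] by blast
  have cp: "c p \<in> carrier F" "c' p \<in> carrier G" using c p by auto
  \<comment> \<open>Equality is obtained from the absence of a strict inequality in either
    direction.\<close>
  have eq': "w (c' i \<ominus>\<^bsub>G\<^esub> c' j) = \<alpha>' l" if "i \<in> I" "j \<in> I" "l \<in> I" "v (c i \<ominus>\<^bsub>F\<^esub> c j) = \<alpha> l" for i j l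
    using 2[OF that(1-3)] that(4) B.ord.less_linear[of "w (c' i \<ominus>\<^bsub>G\<^esub> c' j)" "\<alpha>' l"] by simp
  show ?thesis
  proof (cases "\<alpha> p = infty \<Delta>")
    case True
    then have "x = c p" using x(2)[OF p(1)] x(1) cp A.val_inf_iff[of "x \<ominus>\<^bsub>F\<^esub> c p"] A.M.eq_iff_diff_zero[of x "c p"] by simp
    then have "w (c' p \<ominus>\<^bsub>G\<^esub> c' i) = \<alpha>' i" if "i \<in> I" for i
      using eq'[OF p(1) that that] x(2)[OF that] by simp
    then show ?thesis using cp by blast
  next
    case False
    define J where "J = {i \<in> I. \<alpha> i = \<alpha> p}"
    have J: "finite J" "J \<subseteq> I" "p \<in> J" using I p by (auto simp: J_def)
    have ap: "\<alpha> p \<in> carrier \<Delta>" using x(2)[OF p(1)] x(1) cp A.val_closed[of "x \<ominus>\<^bsub>F\<^esub> c p"] by simp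
    have sg: "A.M.subgrp (val_gt F \<Delta> v (\<alpha> p))" using A.subgrp_val_gt[OF ap False] .
    let ?f = "\<lambda>j. A.M.cls (val_gt F \<Delta> v (\<alpha> p)) (c j)"
    have f_iff: "?f i = ?f j \<longleftrightarrow> A.clt (\<alpha> p) (v (c i \<ominus>\<^bsub>F\<^esub> c j))" if "i \<in> J" "j \<in> J" for i j
    proof -
      have "c i \<in> carrier F" "c j \<in> carrier F" using c that J(2) by auto
      then show ?thesis using A.M.cls_eq_iff[OF sg] A.val_gt_eq[OF ap] by simp
    qed
    \<comment> \<open>One centre from each class modulo the values above the minimal distance:
      congruent centres must not be counted twice in the residue predicate.\<close>
    obtain J' where J': "J' \<subseteq> J" "inj_on ?f J'" "?f ` J' = ?f ` J"
      using subset_image_inj[THEN iffD1, of "?f ` J" ?f J, OF order_refl] by (elim exE conjE) (rule that; simp)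
    have "p \<in> J" by fact
    then have "J' \<noteq> {}" using J'(3) by (metis empty_iff image_is_empty)
    then obtain q where q: "q \<in> J'" by blast
    have qJ: "q \<in> J" "q \<in> I" using q J' J by auto
    have fJ': "finite J'" using J J' finite_subset by blast
    have cJ': "c j \<in> carrier F" "c' j \<in> carrier G" "j \<in> I" "v (x \<ominus>\<^bsub>F\<^esub> c j) = \<alpha> p" if "j \<in> J" for j
      using that J c x(2) by (auto simp: J_def)
    have "res_pred (value_set F \<Delta> v) (Suc (card J')) (\<alpha> p)"
    proof (rule A.res_pred_witness[of J' c q x "\<alpha> p", OF _ fJ' q x(1) _ False])
      show "c j \<in> carrier F" "v (x \<ominus>\<^bsub>F\<^esub> c j) = \<alpha> p" if "j \<in> J'" for j
        using that J'(1) cJ'(1,4) by blast+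
      fix i j assume "i \<in> J'" "j \<in> J'" "i \<noteq> j"
      then show "\<not> A.clt (\<alpha> p) (v (c i \<ominus>\<^bsub>F\<^esub> c j))" using f_iff[of i j] J'(1,2) by (auto simp: inj_on_def)
    qed
    moreover have "card J' \<le> card I" using J J' I by (meson card_mono subset_trans)
    ultimately have R': "res_pred (value_set G \<Gamma> w) (Suc (card J')) (\<alpha>' p)" using 3(2)[OF p(1)] by simp
    have far: "A.cle (\<alpha> p) (v (c i \<ominus>\<^bsub>F\<^esub> c j))" if "i \<in> J" "j \<in> J" for i j
      using A.val_diff_trans_ge[OF cJ'(1)[OF that(1)] x(1) cJ'(1)[OF that(2)], of "\<alpha> p"]
        cJ'(4)[OF that(1)] cJ'(4)[OF that(2)] A.val_diff_commute[OF x(1) cJ'(1)[OF that(1)]] by simp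
    have far': "B.cle (\<alpha>' p) (w (c' i \<ominus>\<^bsub>G\<^esub> c' j))" if "i \<in> J" "j \<in> J" for i j
      using far[OF that] 2(1)[OF cJ'(3)[OF that(1)] cJ'(3)[OF that(2)] p(1)]
      by (simp add: A.ord.not_less[symmetric] B.ord.not_less[symmetric])
    obtain y where y: "y \<in> carrier G" "\<And>j. j \<in> J' \<Longrightarrow> w (y \<ominus>\<^bsub>G\<^esub> c' j) = \<alpha>' p"
    proof -
      have "\<exists>x\<in>carrier G. \<forall>j\<in>J'. w (x \<ominus>\<^bsub>G\<^esub> c' j) = \<alpha>' p"
      proof (rule B.new_class[of J' c' q "\<alpha>' p", OF _ q fJ' a'[OF p(1)] R'])
        fix j assume "j \<in> J'"
        then show "c' j \<in> carrier G" "B.cle (\<alpha>' p) (w (c' j \<ominus>\<^bsub>G\<^esub> c' q))"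
          using J'(1) cJ'(2)[of j] far'[of j q] qJ(1) by auto
      qed
      then show ?thesis using that by blast
    qed
    have "w (y \<ominus>\<^bsub>G\<^esub> c' i) = \<alpha>' i" if i: "i \<in> I" for i
    proof (cases "i \<in> J")
      case True
      then obtain j where j: "j \<in> J'" "?f i = ?f j" using J'(3) by (metis (no_types, lifting) imageE imageI)
      then have jJ: "j \<in> J" using J'(1) by blast
      have near: "B.clt (\<alpha>' p) (w (c' j \<ominus>\<^bsub>G\<^esub> c' i))"
        using f_iff[OF jJ True] j(2) 2(2)[OF cJ'(3)[OF jJ] i p(1)] by simp
      have "\<alpha>' i = \<alpha>' p"
        using 1[OF i p(1)] 1[OF p(1) i] True B.ord.less_linear[of "\<alpha>' i" "\<alpha>' p"] unfolding J_def by simp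
      then show ?thesis
        using B.val_diff_eq[OF y(1) cJ'(2)[OF jJ] cJ'(2)[OF True]] y(2)[OF j(1)] near by simp
    next
      case False
      then have "A.clt (\<alpha> i) (\<alpha> p)" using p(2)[OF i] i A.ord.le_less[of "\<alpha> i" "\<alpha> p"] by (simp add: J_def)
      then have lq: "A.clt (\<alpha> i) (v (x \<ominus>\<^bsub>F\<^esub> c q))" using cJ'(4)[OF qJ(1)] by simp
      have ci: "c i \<in> carrier F" "c' i \<in> carrier G" using c i by auto
      have cq: "c q \<in> carrier F" "c' q \<in> carrier G" using cJ'[OF qJ(1)] by auto
      have "v (c i \<ominus>\<^bsub>F\<^esub> c q) = \<alpha> i"
        using A.val_diff_eq[OF ci(1) x(1) cq(1)] lq x(2)[OF i] A.val_diff_commute[OF x(1) ci(1)] by simp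
      then have 5: "w (c' i \<ominus>\<^bsub>G\<^esub> c' q) = \<alpha>' i" using eq'[OF i qJ(2) i] by simp
      have "B.clt (\<alpha>' i) (\<alpha>' p)" using 1[OF i p(1)] \<open>A.clt (\<alpha> i) (\<alpha> p)\<close> by simp
      then have "B.clt (w (c' i \<ominus>\<^bsub>G\<^esub> c' q)) (w (c' q \<ominus>\<^bsub>G\<^esub> y))"
        using 5 y(2)[OF q] B.val_diff_commute[OF y(1) cq(2)] by simp
      then show ?thesis
        using B.val_diff_eq[OF ci(2) cq(2) y(1)] 5 B.val_diff_commute[OF y(1) ci(2)] by simp
    qed
    then show ?thesis using y(1) by blast
  qed
qed


text \<open>As x r_i + e_i = (x - c_i) r_i for a root c_i, the values to be realised are, away from
  \<theta>, distances to roots; hence the restriction to r_i \<noteq> 0. If some prescribed value is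
  at least \<theta>, a class modulo \<open>gt0\<close> is found first and the positive distances are
  realised inside it. The negative ones are then automatic. If all are negative,
  \<open>level_transfer\<close> applies directly.\<close>

lemma transfer:
  fixes k :: nat and r :: "nat \<Rightarrow> nat \<Rightarrow> 'k" and s :: "nat \<Rightarrow> nat \<Rightarrow> nat \<Rightarrow> 'k"
  defines "N \<equiv> {i. i < k \<and> r i \<noteq> \<zero>\<^bsub>A.R\<^esub>}"
  assumes r: "\<And>i. r i \<in> carrier A.R"
    and e: "\<And>i. e i \<in> carrier F" and e': "\<And>i. e' i \<in> carrier G" and x: "x \<in> carrier F"
    and s: "\<And>i j. s i j \<in> carrier A.R"
      "\<And>i j. i \<in> N \<Longrightarrow> j \<in> N \<Longrightarrow> r i \<otimes>\<^bsub>A.R\<^esub> s i j = r j \<otimes>\<^bsub>A.R\<^esub> s j i"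
      "\<And>i j. i \<in> N \<Longrightarrow> j \<in> N \<Longrightarrow> r i \<otimes>\<^bsub>A.R\<^esub> s i j \<noteq> \<zero>\<^bsub>A.R\<^esub>"
    and \<alpha>: "\<And>i. \<alpha> i \<in> carrier \<Delta>" "\<And>i. i \<in> N \<Longrightarrow> A.lam (r i) (\<alpha> i) = v (x \<cdot>\<^bsub>F\<^esub> r i \<oplus>\<^bsub>F\<^esub> e i)"
    and \<alpha>': "\<And>i. \<alpha>' i \<in> carrier \<Gamma>"
    and \<delta>: "\<And>i j. \<delta> i j \<in> carrier \<Delta>" "\<And>i j. i \<in> N \<Longrightarrow> j \<in> N \<Longrightarrow>
        A.lam (r i \<otimes>\<^bsub>A.R\<^esub> s i j) (\<delta> i j) = v (e i \<cdot>\<^bsub>F\<^esub> s i j \<ominus>\<^bsub>F\<^esub> e j \<cdot>\<^bsub>F\<^esub> s j i)"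
    and \<delta>': "\<And>i j. \<delta>' i j \<in> carrier \<Gamma>" "\<And>i j. i \<in> N \<Longrightarrow> j \<in> N \<Longrightarrow>
        B.lam (r i \<otimes>\<^bsub>A.R\<^esub> s i j) (\<delta>' i j) = w (e' i \<cdot>\<^bsub>G\<^esub> s i j \<ominus>\<^bsub>G\<^esub> e' j \<cdot>\<^bsub>G\<^esub> s j i)"
    and 1: "\<And>i j. i \<in> N \<Longrightarrow> j \<in> N \<Longrightarrow> A.clt (\<alpha> i) (\<alpha> j) \<longleftrightarrow> B.clt (\<alpha>' i) (\<alpha>' j)"
    and 2: "\<And>i j l. i \<in> N \<Longrightarrow> j \<in> N \<Longrightarrow> l \<in> N \<Longrightarrow> A.clt (\<delta> i j) (\<alpha> l) \<longleftrightarrow> B.clt (\<delta>' i j) (\<alpha>' l)"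
      "\<And>i j l. i \<in> N \<Longrightarrow> j \<in> N \<Longrightarrow> l \<in> N \<Longrightarrow> A.clt (\<alpha> l) (\<delta> i j) \<longleftrightarrow> B.clt (\<alpha>' l) (\<delta>' i j)"
    and 3: "\<And>i. i \<in> N \<Longrightarrow> \<alpha> i = infty \<Delta> \<longleftrightarrow> \<alpha>' i = infty \<Gamma>"
      "\<And>i n. i \<in> N \<Longrightarrow> n \<le> Suc k \<Longrightarrow>
        res_pred (value_set F \<Delta> v) n (\<alpha> i) \<longleftrightarrow> res_pred (value_set G \<Gamma> w) n (\<alpha>' i)"
    and 4: "\<And>i. i \<in> N \<Longrightarrow> A.neg (\<alpha> i) \<longleftrightarrow> B.neg (\<alpha>' i)" "\<And>i. i \<in> N \<Longrightarrow> A.pos (\<alpha> i) \<longleftrightarrow> B.pos (\<alpha>' i)"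
      "\<And>i j. i \<in> N \<Longrightarrow> j \<in> N \<Longrightarrow> A.neg (\<delta> i j) \<longleftrightarrow> B.neg (\<delta>' i j)"
    and kap: "\<And>C i. C \<subseteq> N \<Longrightarrow> i \<in> C \<Longrightarrow> A.kappa r k e C i \<in> A.gt0 \<longleftrightarrow> B.kappa r k e' C i \<in> B.gt0"
  shows "\<exists>x'\<in>carrier G. \<forall>i\<in>N. w (x' \<cdot>\<^bsub>G\<^esub> r i \<oplus>\<^bsub>G\<^esub> e' i) = B.lam (r i) (\<alpha>' i)"
proof -
  have fN: "finite N" "N \<subseteq> {..<k}" unfolding N_def by auto
  have cN: "card I \<le> k" if "I \<subseteq> N" for I
    using that fN card_mono[of "{..<k}" I] by auto
  have r0: "r i \<noteq> \<zero>\<^bsub>A.R\<^esub>" if "i \<in> N" for i using that by (simp add: N_def)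
  have sR: "r i \<otimes>\<^bsub>A.R\<^esub> s i j \<in> carrier A.R" for i j using r s(1) by simp
  have "\<exists>c. c \<in> carrier F \<and> c \<cdot>\<^bsub>F\<^esub> r i = \<ominus>\<^bsub>F\<^esub> e i" if "i \<in> N" for i
    using A.div_obtain[OF A.M.a_inv_closed[OF e[of i]] r r0[OF that]] by metis
  then obtain c where c: "\<And>i. i \<in> N \<Longrightarrow> c i \<in> carrier F" "\<And>i. i \<in> N \<Longrightarrow> c i \<cdot>\<^bsub>F\<^esub> r i = \<ominus>\<^bsub>F\<^esub> e i"
    by metis
  have "\<exists>c. c \<in> carrier G \<and> c \<cdot>\<^bsub>G\<^esub> r i = \<ominus>\<^bsub>G\<^esub> e' i" if "i \<in> N" for i
    using B.div_obtain[OF B.M.a_inv_closed[OF e'[of i]] r r0[OF that]] by metis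
  then obtain c' where c': "\<And>i. i \<in> N \<Longrightarrow> c' i \<in> carrier G" "\<And>i. i \<in> N \<Longrightarrow> c' i \<cdot>\<^bsub>G\<^esub> r i = \<ominus>\<^bsub>G\<^esub> e' i"
    by metis
  have rootA: "x \<cdot>\<^bsub>F\<^esub> r i \<oplus>\<^bsub>F\<^esub> e i = (x \<ominus>\<^bsub>F\<^esub> d) \<cdot>\<^bsub>F\<^esub> r i"
    if "x \<in> carrier F" "d \<in> carrier F" "d \<cdot>\<^bsub>F\<^esub> r i = \<ominus>\<^bsub>F\<^esub> e i" for x d i
    using A.act_root[OF that(1,2) r e that(3)] .
  have rootB: "x \<cdot>\<^bsub>G\<^esub> r i \<oplus>\<^bsub>G\<^esub> e' i = (x \<ominus>\<^bsub>G\<^esub> d) \<cdot>\<^bsub>G\<^esub> r i"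
    if "x \<in> carrier G" "d \<in> carrier G" "d \<cdot>\<^bsub>G\<^esub> r i = \<ominus>\<^bsub>G\<^esub> e' i" for x d i
    using B.act_root[OF that(1,2) r e' that(3)] .
  have diffA: "A.lam (r i \<otimes>\<^bsub>A.R\<^esub> s i j) (\<delta> i j) = v ((d \<ominus>\<^bsub>F\<^esub> f) \<cdot>\<^bsub>F\<^esub> (r i \<otimes>\<^bsub>A.R\<^esub> s i j))"
    if "i \<in> N" "j \<in> N" "d \<in> carrier F" "f \<in> carrier F" "d \<cdot>\<^bsub>F\<^esub> r i = \<ominus>\<^bsub>F\<^esub> e i" "f \<cdot>\<^bsub>F\<^esub> r j = \<ominus>\<^bsub>F\<^esub> e j" for i j d f
    using A.root_difference[OF that(3,4) e e r s(1) r s(1) that(5,6) s(2)[OF that(1,2)]]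
      \<delta>(2)[OF that(1,2)] by simp
  have diffB: "B.lam (r i \<otimes>\<^bsub>A.R\<^esub> s i j) (\<delta>' i j) = w ((d \<ominus>\<^bsub>G\<^esub> f) \<cdot>\<^bsub>G\<^esub> (r i \<otimes>\<^bsub>A.R\<^esub> s i j))"
    if "i \<in> N" "j \<in> N" "d \<in> carrier G" "f \<in> carrier G" "d \<cdot>\<^bsub>G\<^esub> r i = \<ominus>\<^bsub>G\<^esub> e' i" "f \<cdot>\<^bsub>G\<^esub> r j = \<ominus>\<^bsub>G\<^esub> e' j" for i j d f
    using B.root_difference[OF that(3,4) e' e' r s(1) r s(1) that(5,6) s(2)[OF that(1,2)]]
      \<delta>'(2)[OF that(1,2)] by simp
  have lamA: "A.lam (r i) (\<alpha> i) = v ((x \<ominus>\<^bsub>F\<^esub> c i) \<cdot>\<^bsub>F\<^esub> r i)" if "i \<in> N" for i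
    using \<alpha>(2)[OF that] rootA[OF x c(1)[OF that] c(2)[OF that]] by simp
  have xc: "x \<ominus>\<^bsub>F\<^esub> c i \<in> carrier F" if "i \<in> N" for i using x c(1)[OF that] by simp
  have cc: "c i \<ominus>\<^bsub>F\<^esub> c j \<in> carrier F" if "i \<in> N" "j \<in> N" for i j using c(1) that by simp
  have cc': "c' i \<ominus>\<^bsub>G\<^esub> c' j \<in> carrier G" if "i \<in> N" "j \<in> N" for i j using c'(1) that by simp
  note negA = A.lam_val_neg[OF r r0 xc \<alpha>(1) lamA]
  have dA: "A.lam (r i \<otimes>\<^bsub>A.R\<^esub> s i j) (\<delta> i j) = v ((c i \<ominus>\<^bsub>F\<^esub> c j) \<cdot>\<^bsub>F\<^esub> (r i \<otimes>\<^bsub>A.R\<^esub> s i j))"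
    if "i \<in> N" "j \<in> N" for i j
    using diffA[OF that c(1)[OF that(1)] c(1)[OF that(2)] c(2)[OF that(1)] c(2)[OF that(2)]] .
  have dB: "B.lam (r i \<otimes>\<^bsub>A.R\<^esub> s i j) (\<delta>' i j) = w ((c' i \<ominus>\<^bsub>G\<^esub> c' j) \<cdot>\<^bsub>G\<^esub> (r i \<otimes>\<^bsub>A.R\<^esub> s i j))"
    if "i \<in> N" "j \<in> N" for i j
    using diffB[OF that c'(1)[OF that(1)] c'(1)[OF that(2)] c'(2)[OF that(1)] c'(2)[OF that(2)]] .
  have fin_neg: "w (x' \<cdot>\<^bsub>G\<^esub> r i \<oplus>\<^bsub>G\<^esub> e' i) = B.lam (r i) (\<alpha>' i)"
    if "i \<in> N" "x' \<in> carrier G" "w (x' \<ominus>\<^bsub>G\<^esub> c' i) = \<alpha>' i" "A.neg (\<alpha> i)" for i x'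
    using rootB[OF that(2) c'(1)[OF that(1)] c'(2)[OF that(1)]] that 4(1)[OF that(1)]
      B.val_act[OF r _ _ r0[OF that(1)], of "x' \<ominus>\<^bsub>G\<^esub> c' i"] c'(1)[OF that(1)]
    by (simp add: B.mid_iff)
  show ?thesis
  proof (cases "\<forall>i\<in>N. A.neg (\<alpha> i)")
    case True
    show ?thesis
    proof (cases "N = {}")
      case True
      then show ?thesis by (intro bexI[of _ "\<zero>\<^bsub>G\<^esub>"]) auto
    next
      case False
      \<comment> \<open>Only comparisons of the distances of roots with negative values matter here,
        and these do not depend on the choice of the roots.\<close>
      have "\<exists>x'\<in>carrier G. \<forall>i\<in>N. w (x' \<ominus>\<^bsub>G\<^esub> c' i) = \<alpha>' i"
      proof (rule level_transfer[OF fN(1) False c(1) c'(1) x])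
        show "v (x \<ominus>\<^bsub>F\<^esub> c i) = \<alpha> i" if "i \<in> N" for i using negA(2)[OF that that that] True that by blast
        fix i j l assume N: "i \<in> N" "j \<in> N" "l \<in> N"
        have n: "A.neg (\<alpha> l)" "B.neg (\<alpha>' l)" using True 4(1) N(3) by auto
        show "A.clt (v (c i \<ominus>\<^bsub>F\<^esub> c j)) (\<alpha> l) \<longleftrightarrow> B.clt (w (c' i \<ominus>\<^bsub>G\<^esub> c' j)) (\<alpha>' l)"
          "A.clt (\<alpha> l) (v (c i \<ominus>\<^bsub>F\<^esub> c j)) \<longleftrightarrow> B.clt (\<alpha>' l) (w (c' i \<ominus>\<^bsub>G\<^esub> c' j))"
          using A.lam_val_compare[OF sR s(3)[OF N(1,2)] cc[OF N(1,2)] \<delta>(1) dA[OF N(1,2)] n(1) \<alpha>(1)]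
            B.lam_val_compare[OF sR s(3)[OF N(1,2)] cc'[OF N(1,2)] \<delta>'(1) dB[OF N(1,2)] n(2) \<alpha>'] 2[OF N]
          by simp_all
      qed (use 1 3 \<alpha>' cN[OF order_refl] in auto)
      then show ?thesis using fin_neg True by blast
    qed
  next
    case False
    \<comment> \<open>The roots with this index anchor the two cosets in which the residue problem
      is posed.\<close>
    then obtain p where p: "p \<in> N" "\<not> A.neg (\<alpha> p)" by blast
    define I where "I = {i \<in> N. A.pos (\<alpha> i)}"
    define J where "J = {i \<in> N. A.mid (\<alpha> i)}"
    have IJ: "I \<union> J \<subseteq> N" by (auto simp: I_def J_def)
    have IJn: "\<not> A.neg (\<alpha> i)" if "i \<in> I \<union> J" for i using that A.neg_not_pos by (auto simp: I_def J_def A.mid_iff)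
    have ge: "x \<ominus>\<^bsub>F\<^esub> c i \<in> A.ge0" if "i \<in> N" "\<not> A.neg (\<alpha> i)" for i
      using negA(1)[OF that(1) that(1) that(1)] that xc[OF that(1)] by (simp add: A.ge0_def)
    have cp: "c p \<ominus>\<^bsub>F\<^esub> c i \<in> A.ge0" if i: "i \<in> N" "\<not> A.neg (\<alpha> i)" for i
    proof -
      have "c p \<ominus>\<^bsub>F\<^esub> x \<in> A.ge0"
        using ge[OF p] A.M.subgrp_diff_commute[OF A.subgrp_ge0 x c(1)[OF p(1)]] by simp
      then show ?thesis
        using A.M.subgrp_diff_trans[OF A.subgrp_ge0 c(1)[OF p(1)] x c(1)[OF i(1)]] ge[OF i] by blast
    qed
    have cp': "c' p \<ominus>\<^bsub>G\<^esub> c' i \<in> B.ge0" if i: "i \<in> N" "\<not> A.neg (\<alpha> i)" for i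
    proof -
      have "\<not> A.neg (\<delta> p i)"
        using A.lam_val_neg(1)[OF sR s(3)[OF p(1) i(1)] cc[OF p(1) i(1)] \<delta>(1) dA[OF p(1) i(1)]] cp[OF i]
        by (simp add: A.ge0_def)
      then have "\<not> B.neg (\<delta>' p i)" using 4(3)[OF p(1) i(1)] by simp
      then show ?thesis
        using B.lam_val_neg(1)[OF sR s(3)[OF p(1) i(1)] cc'[OF p(1) i(1)] \<delta>'(1) dB[OF p(1) i(1)]] cc'[OF p(1) i(1)]
        by (simp add: B.ge0_def)
    qed
    have gt_iff: "x \<cdot>\<^bsub>F\<^esub> r i \<oplus>\<^bsub>F\<^esub> e i \<in> A.gt0 \<longleftrightarrow> A.pos (\<alpha> i)" if "i \<in> N" for i
      using \<alpha>(2)[OF that] A.pos_lam[OF \<alpha>(1), of "r i" i] x r e by (simp add: A.gt0_def)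
    have "\<exists>x'\<in>carrier G. x' \<ominus>\<^bsub>G\<^esub> c' p \<in> B.ge0 \<and> (\<forall>i\<in>I. x' \<cdot>\<^bsub>G\<^esub> r i \<oplus>\<^bsub>G\<^esub> e' i \<in> B.gt0) \<and>
      (\<forall>j\<in>J. x' \<cdot>\<^bsub>G\<^esub> r j \<oplus>\<^bsub>G\<^esub> e' j \<notin> B.gt0)"
    proof (rule residue_transfer[of r I J k e e' "c p" "c' p" x, OF r])
      show "I \<union> J \<subseteq> {..<k}" using IJ fN(2) by (rule subset_trans)
      show "x \<ominus>\<^bsub>F\<^esub> c p \<in> A.ge0" using ge[OF p] .
      show "c p \<in> carrier F" "c' p \<in> carrier G" using c(1) c'(1) p by auto
      fix i assume i: "i \<in> I \<union> J"
      then have iN: "i \<in> N" "\<not> A.neg (\<alpha> i)" using IJ IJn by auto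
      show "r i \<noteq> \<zero>\<^bsub>A.R\<^esub>" using r0[OF iN(1)] .
      show "c p \<cdot>\<^bsub>F\<^esub> r i \<oplus>\<^bsub>F\<^esub> e i \<in> A.ge0"
        using rootA[OF c(1)[OF p(1)] c(1)[OF iN(1)] c(2)[OF iN(1)]] A.ge0_act[OF cp[OF iN] r] by simp
      show "c' p \<cdot>\<^bsub>G\<^esub> r i \<oplus>\<^bsub>G\<^esub> e' i \<in> B.ge0"
        using rootB[OF c'(1)[OF p(1)] c'(1)[OF iN(1)] c'(2)[OF iN(1)]] B.ge0_act[OF cp'[OF iN] r] by simp
    next
      show "x \<cdot>\<^bsub>F\<^esub> r i \<oplus>\<^bsub>F\<^esub> e i \<in> A.gt0" if "i \<in> I" for i using that gt_iff[of i] by (simp add: I_def)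
      show "x \<cdot>\<^bsub>F\<^esub> r i \<oplus>\<^bsub>F\<^esub> e i \<notin> A.gt0" if "i \<in> J" for i
        using that gt_iff[of i] by (simp add: J_def A.mid_iff)
      show "A.kappa r k e C i \<in> A.gt0 \<longleftrightarrow> B.kappa r k e' C i \<in> B.gt0" if "C \<subseteq> I \<union> J" "i \<in> C" for C i
        using kap[OF subset_trans[OF that(1) IJ] that(2)] .
    qed (use e e' x in auto)
    then obtain y where y: "y \<in> carrier G" "y \<ominus>\<^bsub>G\<^esub> c' p \<in> B.ge0"
      "\<And>i. i \<in> I \<Longrightarrow> y \<cdot>\<^bsub>G\<^esub> r i \<oplus>\<^bsub>G\<^esub> e' i \<in> B.gt0" "\<And>j. j \<in> J \<Longrightarrow> y \<cdot>\<^bsub>G\<^esub> r j \<oplus>\<^bsub>G\<^esub> e' j \<notin> B.gt0"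
      by blast
    have "\<exists>x'\<in>carrier G. x' \<ominus>\<^bsub>G\<^esub> y \<in> B.gt0 \<and> (\<forall>i\<in>I. w (x' \<cdot>\<^bsub>G\<^esub> r i \<oplus>\<^bsub>G\<^esub> e' i) = B.lam (r i) (\<alpha>' i))"
    proof (cases "I = {}")
      case True
      then show ?thesis using y(1) B.M.subgrp_zero[OF B.subgrp_gt0] by (intro bexI[of _ y]) auto
    next
      case False
      have iN: "i \<in> N" if "i \<in> I" for i using that IJ by blast
      \<comment> \<open>The roots chosen so far may be at distance \<theta> from \<open>x\<close>
        and \<open>y\<close>. They are exchanged for roots at positive distance, whose mutual
        distances are exactly \<open>\<delta> i j\<close> and \<open>\<delta>' i j\<close>.\<close>
      have "\<exists>d\<in>carrier F. d \<cdot>\<^bsub>F\<^esub> r i = \<ominus>\<^bsub>F\<^esub> e i \<and> x \<ominus>\<^bsub>F\<^esub> d \<in> A.gt0" if "i \<in> I" for i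
        using that gt_iff[of i] A.root_near[OF r r0[OF iN[OF that]] x e] by (simp add: I_def)
      then obtain d where d: "\<And>i. i \<in> I \<Longrightarrow> d i \<in> carrier F" "\<And>i. i \<in> I \<Longrightarrow> d i \<cdot>\<^bsub>F\<^esub> r i = \<ominus>\<^bsub>F\<^esub> e i"
        "\<And>i. i \<in> I \<Longrightarrow> x \<ominus>\<^bsub>F\<^esub> d i \<in> A.gt0" by metis
      have "\<exists>d\<in>carrier G. d \<cdot>\<^bsub>G\<^esub> r i = \<ominus>\<^bsub>G\<^esub> e' i \<and> y \<ominus>\<^bsub>G\<^esub> d \<in> B.gt0" if "i \<in> I" for i
        using B.root_near[OF r r0[OF iN[OF that]] y(1) e' y(3)[OF that]] .
      then obtain d' where d': "\<And>i. i \<in> I \<Longrightarrow> d' i \<in> carrier G" "\<And>i. i \<in> I \<Longrightarrow> d' i \<cdot>\<^bsub>G\<^esub> r i = \<ominus>\<^bsub>G\<^esub> e' i"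
        "\<And>i. i \<in> I \<Longrightarrow> y \<ominus>\<^bsub>G\<^esub> d' i \<in> B.gt0" by metis
      have vd: "v (x \<ominus>\<^bsub>F\<^esub> d i) = \<alpha> i" if i: "i \<in> I" for i
      proof -
        have "A.lam (r i) (\<alpha> i) = v ((x \<ominus>\<^bsub>F\<^esub> d i) \<cdot>\<^bsub>F\<^esub> r i)"
          using \<alpha>(2)[OF iN[OF i]] rootA[OF x d(1,2)[OF i]] by simp
        then show ?thesis
          using A.lam_val_pos[OF r r0[OF iN[OF i]] _ \<alpha>(1)] d(3)[OF i] by (simp add: A.gt0_def)
      qed
      have dd: "v (d i \<ominus>\<^bsub>F\<^esub> d j) = \<delta> i j" if ij: "i \<in> I" "j \<in> I" for i j
      proof -
        have "d i \<ominus>\<^bsub>F\<^esub> x \<in> A.gt0"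
          using d(3)[OF ij(1)] A.M.subgrp_diff_commute[OF A.subgrp_gt0 x d(1)[OF ij(1)]] by simp
        then have "d i \<ominus>\<^bsub>F\<^esub> d j \<in> A.gt0"
          using A.M.subgrp_diff_trans[OF A.subgrp_gt0 d(1)[OF ij(1)] x d(1)[OF ij(2)]] d(3)[OF ij(2)] by blast
        then show ?thesis
          using A.lam_val_pos[OF sR s(3)[OF iN[OF ij(1)] iN[OF ij(2)]] _ \<delta>(1)
              diffA[OF iN[OF ij(1)] iN[OF ij(2)] d(1)[OF ij(1)] d(1)[OF ij(2)] d(2)[OF ij(1)] d(2)[OF ij(2)]]]
          by (simp add: A.gt0_def)
      qed
      have dd': "w (d' i \<ominus>\<^bsub>G\<^esub> d' j) = \<delta>' i j" if ij: "i \<in> I" "j \<in> I" for i j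
      proof -
        have "d' i \<ominus>\<^bsub>G\<^esub> y \<in> B.gt0"
          using d'(3)[OF ij(1)] B.M.subgrp_diff_commute[OF B.subgrp_gt0 y(1) d'(1)[OF ij(1)]] by simp
        then have "d' i \<ominus>\<^bsub>G\<^esub> d' j \<in> B.gt0"
          using B.M.subgrp_diff_trans[OF B.subgrp_gt0 d'(1)[OF ij(1)] y(1) d'(1)[OF ij(2)]] d'(3)[OF ij(2)] by blast
        then show ?thesis
          using B.lam_val_pos[OF sR s(3)[OF iN[OF ij(1)] iN[OF ij(2)]] _ \<delta>'(1)
              diffB[OF iN[OF ij(1)] iN[OF ij(2)] d'(1)[OF ij(1)] d'(1)[OF ij(2)] d'(2)[OF ij(1)] d'(2)[OF ij(2)]]]
          by (simp add: B.gt0_def)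
      qed
      have fI: "finite I" using IJ fN(1) finite_subset by auto
      have cI: "card I \<le> k" using IJ cN[of I] by blast
      have "\<exists>x'\<in>carrier G. \<forall>i\<in>I. w (x' \<ominus>\<^bsub>G\<^esub> d' i) = \<alpha>' i"
      proof (rule level_transfer[OF fI False d(1) d'(1) x vd])
        fix i j l assume "i \<in> I" "j \<in> I" "l \<in> I"
        then show "A.clt (v (d i \<ominus>\<^bsub>F\<^esub> d j)) (\<alpha> l) \<longleftrightarrow> B.clt (w (d' i \<ominus>\<^bsub>G\<^esub> d' j)) (\<alpha>' l)"
          "A.clt (\<alpha> l) (v (d i \<ominus>\<^bsub>F\<^esub> d j)) \<longleftrightarrow> B.clt (\<alpha>' l) (w (d' i \<ominus>\<^bsub>G\<^esub> d' j))"
          using 2[OF iN iN iN, of i j l] dd[of i j] dd'[of i j] by simp_all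
      qed (use 1 3 \<alpha>' iN cI in auto)
      then obtain x' where x': "x' \<in> carrier G" "\<And>i. i \<in> I \<Longrightarrow> w (x' \<ominus>\<^bsub>G\<^esub> d' i) = \<alpha>' i" by blast
      have gt: "x' \<ominus>\<^bsub>G\<^esub> d' i \<in> B.gt0" if "i \<in> I" for i
        using x'(2)[OF that] x'(1) d'(1)[OF that] 4(2)[OF iN[OF that]] that by (simp add: B.gt0_def I_def)
      obtain i where i: "i \<in> I" using False by blast
      have "d' i \<ominus>\<^bsub>G\<^esub> y \<in> B.gt0"
        using d'(3)[OF i] B.M.subgrp_diff_commute[OF B.subgrp_gt0 y(1) d'(1)[OF i]] by simp
      then have "x' \<ominus>\<^bsub>G\<^esub> y \<in> B.gt0"
        using B.M.subgrp_diff_trans[OF B.subgrp_gt0 x'(1) d'(1)[OF i] y(1) gt[OF i]] by blast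
      moreover have "w (x' \<cdot>\<^bsub>G\<^esub> r i \<oplus>\<^bsub>G\<^esub> e' i) = B.lam (r i) (\<alpha>' i)" if i: "i \<in> I" for i
        using rootB[OF x'(1) d'(1,2)[OF i]] x'(2)[OF i] gt[OF i]
          B.val_act[OF r _ _ r0[OF iN[OF i]], of "x' \<ominus>\<^bsub>G\<^esub> d' i"] by (simp add: B.gt0_def B.mid_iff)
      ultimately show ?thesis using x'(1) by blast
    qed
    then obtain x' where x': "x' \<in> carrier G" "x' \<ominus>\<^bsub>G\<^esub> y \<in> B.gt0"
      "\<And>i. i \<in> I \<Longrightarrow> w (x' \<cdot>\<^bsub>G\<^esub> r i \<oplus>\<^bsub>G\<^esub> e' i) = B.lam (r i) (\<alpha>' i)" by blast
    have x'p: "x' \<ominus>\<^bsub>G\<^esub> c' p \<in> B.ge0"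
      using B.M.subgrp_diff_trans[OF B.subgrp_ge0 x'(1) y(1) c'(1)[OF p(1)]] x'(2) y(2) B.gt0_sub_ge0 by blast
    have "w (x' \<cdot>\<^bsub>G\<^esub> r i \<oplus>\<^bsub>G\<^esub> e' i) = B.lam (r i) (\<alpha>' i)" if i: "i \<in> N" for i
    proof -
      consider "i \<in> I" | "i \<in> J" | "A.neg (\<alpha> i)" using i A.trichotomy[of "\<alpha> i"] by (auto simp: I_def J_def)
      then show ?thesis
      proof cases
        case 1
        then show ?thesis using x'(3) by blast
      next
        case 2
        have n: "\<not> A.neg (\<alpha> i)" using IJn 2 by blast
        have "x' \<ominus>\<^bsub>G\<^esub> c' i \<in> B.ge0"
          using B.M.subgrp_diff_trans[OF B.subgrp_ge0 x'(1) c'(1)[OF p(1)] c'(1)[OF i] x'p cp'[OF i n]] .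
        then have ge': "x' \<cdot>\<^bsub>G\<^esub> r i \<oplus>\<^bsub>G\<^esub> e' i \<in> B.ge0"
          using rootB[OF x'(1) c'(1)[OF i] c'(2)[OF i]] B.ge0_act[OF _ r] by simp
        \<comment> \<open>Moving \<open>y\<close> by an element of \<open>gt0\<close> does not
          affect the inequation, so the value is neither above nor below \<theta>.\<close>
        have "x' \<cdot>\<^bsub>G\<^esub> r i \<oplus>\<^bsub>G\<^esub> e' i \<notin> B.gt0"
        proof
          assume g: "x' \<cdot>\<^bsub>G\<^esub> r i \<oplus>\<^bsub>G\<^esub> e' i \<in> B.gt0"
          have "(e' i \<oplus>\<^bsub>G\<^esub> x' \<cdot>\<^bsub>G\<^esub> r i) \<ominus>\<^bsub>G\<^esub> (e' i \<oplus>\<^bsub>G\<^esub> y \<cdot>\<^bsub>G\<^esub> r i) = x' \<cdot>\<^bsub>G\<^esub> r i \<ominus>\<^bsub>G\<^esub> y \<cdot>\<^bsub>G\<^esub> r i"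
            using x'(1) y(1) r e' by (intro B.M.add_diff_add) auto
          then have "(x' \<cdot>\<^bsub>G\<^esub> r i \<oplus>\<^bsub>G\<^esub> e' i) \<ominus>\<^bsub>G\<^esub> (y \<cdot>\<^bsub>G\<^esub> r i \<oplus>\<^bsub>G\<^esub> e' i) = (x' \<ominus>\<^bsub>G\<^esub> y) \<cdot>\<^bsub>G\<^esub> r i"
            using x'(1) y(1) r e' by (simp add: B.diff_act B.M.a_comm)
          then have 5: "(x' \<cdot>\<^bsub>G\<^esub> r i \<oplus>\<^bsub>G\<^esub> e' i) \<ominus>\<^bsub>G\<^esub> (y \<cdot>\<^bsub>G\<^esub> r i \<oplus>\<^bsub>G\<^esub> e' i) \<in> B.gt0"
            using B.gt0_act[OF x'(2) r] by simp
          have "(x' \<cdot>\<^bsub>G\<^esub> r i \<oplus>\<^bsub>G\<^esub> e' i) \<ominus>\<^bsub>G\<^esub> ((x' \<cdot>\<^bsub>G\<^esub> r i \<oplus>\<^bsub>G\<^esub> e' i) \<ominus>\<^bsub>G\<^esub> (y \<cdot>\<^bsub>G\<^esub> r i \<oplus>\<^bsub>G\<^esub> e' i))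
            = y \<cdot>\<^bsub>G\<^esub> r i \<oplus>\<^bsub>G\<^esub> e' i" (is "?a \<ominus>\<^bsub>G\<^esub> (?a \<ominus>\<^bsub>G\<^esub> ?b) = ?b")
          proof -
            have ab: "?a \<in> carrier G" "?b \<in> carrier G" using x'(1) y(1) r e' by auto
            then show ?thesis using B.M.minus_diff[of ?a ?b] B.M.diff_add_cancel[of ?b ?a]
              by (simp add: B.M.minus_eq[of ?a "?a \<ominus>\<^bsub>G\<^esub> ?b"] B.M.a_comm)
          qed
          then have "y \<cdot>\<^bsub>G\<^esub> r i \<oplus>\<^bsub>G\<^esub> e' i \<in> B.gt0" using B.M.subgrp_diff[OF B.subgrp_gt0 g 5] by simp
          then show False using y(4) 2 by blast
        qed
        then have "B.mid (w (x' \<cdot>\<^bsub>G\<^esub> r i \<oplus>\<^bsub>G\<^esub> e' i))"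
          using ge' by (simp add: B.ge0_def B.gt0_def B.mid_iff)
        moreover have m: "B.mid (\<alpha>' i)" using 4(1,2)[OF i] 2 by (simp add: J_def A.mid_iff B.mid_iff)
        ultimately have "w (x' \<cdot>\<^bsub>G\<^esub> r i \<oplus>\<^bsub>G\<^esub> e' i) = \<alpha>' i"
          using B.mid_unique \<alpha>' x'(1) r e' by simp
        then show ?thesis using B.lam_mid[OF m] by simp
      next
        \<comment> \<open>Both \<open>x\<close> and \<open>x'\<close> are at distance at least
          \<theta> from the root with index \<open>p\<close>, so their negative distance to the i-th
          root is that between the two roots.\<close>
        case 3
        have vi: "v (x \<ominus>\<^bsub>F\<^esub> c i) = \<alpha> i" using negA(2)[OF i i i 3] .
        have "A.clt (\<alpha> i) (v (x \<ominus>\<^bsub>F\<^esub> c p))"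
          using A.neg_less[OF 3 _ \<alpha>(1)] ge[OF p] by (simp add: A.ge0_def)
        then have "v (c i \<ominus>\<^bsub>F\<^esub> c p) = \<alpha> i"
          using A.val_diff_eq[OF c(1)[OF i] x c(1)[OF p(1)]] vi A.val_diff_commute[OF x c(1)[OF i]] by simp
        then have "\<delta> i p = \<alpha> i"
          using A.lam_val_neg[OF sR s(3)[OF i p(1)] cc[OF i p(1)] \<delta>(1) dA[OF i p(1)]] 3 by simp
        then have d': "\<delta>' i p = \<alpha>' i"
          using "2"[OF i p(1) i] B.ord.less_linear[of "\<delta>' i p" "\<alpha>' i"] by simp
        have n': "B.neg (\<alpha>' i)" using 4(1)[OF i] 3 by simp
        then have w1: "w (c' i \<ominus>\<^bsub>G\<^esub> c' p) = \<alpha>' i"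
          using B.lam_val_neg(2)[OF sR s(3)[OF i p(1)] cc'[OF i p(1)] \<delta>'(1) dB[OF i p(1)]] d' by simp
        have "B.clt (\<alpha>' i) (w (c' p \<ominus>\<^bsub>G\<^esub> x'))"
          using B.neg_less[OF n' _ \<alpha>' B.val_closed, of "c' p \<ominus>\<^bsub>G\<^esub> x'"] x'p x'(1) c'(1)[OF p(1)]
            B.val_diff_commute[OF x'(1) c'(1)[OF p(1)]] by (simp add: B.ge0_def)
        then have "w (x' \<ominus>\<^bsub>G\<^esub> c' i) = \<alpha>' i"
          using B.val_diff_eq[OF c'(1)[OF i] c'(1)[OF p(1)] x'(1)] w1 B.val_diff_commute[OF x'(1) c'(1)[OF i]] by simp
        then show ?thesis using fin_neg[OF i x'(1)] 3 by blast
      qed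
    qed
    then show ?thesis using x'(1) by blast
  qed
qed

end

section \<open>Agreement on finite sets of formulas\<close>

lemma cterm_eval_cong: "(\<And>i. i \<in> cterm_vars t \<Longrightarrow> e i = e' i) \<Longrightarrow> cterm_eval V e t = cterm_eval V e' t"
  by (induction t) auto

lemma cform_sat_cong:
  "(\<And>i. i \<in> cform_free f \<Longrightarrow> e i = e' i) \<Longrightarrow> cform_sat V e f \<longleftrightarrow> cform_sat V e' f"
proof (induction f arbitrary: e e')
  case (CF_Eq a b)
  have "cterm_eval V e a = cterm_eval V e' a" "cterm_eval V e b = cterm_eval V e' b"
    by (rule cterm_eval_cong, simp add: CF_Eq.prems)+
  then show ?case by (simp only: cform_sat.simps)
next
  case (CF_Less a b)
  have "cterm_eval V e a = cterm_eval V e' a" "cterm_eval V e b = cterm_eval V e' b"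
    by (rule cterm_eval_cong, simp add: CF_Less.prems)+
  then show ?case by (simp only: cform_sat.simps)
next
  case (CF_R n a)
  have "cterm_eval V e a = cterm_eval V e' a"
    by (rule cterm_eval_cong, simp add: CF_R.prems)
  then show ?case by (simp only: cform_sat.simps)
next
  case (CF_Not f)
  have "cform_sat V e f = cform_sat V e' f" by (rule CF_Not.IH) (simp add: CF_Not.prems)
  then show ?case by (simp only: cform_sat.simps)
next
  case (CF_And f g)
  have "cform_sat V e f = cform_sat V e' f" by (rule CF_And.IH(1)) (simp add: CF_And.prems)
  moreover have "cform_sat V e g = cform_sat V e' g" by (rule CF_And.IH(2)) (simp add: CF_And.prems)
  ultimately show ?case by (simp only: cform_sat.simps)
next
  case (CF_Ex i f)
  have "cform_sat V (e(i := x)) f \<longleftrightarrow> cform_sat V (e'(i := x)) f" for x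
    by (rule CF_Ex.IH) (simp add: CF_Ex.prems)
  then show ?case by (simp only: cform_sat.simps)
qed

lemma finite_cterm_vars: "finite (cterm_vars t)" by (induction t) auto

lemma finite_cform_free: "finite (cform_free f)"
  by (induction f) (auto simp: finite_cterm_vars)

primrec cterm_ren :: "(nat \<Rightarrow> nat) \<Rightarrow> cterm \<Rightarrow> cterm" where
  "cterm_ren \<rho> (CVar i) = CVar (\<rho> i)"
| "cterm_ren \<rho> CInf = CInf"
| "cterm_ren \<rho> (CTau a) = CTau (cterm_ren \<rho> a)"

text \<open>Bound variables are renamed along with the free ones; injectivity of
  \<open>\<rho>\<close> is what then prevents capture.\<close>

primrec cform_ren :: "(nat \<Rightarrow> nat) \<Rightarrow> cform \<Rightarrow> cform" where
  "cform_ren \<rho> (CF_Eq a b) = CF_Eq (cterm_ren \<rho> a) (cterm_ren \<rho> b)"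
| "cform_ren \<rho> (CF_Less a b) = CF_Less (cterm_ren \<rho> a) (cterm_ren \<rho> b)"
| "cform_ren \<rho> (CF_R n a) = CF_R n (cterm_ren \<rho> a)"
| "cform_ren \<rho> (CF_Not f) = CF_Not (cform_ren \<rho> f)"
| "cform_ren \<rho> (CF_And f g) = CF_And (cform_ren \<rho> f) (cform_ren \<rho> g)"
| "cform_ren \<rho> (CF_Ex i f) = CF_Ex (\<rho> i) (cform_ren \<rho> f)"

lemma cterm_eval_ren: "cterm_eval V e (cterm_ren \<rho> t) = cterm_eval V (e \<circ> \<rho>) t"
  by (induction t) auto

lemma cform_sat_ren: "inj \<rho> \<Longrightarrow> cform_sat V e (cform_ren \<rho> f) \<longleftrightarrow> cform_sat V (e \<circ> \<rho>) f"
proof (induction f arbitrary: e)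
  case (CF_Ex i f)
  have "e(\<rho> i := x) \<circ> \<rho> = (e \<circ> \<rho>)(i := x)" for x
    using CF_Ex.prems by (auto simp: fun_eq_iff inj_eq)
  then show ?case
    by (simp only: cform_sat.simps cform_ren.simps CF_Ex.IH[OF CF_Ex.prems])
qed (auto simp: cterm_eval_ren)

definition agree ::
  "('d, 'x) val_struct_scheme \<Rightarrow> ('e, 'y) val_struct_scheme \<Rightarrow> cform set \<Rightarrow> (nat \<Rightarrow> 'd) \<Rightarrow> (nat \<Rightarrow> 'e) \<Rightarrow> bool" where
  "agree V W \<Psi> e e' \<longleftrightarrow> (\<forall>\<psi>\<in>\<Psi>. cform_sat V e \<psi> \<longleftrightarrow> cform_sat W e' \<psi>)"

lemma agreeD: "agree V W \<Psi> e e' \<Longrightarrow> \<psi> \<in> \<Psi> \<Longrightarrow> cform_sat V e \<psi> \<longleftrightarrow> cform_sat W e' \<psi>"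
  by (simp add: agree_def)

lemma agree_sym: "agree V W \<Psi> e e' \<Longrightarrow> agree W V \<Psi> e' e"
  by (simp add: agree_def)

lemma agree_mono: "agree V W \<Psi> e e' \<Longrightarrow> \<Psi>' \<subseteq> \<Psi> \<Longrightarrow> agree V W \<Psi>' e e'"
  by (auto simp: agree_def)

lemma agree_ren:
  "inj \<rho> \<Longrightarrow> agree V W (cform_ren \<rho> ` \<Psi>) e e' \<longleftrightarrow> agree V W \<Psi> (e \<circ> \<rho>) (e' \<circ> \<rho>)"
  by (simp add: agree_def cform_sat_ren)

text \<open>All sign patterns over a list of formulas, each closed by a trivially true equation: a
  finite substitute for the type of an assignment.\<close>

primrec pats :: "cform list \<Rightarrow> cform list" where
  "pats [] = [CF_Eq CInf CInf]"
| "pats (\<psi> # l) = map (CF_And \<psi>) (pats l) @ map (CF_And (CF_Not \<psi>)) (pats l)"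

lemma pats_exhaust: "\<exists>q\<in>set (pats l). cform_sat V e q"
proof (induction l)
  case (Cons \<psi> l)
  then obtain q where "q \<in> set (pats l)" "cform_sat V e q" by blast
  then show ?case
    by (intro bexI[of _ "if cform_sat V e \<psi> then CF_And \<psi> q else CF_And (CF_Not \<psi>) q"]) auto
qed simp

lemma pats_agree:
  "q \<in> set (pats l) \<Longrightarrow> cform_sat V e q \<Longrightarrow> cform_sat W e' q \<Longrightarrow> agree V W (set l) e e'"
  by (induction l arbitrary: q) (auto simp: agree_def)

lemma pats_free: "q \<in> set (pats l) \<Longrightarrow> cform_free q \<subseteq> (\<Union>\<psi>\<in>set l. cform_free \<psi>)"
  by (induction l arbitrary: q) (auto, blast+)

text \<open>Agreement on \<open>gsteps is l\<close> lets the back-and-forth game run for one round per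
  variable in \<open>is\<close>, ending in agreement on \<open>l\<close>.\<close>

primrec gsteps :: "nat list \<Rightarrow> cform list \<Rightarrow> cform list" where
  "gsteps [] l = l"
| "gsteps (i # is) l = map (CF_Ex i) (pats (gsteps is l))"

lemma gsteps_free: "\<psi> \<in> set (gsteps is l) \<Longrightarrow> cform_free \<psi> \<subseteq> (\<Union>\<psi>\<in>set l. cform_free \<psi>) - set is"
proof (induction "is" arbitrary: \<psi>)
  case Nil
  then show ?case by auto
next
  case (Cons i "is")
  then obtain q where q: "q \<in> set (pats (gsteps is l))" "\<psi> = CF_Ex i q" by auto
  have "cform_free q \<subseteq> (\<Union>\<psi>\<in>set l. cform_free \<psi>) - set is"
    using pats_free[OF q(1)] Cons.IH by blast
  then show ?case using q(2) by auto
qed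

lemma gsteps_agree:
  assumes "distinct is" "agree V W (set (gsteps is l)) e e'" "\<And>i. i \<in> set is \<Longrightarrow> f i \<in> carrier V"
  shows "\<exists>f'. (\<forall>i\<in>set is. f' i \<in> carrier W) \<and>
    agree V W (set l) (override_on e f (set is)) (override_on e' f' (set is))"
  using assms
proof (induction "is" arbitrary: e e')
  case Nil
  then show ?case by simp
next
  case (Cons i "is")
  \<comment> \<open>The full sign pattern reached by the move \<open>f i\<close>, existentially
    quantified, is among the formulas on which the positions before the move agree. Its witness in
    \<open>W\<close> is the reply.\<close>
  obtain q where q: "q \<in> set (pats (gsteps is l))" "cform_sat V (e(i := f i)) q"
    using pats_exhaust by blast
  have "cform_sat V e (CF_Ex i q)" using q(2) Cons.prems(3)[of i] by auto
  moreover have "CF_Ex i q \<in> set (gsteps (i # is) l)" using q(1) by simp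
  ultimately have "cform_sat W e' (CF_Ex i q)" using agreeD[OF Cons.prems(2)] by blast
  then obtain g where g: "g \<in> carrier W" "cform_sat W (e'(i := g)) q" by auto
  have ag: "agree V W (set (gsteps is l)) (e(i := f i)) (e'(i := g))" using pats_agree[OF q g(2)] .
  have "distinct is" "\<And>i. i \<in> set is \<Longrightarrow> f i \<in> carrier V" using Cons.prems by auto
  then have "\<exists>f'. (\<forall>i\<in>set is. f' i \<in> carrier W) \<and>
    agree V W (set l) (override_on (e(i := f i)) f (set is)) (override_on (e'(i := g)) f' (set is))"
    by (rule Cons.IH[OF _ ag])
  then obtain f' where f': "\<forall>i\<in>set is. f' i \<in> carrier W"
    "agree V W (set l) (override_on (e(i := f i)) f (set is)) (override_on (e'(i := g)) f' (set is))"
    by (elim exE conjE)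
  have "override_on (e(i := f i)) f (set is) = override_on e f (set (i # is))"
    "override_on (e'(i := g)) f' (set is) = override_on e' (f'(i := g)) (set (i # is))"
    using Cons.prems(1) by (auto simp: override_on_def fun_eq_iff)
  with f'(2) have "agree V W (set l) (override_on e f (set (i # is)))
    (override_on e' (f'(i := g)) (set (i # is)))" by (simp only:)
  moreover have "\<forall>j\<in>set (i # is). (f'(i := g)) j \<in> carrier W" using f'(1) g(1) by simp
  ultimately show ?case by blast
qed

text \<open>The variables \<open>vpos 0 j\<close>, \<open>vpos 1 j\<close>, \<open>vpos 2 (i, j)\<close> are played in the game and stand for
  the values of \<open>x \<cdot> r j + e j\<close>, the normalised distances \<open>\<alpha> j\<close> and \<open>\<delta> i j\<close>; the others stand for
  the values of the terms listed in \<open>new_terms\<close>.\<close>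

definition vpos :: "nat \<Rightarrow> nat \<Rightarrow> nat" where "vpos t m = 2 * prod_encode (t, m) + 1"

definition game_vars :: "nat \<Rightarrow> nat set" where
  "game_vars k = vpos 0 ` {..<k} \<union> vpos 1 ` {..<k} \<union>
    (\<lambda>(i, j). vpos 2 (prod_encode (i, j))) ` ({..<k} \<times> {..<k})"

lemma finite_game_vars: "finite (game_vars k)" by (simp add: game_vars_def)

lemma vpos_eq[simp]: "vpos t m = vpos t' m' \<longleftrightarrow> t = t' \<and> m = m'"
  by (simp add: vpos_def)

lemma odd_vpos[simp]: "odd (vpos t m)" by (simp add: vpos_def)

lemma vpos_div: "vpos t m div 2 = prod_encode (t, m)" by (simp add: vpos_def)

lemma game_vars_iff:
  "vpos t m \<in> game_vars k \<longleftrightarrow> (t = 0 \<and> m < k) \<or> (t = 1 \<and> m < k) \<or>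
    (t = 2 \<and> (\<exists>i j. m = prod_encode (i, j) \<and> i < k \<and> j < k))"
  by (auto simp: game_vars_def image_iff)

lemma even_game_vars: "even n \<Longrightarrow> n \<notin> game_vars k"
  by (auto simp: game_vars_def)

section \<open>Elimination of a module quantifier\<close>

lemma mterm_eval_cong: "(\<And>i. i \<in> mterm_vars t \<Longrightarrow> s i = s' i) \<Longrightarrow> mterm_eval M s t = mterm_eval M s' t"
  by (induction t) auto

context skew_field
begin

text \<open>A module term is affine in the variable \<open>i\<close>: its value is x r + e, with the
  coefficient r and the remaining term computed formally and hence the same for both
  modules.\<close>

primrec mcoeff :: "nat \<Rightarrow> (nat \<Rightarrow> 'k) mterm \<Rightarrow> nat \<Rightarrow> 'k" where
  "mcoeff i (MVar n) = (if n = i then \<one>\<^bsub>R\<^esub> else \<zero>\<^bsub>R\<^esub>)"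
| "mcoeff i MZero = \<zero>\<^bsub>R\<^esub>"
| "mcoeff i (MPlus a b) = mcoeff i a \<oplus>\<^bsub>R\<^esub> mcoeff i b"
| "mcoeff i (MMinus a) = \<ominus>\<^bsub>R\<^esub> mcoeff i a"
| "mcoeff i (MAct a r) = mcoeff i a \<otimes>\<^bsub>R\<^esub> r"

primrec mrest :: "nat \<Rightarrow> (nat \<Rightarrow> 'k) mterm \<Rightarrow> (nat \<Rightarrow> 'k) mterm" where
  "mrest i (MVar n) = (if n = i then MZero else MVar n)"
| "mrest i MZero = MZero"
| "mrest i (MPlus a b) = MPlus (mrest i a) (mrest i b)"
| "mrest i (MMinus a) = MMinus (mrest i a)"
| "mrest i (MAct a r) = MAct (mrest i a) r"

lemma mcoeff_closed[simp]: "mterm_scalars t \<subseteq> carrier R \<Longrightarrow> mcoeff i t \<in> carrier R"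
  by (induction t) auto

lemma mrest_scalars[simp]: "mterm_scalars t \<subseteq> carrier R \<Longrightarrow> mterm_scalars (mrest i t) \<subseteq> carrier R"
  by (induction t) auto

text \<open>Common right multiples for all pairs at once. Like \<open>sys\<close>, the choice
  depends on the scalars only, so that it can be used inside terms.\<close>

definition ore :: "(nat \<Rightarrow> nat \<Rightarrow> 'k) \<Rightarrow> nat \<Rightarrow> nat \<Rightarrow> nat \<Rightarrow> 'k" where
  "ore r = (SOME s. (\<forall>i j. s i j \<in> carrier R) \<and> (\<forall>i j. r i \<noteq> \<zero>\<^bsub>R\<^esub> \<longrightarrow> r j \<noteq> \<zero>\<^bsub>R\<^esub> \<longrightarrow>
    r i \<otimes>\<^bsub>R\<^esub> s i j = r j \<otimes>\<^bsub>R\<^esub> s j i \<and> r i \<otimes>\<^bsub>R\<^esub> s i j \<noteq> \<zero>\<^bsub>R\<^esub>))"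

lemma ore:
  assumes r: "\<And>i. r i \<in> carrier R"
  shows "ore r i j \<in> carrier R"
    "r i \<noteq> \<zero>\<^bsub>R\<^esub> \<Longrightarrow> r j \<noteq> \<zero>\<^bsub>R\<^esub> \<Longrightarrow> r i \<otimes>\<^bsub>R\<^esub> ore r i j = r j \<otimes>\<^bsub>R\<^esub> ore r j i"
    "r i \<noteq> \<zero>\<^bsub>R\<^esub> \<Longrightarrow> r j \<noteq> \<zero>\<^bsub>R\<^esub> \<Longrightarrow> r i \<otimes>\<^bsub>R\<^esub> ore r i j \<noteq> \<zero>\<^bsub>R\<^esub>"
proof -
  let ?P = "\<lambda>s. (\<forall>i j. s i j \<in> carrier R) \<and> (\<forall>i j. r i \<noteq> \<zero>\<^bsub>R\<^esub> \<longrightarrow> r j \<noteq> \<zero>\<^bsub>R\<^esub> \<longrightarrow>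
    r i \<otimes>\<^bsub>R\<^esub> s i j = r j \<otimes>\<^bsub>R\<^esub> s j i \<and> r i \<otimes>\<^bsub>R\<^esub> s i j \<noteq> \<zero>\<^bsub>R\<^esub>)"
  have "\<exists>p. fst p \<in> carrier R \<and> snd p \<in> carrier R \<and> (r i \<noteq> \<zero>\<^bsub>R\<^esub> \<longrightarrow> r j \<noteq> \<zero>\<^bsub>R\<^esub> \<longrightarrow>
    r i \<otimes>\<^bsub>R\<^esub> fst p = r j \<otimes>\<^bsub>R\<^esub> snd p \<and> r i \<otimes>\<^bsub>R\<^esub> fst p \<noteq> \<zero>\<^bsub>R\<^esub>)" for i j
  proof (cases "r i \<noteq> \<zero>\<^bsub>R\<^esub> \<and> r j \<noteq> \<zero>\<^bsub>R\<^esub>")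
    case True
    then obtain s u where "s \<in> carrier R" "u \<in> carrier R" "r i \<otimes>\<^bsub>R\<^esub> s = r j \<otimes>\<^bsub>R\<^esub> u" "r i \<otimes>\<^bsub>R\<^esub> s \<noteq> \<zero>\<^bsub>R\<^esub>"
      using right_Ore[OF r[of i] _ r[of j]] by (elim conjE) blast
    then show ?thesis by (intro exI[of _ "(s, u)"]) simp
  next
    case False
    then show ?thesis by (intro exI[of _ "(\<zero>\<^bsub>R\<^esub>, \<zero>\<^bsub>R\<^esub>)"]) auto
  qed
  then obtain p where p: "\<And>i j. fst (p i j) \<in> carrier R" "\<And>i j. snd (p i j) \<in> carrier R"
    "\<And>i j. r i \<noteq> \<zero>\<^bsub>R\<^esub> \<Longrightarrow> r j \<noteq> \<zero>\<^bsub>R\<^esub> \<Longrightarrow> r i \<otimes>\<^bsub>R\<^esub> fst (p i j) = r j \<otimes>\<^bsub>R\<^esub> snd (p i j)"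
    "\<And>i j. r i \<noteq> \<zero>\<^bsub>R\<^esub> \<Longrightarrow> r j \<noteq> \<zero>\<^bsub>R\<^esub> \<Longrightarrow> r i \<otimes>\<^bsub>R\<^esub> fst (p i j) \<noteq> \<zero>\<^bsub>R\<^esub>" by metis
  \<comment> \<open>For the identity to be symmetric one pair is chosen for each i < j, and its two
    components serve for (i, j) and (j, i).\<close>
  define s where "s i j = (if i = j then \<one>\<^bsub>R\<^esub> else if i < j then fst (p i j) else snd (p j i))" for i j
  have "s i j \<in> carrier R" for i j using p(1,2) by (simp add: s_def)
  moreover have "r i \<otimes>\<^bsub>R\<^esub> s i j = r j \<otimes>\<^bsub>R\<^esub> s j i \<and> r i \<otimes>\<^bsub>R\<^esub> s i j \<noteq> \<zero>\<^bsub>R\<^esub>"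
    if "r i \<noteq> \<zero>\<^bsub>R\<^esub>" "r j \<noteq> \<zero>\<^bsub>R\<^esub>" for i j
  proof -
    consider "i = j" | "i < j" | "j < i" by linarith
    then show ?thesis
    proof cases
      case 1
      then show ?thesis using that r by (simp add: s_def)
    next
      case 2
      then have "s i j = fst (p i j)" "s j i = snd (p i j)" by (simp_all add: s_def)
      then show ?thesis using p(3,4)[OF that] by simp
    next
      case 3
      then have e: "s i j = snd (p j i)" "s j i = fst (p j i)" by (simp_all add: s_def)
      show ?thesis unfolding e p(3)[OF that(2,1), symmetric] using p(4)[OF that(2,1)] by simp
    qed
  qed
  ultimately have "?P s" by blast
  then have "?P (ore r)" unfolding ore_def by (rule someI[where P = ?P])
  then show "ore r i j \<in> carrier R"
    "r i \<noteq> \<zero>\<^bsub>R\<^esub> \<Longrightarrow> r j \<noteq> \<zero>\<^bsub>R\<^esub> \<Longrightarrow> r i \<otimes>\<^bsub>R\<^esub> ore r i j = r j \<otimes>\<^bsub>R\<^esub> ore r j i"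
    "r i \<noteq> \<zero>\<^bsub>R\<^esub> \<Longrightarrow> r j \<noteq> \<zero>\<^bsub>R\<^esub> \<Longrightarrow> r i \<otimes>\<^bsub>R\<^esub> ore r i j \<noteq> \<zero>\<^bsub>R\<^esub>" by blast+
qed

primrec mlc_term :: "(nat \<Rightarrow> (nat \<Rightarrow> 'k) mterm) \<Rightarrow> (nat \<Rightarrow> nat \<Rightarrow> 'k) \<Rightarrow> nat \<Rightarrow> (nat \<Rightarrow> 'k) mterm" where
  "mlc_term b a 0 = MZero"
| "mlc_term b a (Suc n) = MPlus (mlc_term b a n) (MAct (b n) (a n))"

definition diff_term where
  "diff_term r b i j = MPlus (MAct (b i) (ore r i j)) (MMinus (MAct (b j) (ore r j i)))"

definition kappa_term where
  "kappa_term r k b A i = MPlus (MAct (mlc_term b (sys_a r k A) k) (sys_c r k A i)) (MMinus (b i))"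

text \<open>The tags 3, 4, 5 continue the tags 0, 1, 2 of the played variables: differences whose
  values encode the distances of roots, the constant terms, and the obstructions
  \<open>kappa\<close> with their index sets coded by numbers. The bound by \<open>k\<close>
  guarantees that the chosen coefficients lie in \<open>R\<close>; all other positions hold
  \<open>MZero\<close>.\<close>

definition new_terms :: "(nat \<Rightarrow> nat \<Rightarrow> 'k) \<Rightarrow> (nat \<Rightarrow> (nat \<Rightarrow> 'k) mterm) \<Rightarrow> nat \<Rightarrow> nat \<Rightarrow> (nat \<Rightarrow> 'k) mterm" where
  "new_terms r b k n = (case prod_decode n of (t, m) \<Rightarrow>
    if t = 3 then diff_term r b (fst (prod_decode m)) (snd (prod_decode m))
    else if t = 4 then b m
    else if t = 5 then
      (if set_decode (fst (prod_decode m)) \<subseteq> {..<k}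
       then kappa_term r k b (set_decode (fst (prod_decode m))) (snd (prod_decode m)) else MZero)
    else MZero)"

text \<open>The graph of \<open>lam p\<close> in the language of value sets: a case distinction on
  \<tau>(a) < a, written without disjunction.\<close>

definition lam_form :: "(nat \<Rightarrow> 'k) \<Rightarrow> nat \<Rightarrow> nat \<Rightarrow> cform" where
  "lam_form p a z = CF_Not (CF_And
    (CF_Not (CF_And (CF_Less (CTau (CVar a)) (CVar a)) (CF_Eq ((CTau ^^ sdeg p) (CVar a)) (CVar z))))
    (CF_Not (CF_And (CF_Not (CF_Less (CTau (CVar a)) (CVar a)))
      (CF_Eq ((CTau ^^ sord p) (CVar a)) (CVar z)))))"

text \<open>Agreement on these formulas supplies the hypotheses of \<open>transfer\<close>. The
  first one serves the indices with r_j = 0, where the value is that of the constant term; the last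
  two say whether the obstruction \<open>q\<close> lies in \<open>gt0\<close>.\<close>

definition atoms :: "(nat \<Rightarrow> nat \<Rightarrow> 'k) \<Rightarrow> nat \<Rightarrow> nat \<Rightarrow> nat \<Rightarrow> nat \<Rightarrow> nat set \<Rightarrow> cform set" where
  "atoms r i j l n A = (let z = vpos 0; a = vpos 1; d = vpos 2 (prod_encode (i, j));
      q = vpos 5 (prod_encode (set_encode A, i)) in
    {CF_Eq (CVar (z j)) (CVar (vpos 4 j)),
     lam_form (r j) (a j) (z j),
     lam_form (r i \<otimes>\<^bsub>R\<^esub> ore r i j) d (vpos 3 (prod_encode (i, j))),
     CF_Less (CVar (a i)) (CVar (a j)),
     CF_Less (CVar d) (CVar (a l)),
     CF_Less (CVar (a l)) (CVar d),
     CF_Eq (CVar (a i)) CInf,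
     CF_R n (CVar (a i)),
     CF_Less (CTau (CVar (a i))) (CVar (a i)),
     CF_Less (CVar (a i)) (CTau (CVar (a i))),
     CF_Less (CTau (CVar d)) (CVar d),
     CF_Less (CVar q) (CTau (CVar q)),
     CF_Eq (CVar q) CInf})"

text \<open>The bound k + 1 on \<open>n\<close> is the number of classes required by
  \<open>new_class\<close> for at most k centres.\<close>

definition theta :: "(nat \<Rightarrow> nat \<Rightarrow> 'k) \<Rightarrow> nat \<Rightarrow> cform set" where
  "theta r k = (\<Union>i\<in>{..<k}. \<Union>j\<in>{..<k}. \<Union>l\<in>{..<k}. \<Union>n\<in>{..Suc k}. \<Union>A\<in>Pow {..<k}. atoms r i j l n A)"

lemma finite_theta: "finite (theta r k)"
  unfolding theta_def atoms_def Let_def by (intro finite_UN_I) simp_all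

lemma theta_memI:
  "i < k \<Longrightarrow> j < k \<Longrightarrow> l < k \<Longrightarrow> n \<le> Suc k \<Longrightarrow> A \<subseteq> {..<k} \<Longrightarrow> f \<in> atoms r i j l n A \<Longrightarrow> f \<in> theta r k"
  unfolding theta_def by (intro UN_I[of i] UN_I[of j] UN_I[of l] UN_I[of n] UN_I[of A]) simp_all

lemma theta_mem:
  assumes "j < k" "i < k"
  shows "CF_Eq (CVar (vpos 0 j)) (CVar (vpos 4 j)) \<in> theta r k"
    "lam_form (r j) (vpos 1 j) (vpos 0 j) \<in> theta r k"
    "lam_form (r i \<otimes>\<^bsub>R\<^esub> ore r i j) (vpos 2 (prod_encode (i, j))) (vpos 3 (prod_encode (i, j))) \<in> theta r k"
    "CF_Less (CVar (vpos 1 i)) (CVar (vpos 1 j)) \<in> theta r k"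
    "l < k \<Longrightarrow> CF_Less (CVar (vpos 2 (prod_encode (i, j)))) (CVar (vpos 1 l)) \<in> theta r k"
    "l < k \<Longrightarrow> CF_Less (CVar (vpos 1 l)) (CVar (vpos 2 (prod_encode (i, j)))) \<in> theta r k"
    "CF_Eq (CVar (vpos 1 i)) CInf \<in> theta r k"
    "n \<le> Suc k \<Longrightarrow> CF_R n (CVar (vpos 1 i)) \<in> theta r k"
    "CF_Less (CTau (CVar (vpos 1 i))) (CVar (vpos 1 i)) \<in> theta r k"
    "CF_Less (CVar (vpos 1 i)) (CTau (CVar (vpos 1 i))) \<in> theta r k"
    "CF_Less (CTau (CVar (vpos 2 (prod_encode (i, j))))) (CVar (vpos 2 (prod_encode (i, j)))) \<in> theta r k"
    "A \<subseteq> {..<k} \<Longrightarrow> CF_Less (CVar (vpos 5 (prod_encode (set_encode A, i))))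
      (CTau (CVar (vpos 5 (prod_encode (set_encode A, i))))) \<in> theta r k"
    "A \<subseteq> {..<k} \<Longrightarrow> CF_Eq (CVar (vpos 5 (prod_encode (set_encode A, i)))) CInf \<in> theta r k"
proof -
  have I: "f \<in> theta r k" if "f \<in> atoms r i j l' n' A'" "l' < k" "n' \<le> Suc k" "A' \<subseteq> {..<k}" for f l' n' A'
    using theta_memI[OF assms(2,1) that(2,3,4,1)] .
  have J: "f \<in> theta r k" if "f \<in> atoms r i j j 0 {}" for f
    using I[OF that assms(1)] by simp
  show "CF_Eq (CVar (vpos 0 j)) (CVar (vpos 4 j)) \<in> theta r k"
    "lam_form (r j) (vpos 1 j) (vpos 0 j) \<in> theta r k"
    "lam_form (r i \<otimes>\<^bsub>R\<^esub> ore r i j) (vpos 2 (prod_encode (i, j))) (vpos 3 (prod_encode (i, j))) \<in> theta r k"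
    "CF_Less (CVar (vpos 1 i)) (CVar (vpos 1 j)) \<in> theta r k"
    "CF_Eq (CVar (vpos 1 i)) CInf \<in> theta r k"
    "CF_Less (CTau (CVar (vpos 1 i))) (CVar (vpos 1 i)) \<in> theta r k"
    "CF_Less (CVar (vpos 1 i)) (CTau (CVar (vpos 1 i))) \<in> theta r k"
    "CF_Less (CTau (CVar (vpos 2 (prod_encode (i, j))))) (CVar (vpos 2 (prod_encode (i, j)))) \<in> theta r k"
    by (rule J, simp only: atoms_def Let_def insert_iff simp_thms)+
  show "CF_Less (CVar (vpos 2 (prod_encode (i, j)))) (CVar (vpos 1 l)) \<in> theta r k"
    "CF_Less (CVar (vpos 1 l)) (CVar (vpos 2 (prod_encode (i, j)))) \<in> theta r k" if "l < k"
    by (rule I[OF _ that le0 empty_subsetI], simp only: atoms_def Let_def insert_iff simp_thms)+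
  show "CF_R n (CVar (vpos 1 i)) \<in> theta r k" if "n \<le> Suc k"
    by (rule I[OF _ assms(1) that empty_subsetI], simp only: atoms_def Let_def insert_iff simp_thms)
  show "CF_Less (CVar (vpos 5 (prod_encode (set_encode A, i))))
      (CTau (CVar (vpos 5 (prod_encode (set_encode A, i))))) \<in> theta r k"
    "CF_Eq (CVar (vpos 5 (prod_encode (set_encode A, i)))) CInf \<in> theta r k" if "A \<subseteq> {..<k}"
    by (rule I[OF _ assms(1) le0 that], simp only: atoms_def Let_def insert_iff simp_thms)+
qed

lemma mlc_term_scalars:
  "(\<And>n. mterm_scalars (b n) \<subseteq> carrier R) \<Longrightarrow> (\<And>n. a n \<in> carrier R) \<Longrightarrow>
    mterm_scalars (mlc_term b a n) \<subseteq> carrier R"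
  by (induction n) auto

lemma new_terms_scalars:
  assumes b: "\<And>n. mterm_scalars (b n) \<subseteq> carrier R" and r: "\<And>i. r i \<in> carrier R"
  shows "mterm_scalars (new_terms r b k n) \<subseteq> carrier R"
proof -
  have "mterm_scalars (kappa_term r k b A i) \<subseteq> carrier R" if A: "A \<subseteq> {..<k}" for A i
    using b mlc_term_scalars[of b "sys_a r k A" k, OF b] sys_a_closed[of r A k, OF r A]
      sys_c_closed[of r A k, OF r A] by (simp add: kappa_term_def)
  moreover have "mterm_scalars (diff_term r b i j) \<subseteq> carrier R" for i j
    using b ore(1)[of r, OF r] by (simp add: diff_term_def)
  ultimately show ?thesis using b by (auto simp: new_terms_def split: prod.split)
qed

end

text \<open>Even positions carry variables of the value sort and stay fixed; \<open>g\<close>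
  re-indexes the odd positions, which carry values of module terms.\<close>

lemma merge_inj: "inj g \<Longrightarrow> inj (\<lambda>n. if even n then n else 2 * g (n div 2) + (1::nat))"
proof (rule injI)
  fix m n assume g: "inj g"
    and e: "(if even m then m else 2 * g (m div 2) + 1) = (if even n then n else 2 * g (n div 2) + (1::nat))"
  have "even m \<longleftrightarrow> even n" using arg_cong[OF e, of even] by (auto split: if_splits)
  then show "m = n" using e g by (auto simp: inj_eq split: if_splits elim!: oddE)
qed

context vmod
begin

abbreviation VS where "VS \<equiv> value_set M \<Delta> v"

lemma VS_simps[simp]: "carrier VS = carrier \<Delta>" "infty VS = infty \<Delta>" "tau VS = tau \<Delta>"
  by (simp_all add: value_set_def)

lemma VS_less[simp]: "x \<in> carrier \<Delta> \<Longrightarrow> y \<in> carrier \<Delta> \<Longrightarrow> chain_less VS x y \<longleftrightarrow> x \<sqsubset> y"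
  by (simp add: value_set_def chain_less_def le_rel_iff clt_def)

lemma mterm_eval_closed[simp]:
  "mterm_scalars t \<subseteq> carrier R \<Longrightarrow> (\<And>i. s i \<in> carrier M) \<Longrightarrow> mterm_eval M s t \<in> carrier M"
  by (induction t) auto

lemma mterm_decomp:
  assumes "mterm_scalars t \<subseteq> carrier R" "\<And>i. s i \<in> carrier M" "x \<in> carrier M"
  shows "mterm_eval M (s(i := x)) t = x \<cdot> mcoeff i t \<oplus> mterm_eval M s (mrest i t)"
  using assms
proof (induction t)
  case (MVar n)
  then show ?case by (auto simp: ract_one)
next
  case MZero
  then show ?case by simp
next
  case (MPlus a b)
  then show ?case by (simp add: ract_add_right M.a_ac)
next
  case (MMinus a)
  then show ?case by (simp add: act_minus M.minus_add)
next
  case (MAct a r)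
  then show ?case by (simp add: ract_add_left ract_mult)
qed

text \<open>Interleaving both kinds of data in one assignment turns a change of the family of terms
  into a renaming of odd positions.\<close>

definition env :: "(nat \<Rightarrow> (nat \<Rightarrow> 'k) mterm) \<Rightarrow> (nat \<Rightarrow> 'm) \<Rightarrow> (nat \<Rightarrow> 'd) \<Rightarrow> nat \<Rightarrow> 'd" where
  "env \<sigma> s u n = (if even n then u (n div 2) else v (mterm_eval M s (\<sigma> (n div 2))))"

lemma env_closed:
  assumes "\<And>n. mterm_scalars (\<sigma> n) \<subseteq> carrier R" "\<And>i. s i \<in> carrier M" "\<And>i. u i \<in> carrier \<Delta>"
  shows "env \<sigma> s u n \<in> carrier \<Delta>"
  using assms by (simp add: env_def)

lemma env_merge:
  "env \<sigma> s u \<circ> (\<lambda>n. if even n then n else 2 * g (n div 2) + 1) = env (\<lambda>n. \<sigma> (g n)) s u"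
  by (auto simp: env_def fun_eq_iff)

lemma env_upd: "env \<sigma> s (u(i := \<gamma>)) = (env \<sigma> s u)(2 * i := \<gamma>)"
  by (auto simp: env_def fun_eq_iff)

lemma pow_CTau: "cterm_eval VS e ((CTau ^^ n) t) = (\<tau> ^^ n) (cterm_eval VS e t)"
  by (induction n) auto

lemma sat_lam_form:
  assumes "\<And>i. e i \<in> carrier \<Delta>"
  shows "cform_sat VS e (lam_form p a z) \<longleftrightarrow> lam p (e a) = e z"
  using assms by (simp add: lam_form_def lam_def pow_CTau neg_def tau_closed)

lemma eval_mlc_term:
  assumes "\<And>n. mterm_scalars (b n) \<subseteq> carrier R" "\<And>i. s i \<in> carrier M" "\<And>i. a i \<in> carrier R"
  shows "mterm_eval M s (mlc_term b a n) = mlc (\<lambda>j. mterm_eval M s (b j)) a n"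
  using assms by (induction n) auto

lemma env_new_terms:
  fixes r b k
  defines "\<sigma> \<equiv> new_terms r b k"
  assumes b: "\<And>n. mterm_scalars (b n) \<subseteq> carrier R" and r: "\<And>i. r i \<in> carrier R" and s: "\<And>i. s i \<in> carrier M"
  shows "env \<sigma> s u (vpos 3 (prod_encode (i, j))) =
      v (mterm_eval M s (b i) \<cdot> ore r i j \<ominus> mterm_eval M s (b j) \<cdot> ore r j i)"
    "env \<sigma> s u (vpos 4 j) = v (mterm_eval M s (b j))"
    "A \<subseteq> {..<k} \<Longrightarrow> env \<sigma> s u (vpos 5 (prod_encode (set_encode A, i))) =
      v (kappa r k (\<lambda>j. mterm_eval M s (b j)) A i)"
proof -
  show "env \<sigma> s u (vpos 3 (prod_encode (i, j))) =
      v (mterm_eval M s (b i) \<cdot> ore r i j \<ominus> mterm_eval M s (b j) \<cdot> ore r j i)"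
    by (simp add: env_def \<sigma>_def new_terms_def vpos_div diff_term_def M.minus_eq)
  show "env \<sigma> s u (vpos 4 j) = v (mterm_eval M s (b j))"
    by (simp add: env_def \<sigma>_def new_terms_def vpos_div)
  assume A: "A \<subseteq> {..<k}"
  then have "set_decode (set_encode A) = A" using finite_subset by (intro set_encode_inverse) auto
  then show "env \<sigma> s u (vpos 5 (prod_encode (set_encode A, i))) =
      v (kappa r k (\<lambda>j. mterm_eval M s (b j)) A i)"
    using A eval_mlc_term[of b s "sys_a r k A" k, OF b s sys_a_closed[of r A k, OF r A]]
    by (simp add: env_def \<sigma>_def new_terms_def vpos_div kappa_term_def kappa_def M.minus_eq)
qed

end

context vmod_pair
begin

text \<open>The game is played in the value sets only. On the side of \<open>F\<close> the moves are
  the values of x r_j + e_j, their normalisations and the normalised distances; the replies satisfy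
  the same formulas of \<open>theta\<close>, and \<open>transfer\<close> finds an \<open>x'\<close>
  that realises them. The renaming \<open>\<rho>\<close> makes \<open>\<Psi>\<close> refer to the
  played variables \<open>vpos 0 j\<close>.\<close>

lemma MEx_forth:
  fixes \<sigma> :: "nat \<Rightarrow> (nat \<Rightarrow> 'k) mterm" and k i
  defines "r \<equiv> \<lambda>j. A.mcoeff i (\<sigma> j)" and "b \<equiv> \<lambda>j. A.mrest i (\<sigma> j)"
  defines "\<rho> \<equiv> \<lambda>n. if even n then n else 2 * prod_encode (0, n div 2) + (1::nat)"
  assumes \<sigma>: "\<And>n. mterm_scalars (\<sigma> n) \<subseteq> carrier A.R"
    and k: "\<And>\<psi> j. \<psi> \<in> \<Psi> \<Longrightarrow> 2 * j + 1 \<in> cform_free \<psi> \<Longrightarrow> j < k"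
    and l: "set l = A.theta r k \<union> cform_ren \<rho> ` \<Psi>"
    and vars: "distinct vars" "set vars = game_vars k"
    and s: "\<And>i. s i \<in> carrier F" "\<And>i. u i \<in> carrier \<Delta>"
    and s': "\<And>i. s' i \<in> carrier G" "\<And>i. u' i \<in> carrier \<Gamma>"
    and ag: "agree A.VS B.VS (set (gsteps vars l)) (A.env (A.new_terms r b k) s u) (B.env (A.new_terms r b k) s' u')"
    and x: "x \<in> carrier F"
  shows "\<exists>x'\<in>carrier G. agree A.VS B.VS \<Psi> (A.env \<sigma> (s(i := x)) u) (B.env \<sigma> (s'(i := x')) u')"
proof -
  let ?\<sigma> = "A.new_terms r b k"
  have r: "r j \<in> carrier A.R" for j unfolding r_def using \<sigma> by simp
  have b: "mterm_scalars (b j) \<subseteq> carrier A.R" for j unfolding b_def using \<sigma> by simp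
  have \<sigma>': "mterm_scalars (?\<sigma> n) \<subseteq> carrier A.R" for n using A.new_terms_scalars[of b r k n, OF b r] .
  define e where "e j = mterm_eval F s (b j)" for j
  define e' where "e' j = mterm_eval G s' (b j)" for j
  have e: "e j \<in> carrier F" for j unfolding e_def using b s by simp
  have e': "e' j \<in> carrier G" for j unfolding e'_def using b s' by simp
  have ev: "mterm_eval F (s(i := x)) (\<sigma> j) = x \<cdot>\<^bsub>F\<^esub> r j \<oplus>\<^bsub>F\<^esub> e j" for j
    unfolding r_def e_def b_def by (rule A.mterm_decomp[OF \<sigma> s(1) x])
  have ev': "mterm_eval G (s'(i := y)) (\<sigma> j) = y \<cdot>\<^bsub>G\<^esub> r j \<oplus>\<^bsub>G\<^esub> e' j" if "y \<in> carrier G" for y j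
    unfolding r_def e'_def b_def by (rule B.mterm_decomp[OF \<sigma> s'(1) that])
  have o: "A.ore r i j \<in> carrier A.R" for i j using A.ore(1)[of r, OF r] .
  have "\<exists>\<alpha>\<in>carrier \<Delta>. A.lam (r j) \<alpha> = v (x \<cdot>\<^bsub>F\<^esub> r j \<oplus>\<^bsub>F\<^esub> e j)" for j
    using A.lam_surj[of "v (x \<cdot>\<^bsub>F\<^esub> r j \<oplus>\<^bsub>F\<^esub> e j)" "r j"] x r e by simp
  then obtain \<alpha> where \<alpha>: "\<And>j. \<alpha> j \<in> carrier \<Delta>" "\<And>j. A.lam (r j) (\<alpha> j) = v (x \<cdot>\<^bsub>F\<^esub> r j \<oplus>\<^bsub>F\<^esub> e j)"
    by metis
  have "\<exists>\<delta>\<in>carrier \<Delta>. A.lam (r i \<otimes>\<^bsub>A.R\<^esub> A.ore r i j) \<delta> = v (e i \<cdot>\<^bsub>F\<^esub> A.ore r i j \<ominus>\<^bsub>F\<^esub> e j \<cdot>\<^bsub>F\<^esub> A.ore r j i)" for i j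
    using A.lam_surj[of "v (e i \<cdot>\<^bsub>F\<^esub> A.ore r i j \<ominus>\<^bsub>F\<^esub> e j \<cdot>\<^bsub>F\<^esub> A.ore r j i)" "r i \<otimes>\<^bsub>A.R\<^esub> A.ore r i j"] e o by simp
  then obtain \<delta> where \<delta>: "\<And>i j. \<delta> i j \<in> carrier \<Delta>"
    "\<And>i j. A.lam (r i \<otimes>\<^bsub>A.R\<^esub> A.ore r i j) (\<delta> i j) = v (e i \<cdot>\<^bsub>F\<^esub> A.ore r i j \<ominus>\<^bsub>F\<^esub> e j \<cdot>\<^bsub>F\<^esub> A.ore r j i)"
    by metis
  \<comment> \<open>The last branch collects all tags other than 0 and 1; among the played variables
    only tag 2 reaches it.\<close>
  define f where "f n = (case prod_decode (n div 2) of (t, m) \<Rightarrow>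
    if t = 0 then v (x \<cdot>\<^bsub>F\<^esub> r m \<oplus>\<^bsub>F\<^esub> e m) else if t = 1 then \<alpha> m
    else \<delta> (fst (prod_decode m)) (snd (prod_decode m)))" for n
  have fc: "f n \<in> carrier \<Delta>" for n
    unfolding f_def using \<alpha>(1) \<delta>(1) x r e by (auto split: prod.split)
  have f: "f (vpos 0 j) = v (x \<cdot>\<^bsub>F\<^esub> r j \<oplus>\<^bsub>F\<^esub> e j)" "f (vpos 1 j) = \<alpha> j"
    "f (vpos 2 (prod_encode (i, j))) = \<delta> i j" for i j
    by (simp_all add: f_def vpos_div)
  have "\<exists>f'. (\<forall>i\<in>game_vars k. f' i \<in> carrier B.VS) \<and>
    agree A.VS B.VS (set l) (override_on (A.env ?\<sigma> s u) f (game_vars k))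
      (override_on (B.env ?\<sigma> s' u') f' (game_vars k))"
    using gsteps_agree[OF vars(1) ag, of f] fc unfolding vars(2) A.VS_simps by blast
  then obtain f' where f': "\<forall>n\<in>game_vars k. f' n \<in> carrier \<Gamma>"
    and ag': "agree A.VS B.VS (set l) (override_on (A.env ?\<sigma> s u) f (game_vars k))
      (override_on (B.env ?\<sigma> s' u') f' (game_vars k))"
    unfolding B.VS_simps by (elim exE conjE)
  define D where "D = override_on (A.env ?\<sigma> s u) f (game_vars k)"
  define D' where "D' = override_on (B.env ?\<sigma> s' u') f' (game_vars k)"
  have Dc: "D n \<in> carrier \<Delta>" for n
    unfolding D_def override_on_def using fc A.env_closed[of ?\<sigma> s u, OF \<sigma>' s] by simp
  have Dc': "D' n \<in> carrier \<Gamma>" for n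
    unfolding D'_def override_on_def using f' B.env_closed[of ?\<sigma> s' u', OF \<sigma>' s'] by simp
  have th: "cform_sat A.VS D \<psi> \<longleftrightarrow> cform_sat B.VS D' \<psi>" if "\<psi> \<in> A.theta r k" for \<psi>
    unfolding D_def D'_def by (rule agreeD[OF ag']) (simp add: l that)
  have ps: "cform_sat A.VS (D \<circ> \<rho>) \<psi> \<longleftrightarrow> cform_sat B.VS (D' \<circ> \<rho>) \<psi>" if "\<psi> \<in> \<Psi>" for \<psi>
  proof -
    have "inj \<rho>" unfolding \<rho>_def by (rule merge_inj) (simp add: inj_def)
    moreover have "cform_sat A.VS D (cform_ren \<rho> \<psi>) \<longleftrightarrow> cform_sat B.VS D' (cform_ren \<rho> \<psi>)"
      unfolding D_def D'_def by (rule agreeD[OF ag']) (simp add: l that)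
    ultimately show ?thesis by (simp only: cform_sat_ren)
  qed
  have D: "D (vpos 0 j) = v (x \<cdot>\<^bsub>F\<^esub> r j \<oplus>\<^bsub>F\<^esub> e j)" "D (vpos 1 j) = \<alpha> j"
    "D (vpos 4 j) = v (e j)" "D' (vpos 4 j) = w (e' j)" if "j < k" for j
    unfolding D_def D'_def override_on_def e_def e'_def using that f[of j]
      A.env_new_terms(2)[of b r s k u j, OF b r s(1)] B.env_new_terms(2)[of b r s' k u' j, OF b r s'(1)]
    by (simp_all add: game_vars_iff e_def)
  have D2: "D (vpos 2 (prod_encode (i, j))) = \<delta> i j" if "i < k" "j < k" for i j
    unfolding D_def override_on_def using that f(3)[of i j] by (simp add: game_vars_iff)
  have D3: "D' (vpos 3 (prod_encode (i, j))) = w (e' i \<cdot>\<^bsub>G\<^esub> A.ore r i j \<ominus>\<^bsub>G\<^esub> e' j \<cdot>\<^bsub>G\<^esub> A.ore r j i)"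
    "D (vpos 3 (prod_encode (i, j))) = v (e i \<cdot>\<^bsub>F\<^esub> A.ore r i j \<ominus>\<^bsub>F\<^esub> e j \<cdot>\<^bsub>F\<^esub> A.ore r j i)" for i j
    unfolding D_def D'_def override_on_def e_def e'_def
    using A.env_new_terms(1)[of b r s k u i j, OF b r s(1)] B.env_new_terms(1)[of b r s' k u' i j, OF b r s'(1)]
    by (simp_all add: game_vars_iff)
  have D5: "D (vpos 5 (prod_encode (set_encode C, i))) = v (A.kappa r k e C i)"
    "D' (vpos 5 (prod_encode (set_encode C, i))) = w (B.kappa r k e' C i)" if "C \<subseteq> {..<k}" for C i
    unfolding D_def D'_def override_on_def e_def e'_def
    using A.env_new_terms(3)[of b r s C k u i, OF b r s(1) that] B.env_new_terms(3)[of b r s' C k u' i, OF b r s'(1) that]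
    by (simp_all add: game_vars_iff)
  define \<alpha>' where "\<alpha>' j = D' (vpos 1 j)" for j
  define \<delta>' where "\<delta>' i j = D' (vpos 2 (prod_encode (i, j)))" for i j
  define N where "N = {i. i < k \<and> r i \<noteq> \<zero>\<^bsub>A.R\<^esub>}"
  have kap: "A.kappa r k e C i \<in> carrier F" "B.kappa r k e' C i \<in> carrier G" if "C \<subseteq> {..<k}" for C i
    unfolding A.kappa_def B.kappa_def using e e' A.sys_a_closed[of r C k, OF r that] A.sys_c_closed[of r C k, OF r that]
    by simp_all
  have "\<exists>x'\<in>carrier G. \<forall>i\<in>N. w (x' \<cdot>\<^bsub>G\<^esub> r i \<oplus>\<^bsub>G\<^esub> e' i) = B.lam (r i) (\<alpha>' i)"
  proof (rule transfer[where k = k and r = r and s = "A.ore r" and e = e and e' = e' and x = x and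
        \<alpha> = \<alpha> and \<alpha>' = \<alpha>' and \<delta> = \<delta> and \<delta>' = \<delta>', folded N_def])
    show "r i \<in> carrier A.R" "e i \<in> carrier F" "e' i \<in> carrier G" "A.ore r i j \<in> carrier A.R"
      "\<alpha> i \<in> carrier \<Delta>" "\<delta> i j \<in> carrier \<Delta>" "\<alpha>' i \<in> carrier \<Gamma>" "\<delta>' i j \<in> carrier \<Gamma>"
      "A.lam (r i) (\<alpha> i) = v (x \<cdot>\<^bsub>F\<^esub> r i \<oplus>\<^bsub>F\<^esub> e i)"
      "A.lam (r i \<otimes>\<^bsub>A.R\<^esub> A.ore r i j) (\<delta> i j) = v (e i \<cdot>\<^bsub>F\<^esub> A.ore r i j \<ominus>\<^bsub>F\<^esub> e j \<cdot>\<^bsub>F\<^esub> A.ore r j i)" for i j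
      unfolding \<alpha>'_def \<delta>'_def by (rule r e e' o \<alpha> \<delta> Dc')+
    show "x \<in> carrier F" by (rule x)
  next
    fix i j l assume N: "i \<in> N" "j \<in> N" "l \<in> N"
    have kk: "i < k" "j < k" "l < k" and nz: "r i \<noteq> \<zero>\<^bsub>A.R\<^esub>" "r j \<noteq> \<zero>\<^bsub>A.R\<^esub>" using N by (auto simp: N_def)
    show "A.clt (\<delta> i j) (\<alpha> l) \<longleftrightarrow> B.clt (\<delta>' i j) (\<alpha>' l)"
      using th[OF A.theta_mem(5)[OF kk(2,1,3)]] Dc Dc' D D2 kk \<alpha>(1) \<delta>(1) by (simp add: \<alpha>'_def \<delta>'_def)
    show "A.clt (\<alpha> l) (\<delta> i j) \<longleftrightarrow> B.clt (\<alpha>' l) (\<delta>' i j)"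
      using th[OF A.theta_mem(6)[OF kk(2,1,3)]] Dc Dc' D D2 kk \<alpha>(1) \<delta>(1) by (simp add: \<alpha>'_def \<delta>'_def)
  next
    fix i j assume N: "i \<in> N" "j \<in> N"
    have kk: "i < k" "j < k" and nz: "r i \<noteq> \<zero>\<^bsub>A.R\<^esub>" "r j \<noteq> \<zero>\<^bsub>A.R\<^esub>" using N by (auto simp: N_def)
    show "r i \<otimes>\<^bsub>A.R\<^esub> A.ore r i j = r j \<otimes>\<^bsub>A.R\<^esub> A.ore r j i" "r i \<otimes>\<^bsub>A.R\<^esub> A.ore r i j \<noteq> \<zero>\<^bsub>A.R\<^esub>"
      using A.ore(2,3)[of r, OF r nz] by auto
    show "B.lam (r i \<otimes>\<^bsub>A.R\<^esub> A.ore r i j) (\<delta>' i j) = w (e' i \<cdot>\<^bsub>G\<^esub> A.ore r i j \<ominus>\<^bsub>G\<^esub> e' j \<cdot>\<^bsub>G\<^esub> A.ore r j i)"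
      using th[OF A.theta_mem(3)[OF kk(2,1)]] A.sat_lam_form[of D, OF Dc] B.sat_lam_form[of D', OF Dc']
        D2[OF kk] D3[of i j] \<delta>(2)[of i j] by (simp add: \<delta>'_def)
    show "A.clt (\<alpha> i) (\<alpha> j) \<longleftrightarrow> B.clt (\<alpha>' i) (\<alpha>' j)"
      using th[OF A.theta_mem(4)[OF kk(2,1)]] Dc Dc' D kk \<alpha>(1) by (simp add: \<alpha>'_def)
    show "A.neg (\<delta> i j) \<longleftrightarrow> B.neg (\<delta>' i j)"
      using th[OF A.theta_mem(11)[OF kk(2,1)]] Dc Dc' D2 kk \<delta>(1)
      by (simp add: \<delta>'_def A.neg_def B.neg_def A.tau_closed B.tau_closed)
  next
    fix i assume N: "i \<in> N"
    then have kk: "i < k" by (simp add: N_def)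
    show inf: "\<alpha> i = infty \<Delta> \<longleftrightarrow> \<alpha>' i = infty \<Gamma>"
      using th[OF A.theta_mem(7)[OF kk kk]] D kk by (simp add: \<alpha>'_def)
    show "res_pred A.VS n (\<alpha> i) \<longleftrightarrow> res_pred B.VS n (\<alpha>' i)" if "n \<le> Suc k" for n
      using th[OF A.theta_mem(8)[OF kk kk that]] D kk by (simp add: \<alpha>'_def)
    show "A.neg (\<alpha> i) \<longleftrightarrow> B.neg (\<alpha>' i)"
      using th[OF A.theta_mem(9)[OF kk kk]] Dc Dc' D kk \<alpha>(1)
      by (simp add: \<alpha>'_def A.neg_def B.neg_def A.tau_closed B.tau_closed)
    show "A.pos (\<alpha> i) \<longleftrightarrow> B.pos (\<alpha>' i)"
      using th[OF A.theta_mem(10)[OF kk kk]] Dc Dc' D kk \<alpha>(1) inf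
      by (simp add: \<alpha>'_def A.pos_def B.pos_def A.tau_closed B.tau_closed)
  next
    fix C i assume C: "C \<subseteq> N" "i \<in> C"
    then have kk: "C \<subseteq> {..<k}" "i < k" by (auto simp: N_def)
    show "A.kappa r k e C i \<in> A.gt0 \<longleftrightarrow> B.kappa r k e' C i \<in> B.gt0"
      using th[OF A.theta_mem(12)[OF kk(2,2,1)]] th[OF A.theta_mem(13)[OF kk(2,2,1)]]
        D5[OF kk(1), of i] kap[OF kk(1), of i]
      by (simp add: A.gt0_def B.gt0_def A.pos_def B.pos_def A.tau_closed B.tau_closed)
  qed
  then obtain x' where x': "x' \<in> carrier G" "\<And>i. i \<in> N \<Longrightarrow> w (x' \<cdot>\<^bsub>G\<^esub> r i \<oplus>\<^bsub>G\<^esub> e' i) = B.lam (r i) (\<alpha>' i)"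
    by blast
  \<comment> \<open>The case r_j = 0 lies outside \<open>transfer\<close>: the term does not depend
    on the unknown, and the first formula of \<open>atoms\<close> identifies its value.\<close>
  have val: "w (x' \<cdot>\<^bsub>G\<^esub> r j \<oplus>\<^bsub>G\<^esub> e' j) = D' (vpos 0 j)" if j: "j < k" for j
  proof (cases "r j = \<zero>\<^bsub>A.R\<^esub>")
    case True
    then have "D (vpos 0 j) = D (vpos 4 j)" using D[OF j] x e by simp
    then have "D' (vpos 0 j) = D' (vpos 4 j)" using th[OF A.theta_mem(1)[OF j j]] by simp
    then show ?thesis using D(4)[OF j] True x'(1) e' by simp
  next
    case False
    have "A.lam (r j) (D (vpos 1 j)) = D (vpos 0 j)" using D[OF j] \<alpha>(2) by simp
    then have "B.lam (r j) (D' (vpos 1 j)) = D' (vpos 0 j)"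
      using th[OF A.theta_mem(2)[OF j j]] A.sat_lam_form[of D, OF Dc] B.sat_lam_form[of D', OF Dc'] by simp
    then show ?thesis using x'(2)[of j] j False by (simp add: N_def \<alpha>'_def)
  qed
  have "cform_sat A.VS (A.env \<sigma> (s(i := x)) u) \<psi> \<longleftrightarrow> cform_sat B.VS (B.env \<sigma> (s'(i := x')) u') \<psi>"
    if p: "\<psi> \<in> \<Psi>" for \<psi>
  proof -
    have small: "n div 2 < k" if "n \<in> cform_free \<psi>" "odd n" for n
      using k[OF p, of "n div 2"] that by simp
    have \<rho>: "\<rho> n = vpos 0 (n div 2)" if "odd n" for n using that by (simp add: \<rho>_def vpos_def)
    have "cform_sat A.VS (A.env \<sigma> (s(i := x)) u) \<psi> \<longleftrightarrow> cform_sat A.VS (D \<circ> \<rho>) \<psi>"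
    proof (rule cform_sat_cong)
      fix n assume n: "n \<in> cform_free \<psi>"
      show "A.env \<sigma> (s(i := x)) u n = (D \<circ> \<rho>) n"
      proof (cases "even n")
        case True
        then show ?thesis using even_game_vars[of n k] by (simp add: A.env_def \<rho>_def D_def override_on_def)
      next
        case False
        then show ?thesis using D(1)[OF small[OF n]] \<rho> ev by (simp add: A.env_def)
      qed
    qed
    also have "\<dots> \<longleftrightarrow> cform_sat B.VS (D' \<circ> \<rho>) \<psi>" by (rule ps[OF p])
    also have "\<dots> \<longleftrightarrow> cform_sat B.VS (B.env \<sigma> (s'(i := x')) u') \<psi>"
    proof (rule cform_sat_cong)
      fix n assume n: "n \<in> cform_free \<psi>"
      show "(D' \<circ> \<rho>) n = B.env \<sigma> (s'(i := x')) u' n"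
      proof (cases "even n")
        case True
        then show ?thesis using even_game_vars[of n k] by (simp add: B.env_def \<rho>_def D'_def override_on_def)
      next
        case False
        then show ?thesis using val[OF small[OF n]] \<rho> ev'[OF x'(1)] by (simp add: B.env_def)
      qed
    qed
    finally show ?thesis .
  qed
  then show ?thesis using x'(1) unfolding agree_def by blast
qed

end

section \<open>Elementary equivalence\<close>

lemma mform_sat_cong:
  "(\<And>i. i \<in> mform_free f \<Longrightarrow> s i = s' i) \<Longrightarrow> mform_sat M s f \<longleftrightarrow> mform_sat M s' f"
proof (induction f arbitrary: s s')
  case (MF_Eq a b)
  have "mterm_eval M s a = mterm_eval M s' a" "mterm_eval M s b = mterm_eval M s' b"
    by (rule mterm_eval_cong, simp add: MF_Eq.prems)+
  then show ?case by (simp only: mform_sat.simps)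
next
  case (MF_Not f)
  have "mform_sat M s f = mform_sat M s' f" by (rule MF_Not.IH) (simp add: MF_Not.prems)
  then show ?case by (simp only: mform_sat.simps)
next
  case (MF_And f g)
  have "mform_sat M s f = mform_sat M s' f" by (rule MF_And.IH(1)) (simp add: MF_And.prems)
  moreover have "mform_sat M s g = mform_sat M s' g" by (rule MF_And.IH(2)) (simp add: MF_And.prems)
  ultimately show ?case by (simp only: mform_sat.simps)
next
  case (MF_Ex i f)
  have "mform_sat M (s(i := x)) f \<longleftrightarrow> mform_sat M (s'(i := x)) f" for x
    by (rule MF_Ex.IH) (simp add: MF_Ex.prems)
  then show ?case by (simp only: mform_sat.simps)
qed

lemma vterm_eval_cong:
  "(\<And>i. i \<in> vterm_mvars a \<Longrightarrow> s i = s' i) \<Longrightarrow> (\<And>i. i \<in> vterm_vvars a \<Longrightarrow> u i = u' i) \<Longrightarrow>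
    vterm_eval S s u a = vterm_eval S s' u' a"
proof (induction a)
  case (VVal a)
  have "mterm_eval (module_sort S) s a = mterm_eval (module_sort S) s' a"
    by (rule mterm_eval_cong) (simp add: VVal.prems)
  then show ?case by simp
qed auto

lemma lform_sat_cong:
  "(\<And>i. i \<in> lform_mfree f \<Longrightarrow> s i = s' i) \<Longrightarrow> (\<And>i. i \<in> lform_vfree f \<Longrightarrow> u i = u' i) \<Longrightarrow>
    lform_sat S s u f \<longleftrightarrow> lform_sat S s' u' f"
proof (induction f arbitrary: s s' u u')
  case (LF_MEq a b)
  have "mterm_eval (module_sort S) s a = mterm_eval (module_sort S) s' a"
    "mterm_eval (module_sort S) s b = mterm_eval (module_sort S) s' b"
    by (rule mterm_eval_cong, simp add: LF_MEq.prems)+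
  then show ?case by (simp only: lform_sat.simps)
next
  case (LF_VEq a b)
  have "vterm_eval S s u a = vterm_eval S s' u' a" "vterm_eval S s u b = vterm_eval S s' u' b"
    by (rule vterm_eval_cong; simp add: LF_VEq.prems)+
  then show ?case by (simp only: lform_sat.simps)
next
  case (LF_Less a b)
  have "vterm_eval S s u a = vterm_eval S s' u' a" "vterm_eval S s u b = vterm_eval S s' u' b"
    by (rule vterm_eval_cong; simp add: LF_Less.prems)+
  then show ?case by (simp only: lform_sat.simps)
next
  case (LF_R n a)
  have "vterm_eval S s u a = vterm_eval S s' u' a"
    by (rule vterm_eval_cong; simp add: LF_R.prems)
  then show ?case by (simp only: lform_sat.simps)
next
  case (LF_Not f)
  have "lform_sat S s u f = lform_sat S s' u' f" by (rule LF_Not.IH; simp add: LF_Not.prems)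
  then show ?case by (simp only: lform_sat.simps)
next
  case (LF_And f g)
  have "lform_sat S s u f = lform_sat S s' u' f" by (rule LF_And.IH(1); simp add: LF_And.prems)
  moreover have "lform_sat S s u g = lform_sat S s' u' g" by (rule LF_And.IH(2); simp add: LF_And.prems)
  ultimately show ?case by (simp only: lform_sat.simps)
next
  case (LF_MEx i f)
  have "lform_sat S (s(i := x)) u f \<longleftrightarrow> lform_sat S (s'(i := x)) u' f" for x
    by (rule LF_MEx.IH; simp add: LF_MEx.prems)
  then show ?case by (simp only: lform_sat.simps)
next
  case (LF_VEx i f)
  have "lform_sat S s (u(i := x)) f \<longleftrightarrow> lform_sat S s' (u'(i := x)) f" for x
    by (rule LF_VEx.IH; simp add: LF_VEx.prems)
  then show ?case by (simp only: lform_sat.simps)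
qed

section \<open>Sentences for the indices of annihilators\<close>

primrec mconj :: "'r mform list \<Rightarrow> 'r mform" where
  "mconj [] = MF_Eq MZero MZero"
| "mconj (f # l) = MF_And f (mconj l)"

primrec mexs :: "nat list \<Rightarrow> 'r mform \<Rightarrow> 'r mform" where
  "mexs [] f = f"
| "mexs (i # is) f = MF_Ex i (mexs is f)"

lemma sat_mconj: "mform_sat M s (mconj l) \<longleftrightarrow> (\<forall>f\<in>set l. mform_sat M s f)"
  by (induction l) auto

lemma free_mconj: "mform_free (mconj l) = (\<Union>f\<in>set l. mform_free f)"
  by (induction l) auto

lemma scalars_mconj: "mform_scalars (mconj l) = (\<Union>f\<in>set l. mform_scalars f)"
  by (induction l) auto

lemma free_mexs: "mform_free (mexs is f) = mform_free f - set is"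
  by (induction "is") auto

lemma scalars_mexs: "mform_scalars (mexs is f) = mform_scalars f"
  by (induction "is") auto

lemma sat_mexs:
  "distinct is \<Longrightarrow> mform_sat M s (mexs is f) \<longleftrightarrow>
    (\<exists>t. (\<forall>i\<in>set is. t i \<in> carrier M) \<and> mform_sat M (override_on s t (set is)) f)"
proof (induction "is" arbitrary: s)
  case Nil
  then show ?case by simp
next
  case (Cons i "is")
  have o: "override_on (s(i := x)) t (set is) = override_on s (t(i := x)) (set (i # is))" for x t
    using Cons.prems by (auto simp: override_on_def fun_eq_iff)
  have "mform_sat M s (mexs (i # is) f) \<longleftrightarrow> (\<exists>x\<in>carrier M. \<exists>t. (\<forall>i\<in>set is. t i \<in> carrier M) \<and>
      mform_sat M (override_on s (t(i := x)) (set (i # is))) f)"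
    using Cons by (simp only: mexs.simps mform_sat.simps o distinct.simps simp_thms)
  also have "\<dots> \<longleftrightarrow> (\<exists>t. (\<forall>i\<in>set (i # is). t i \<in> carrier M) \<and> mform_sat M (override_on s t (set (i # is))) f)"
    (is "?L \<longleftrightarrow> ?R")
  proof
    assume ?L
    then obtain x t where xt: "x \<in> carrier M" "\<forall>i\<in>set is. t i \<in> carrier M"
      "mform_sat M (override_on s (t(i := x)) (set (i # is))) f" by blast
    moreover have "\<forall>j\<in>set (i # is). (t(i := x)) j \<in> carrier M" using xt by simp
    ultimately show ?R by blast
  next
    assume ?R
    then obtain t where t: "\<forall>i\<in>set (i # is). t i \<in> carrier M"
      "mform_sat M (override_on s t (set (i # is))) f" by blast
    have "t(i := t i) = t" by simp
    then have "t i \<in> carrier M" "\<forall>i\<in>set is. t i \<in> carrier M"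
      "mform_sat M (override_on s (t(i := t i)) (set (i # is))) f" using t by simp_all
    then show ?L by blast
  qed
  finally show ?case .
qed

text \<open>The right-hand side of \<open>sep_Pset_torsion\<close> as a sentence. Pairs on the
  diagonal contribute a trivial equation.\<close>

definition index_sentence :: "'r \<Rightarrow> 'r \<Rightarrow> nat \<Rightarrow> 'r mform" where
  "index_sentence r g n = mexs [0..<n] (mconj
    (map (\<lambda>a. MF_Eq (MAct (MVar a) r) MZero) [0..<n] @
     map (\<lambda>(a, b). if a = b then MF_Eq MZero MZero
       else MF_Not (MF_Eq (MAct (MVar a) g) (MAct (MVar b) g))) (List.product [0..<n] [0..<n])))"

lemma index_sentence_closed:
  "r \<in> carrier R \<Longrightarrow> g \<in> carrier R \<Longrightarrow> mod_sentence R (index_sentence r g n)"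
  unfolding mod_sentence_def index_sentence_def free_mexs scalars_mexs free_mconj scalars_mconj
  by (auto split: if_splits)

lemma sat_index_sentence:
  "mform_sat M s (index_sentence r g n) \<longleftrightarrow>
    (\<exists>S\<subseteq>{x \<in> carrier M. x \<cdot>\<^bsub>M\<^esub> r = \<zero>\<^bsub>M\<^esub>}. finite S \<and> card S = n \<and> inj_on (\<lambda>x. x \<cdot>\<^bsub>M\<^esub> g) S)"
    (is "?L \<longleftrightarrow> ?R")
proof -
  have body: "(\<forall>f\<in>set (map (\<lambda>a. MF_Eq (MAct (MVar a) r) MZero) [0..<n] @
      map (\<lambda>(a, b). if a = b then MF_Eq MZero MZero
        else MF_Not (MF_Eq (MAct (MVar a) g) (MAct (MVar b) g))) (List.product [0..<n] [0..<n])).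
        mform_sat M s f) \<longleftrightarrow>
      (\<forall>i<n. s i \<cdot>\<^bsub>M\<^esub> r = \<zero>\<^bsub>M\<^esub>) \<and> (\<forall>i<n. \<forall>j<n. i \<noteq> j \<longrightarrow> s i \<cdot>\<^bsub>M\<^esub> g \<noteq> s j \<cdot>\<^bsub>M\<^esub> g)" for s
    unfolding set_append ball_Un by (rule arg_cong2[of _ _ _ _ "(\<and>)"]) (simp_all, auto)
  have "?L \<longleftrightarrow> (\<exists>t. (\<forall>i<n. t i \<in> carrier M) \<and> (\<forall>i<n. t i \<cdot>\<^bsub>M\<^esub> r = \<zero>\<^bsub>M\<^esub>) \<and>
      (\<forall>i<n. \<forall>j<n. i \<noteq> j \<longrightarrow> t i \<cdot>\<^bsub>M\<^esub> g \<noteq> t j \<cdot>\<^bsub>M\<^esub> g))"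
    unfolding index_sentence_def sat_mexs[OF distinct_upt] sat_mconj body
    by (intro ex_cong1) (simp add: override_on_def Ball_def)
  also have "\<dots> \<longleftrightarrow> ?R"
  proof
    assume "\<exists>t. (\<forall>i<n. t i \<in> carrier M) \<and> (\<forall>i<n. t i \<cdot>\<^bsub>M\<^esub> r = \<zero>\<^bsub>M\<^esub>) \<and>
      (\<forall>i<n. \<forall>j<n. i \<noteq> j \<longrightarrow> t i \<cdot>\<^bsub>M\<^esub> g \<noteq> t j \<cdot>\<^bsub>M\<^esub> g)"
    then obtain t where t: "\<forall>i<n. t i \<in> carrier M" "\<forall>i<n. t i \<cdot>\<^bsub>M\<^esub> r = \<zero>\<^bsub>M\<^esub>"
      "\<forall>i<n. \<forall>j<n. i \<noteq> j \<longrightarrow> t i \<cdot>\<^bsub>M\<^esub> g \<noteq> t j \<cdot>\<^bsub>M\<^esub> g" by blast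
    have "i = j" if "i < n" "j < n" "t i \<cdot>\<^bsub>M\<^esub> g = t j \<cdot>\<^bsub>M\<^esub> g" for i j using t(3) that by blast
    then have "inj_on t {..<n}" "inj_on (\<lambda>x. x \<cdot>\<^bsub>M\<^esub> g) (t ` {..<n})"
      unfolding inj_on_def by (metis lessThan_iff, metis imageE lessThan_iff)
    then show ?R using t by (intro exI[of _ "t ` {..<n}"]) (auto simp: card_image)
  next
    assume ?R
    then obtain S where S: "S \<subseteq> {x \<in> carrier M. x \<cdot>\<^bsub>M\<^esub> r = \<zero>\<^bsub>M\<^esub>}" "finite S" "card S = n"
      "inj_on (\<lambda>x. x \<cdot>\<^bsub>M\<^esub> g) S" by blast
    obtain t where t: "bij_betw t {0..<n} S" using ex_bij_betw_nat_finite[OF S(2)] S(3) by blast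
    have tS: "t i \<in> S" if "i < n" for i using bij_betwE[OF t] that by auto
    have "t i \<cdot>\<^bsub>M\<^esub> g \<noteq> t j \<cdot>\<^bsub>M\<^esub> g" if "i < n" "j < n" "i \<noteq> j" for i j
    proof
      assume "t i \<cdot>\<^bsub>M\<^esub> g = t j \<cdot>\<^bsub>M\<^esub> g"
      then have "t i = t j" using inj_onD[OF S(4)] tS that by blast
      then show False using inj_onD[OF bij_betw_imp_inj_on[OF t]] that by force
    qed
    then show "\<exists>t. (\<forall>i<n. t i \<in> carrier M) \<and> (\<forall>i<n. t i \<cdot>\<^bsub>M\<^esub> r = \<zero>\<^bsub>M\<^esub>) \<and>
      (\<forall>i<n. \<forall>j<n. i \<noteq> j \<longrightarrow> t i \<cdot>\<^bsub>M\<^esub> g \<noteq> t j \<cdot>\<^bsub>M\<^esub> g)"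
      using S(1) tS by (intro exI[of _ t]) auto
  qed
  finally show ?thesis .
qed

lemma val_models_closed:
  assumes "cform_free f = {}" "\<And>i. e i \<in> carrier V"
  shows "val_models V f \<longleftrightarrow> cform_sat V e f"
proof
  assume "val_models V f"
  then show "cform_sat V e f" using assms(2) by (simp add: val_models_def)
next
  assume e: "cform_sat V e f"
  have "cform_sat V s f" for s using cform_sat_cong[of f s e V] assms(1) e by simp
  then show "val_models V f" by (simp add: val_models_def)
qed

lemma mod_models_closed:
  assumes "mform_free f = {}" "\<And>i. s i \<in> carrier M"
  shows "mod_models M f \<longleftrightarrow> mform_sat M s f"
proof
  assume "mod_models M f"
  then show "mform_sat M s f" using assms(2) by (simp add: mod_models_def)
next
  assume e: "mform_sat M s f"
  have "mform_sat M t f" for t using mform_sat_cong[of f t s M] assms(1) e by simp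
  then show "mod_models M f" by (simp add: mod_models_def)
qed

context vmod
begin

text \<open>All elements annihilated by a non-zero \<open>r\<close> are torsion, so the sentence
  counts the same elements in the torsion submodule as in the whole module.\<close>

lemma models_index_sentence:
  assumes r: "r \<in> carrier R" "r \<noteq> \<zero>\<^bsub>R\<^esub>" and g: "g \<in> carrier R"
  shows "mod_models (torsion R M) (index_sentence r g n) \<longleftrightarrow> M.sep n (Pset r) (Pset g)"
proof -
  let ?T = "torsion R M"
  have ops: "ract ?T = ract M" "zero ?T = \<zero>" by (simp_all add: torsion_def)
  have "\<zero> \<cdot> \<one>\<^bsub>R\<^esub> = \<zero>" by simp
  then have z: "\<zero> \<in> carrier ?T" using one_neq_zero unfolding torsion_def by auto
  have "{x \<in> carrier ?T. x \<cdot>\<^bsub>?T\<^esub> r = zero ?T} = {x \<in> carrier M. x \<cdot> r = \<zero>}"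
    unfolding ops using r by (auto simp: torsion_def)
  then have "mform_sat ?T (\<lambda>_. \<zero>) (index_sentence r g n) \<longleftrightarrow> M.sep n (Pset r) (Pset g)"
    unfolding sat_index_sentence sep_Pset_torsion[OF r g] by (simp only: ops)
  moreover have "mform_free (index_sentence r g n) = {}"
    using index_sentence_closed[OF r(1) g] by (simp add: mod_sentence_def)
  ultimately show ?thesis using mod_models_closed[of _ "\<lambda>_. \<zero>" ?T] z by simp
qed

definition mid_sentence :: cform where
  "mid_sentence = CF_Ex 0 (CF_And (CF_Eq (CTau (CVar 0)) (CVar 0)) (CF_Not (CF_Eq (CVar 0) CInf)))"

lemma models_mid_sentence: "val_models VS mid_sentence \<longleftrightarrow> (\<exists>\<gamma>\<in>carrier \<Delta>. mid \<gamma>)"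
proof -
  have "val_models VS mid_sentence \<longleftrightarrow> cform_sat VS (\<lambda>_. \<infinity>) mid_sentence"
    by (rule val_models_closed) (auto simp: mid_sentence_def infty_closed)
  then show ?thesis by (simp add: mid_sentence_def mid_def)
qed

end

section \<open>Formulas determined by the values of finitely many terms\<close>

primrec vt_base :: "'r vterm \<Rightarrow> 'r mterm" where
  "vt_base (VVar i) = MZero"
| "vt_base VInf = MZero"
| "vt_base (VTau a) = vt_base a"
| "vt_base (VVal t) = t"

text \<open>A value term is an iterate of \<tau> over a variable, \<infinity> or the value of one
  module term. In the last case this value is read at the odd position 2 j + 1; otherwise the base
  \<open>MZero\<close> is only a placeholder.\<close>

primrec vt_cterm :: "nat \<Rightarrow> 'r vterm \<Rightarrow> cterm" where
  "vt_cterm j (VVar i) = CVar (2 * i)"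
| "vt_cterm j VInf = CInf"
| "vt_cterm j (VTau a) = CTau (vt_cterm j a)"
| "vt_cterm j (VVal t) = CVar (2 * j + 1)"

lemma vt_base_scalars: "mterm_scalars (vt_base a) \<subseteq> vterm_scalars a"
  by (induction a) auto

locale vmod_plain = vmod K \<phi> M \<Delta> v
  for K :: "('k, 'x) ring_scheme" and \<phi> :: "'k \<Rightarrow> 'k"
    and M :: "(nat \<Rightarrow> 'k, 'm) rmodule" (structure) and \<Delta> :: "'d chain" and v :: "'m \<Rightarrow> 'd"
begin

abbreviation LS where "LS \<equiv> l_structure M \<Delta> v"

lemma LS_simps[simp]: "module_sort LS = M" "value_sort LS = VS" "valuation LS = v"
  by (simp_all add: l_structure_def)

lemma vterm_env: "\<sigma> j = vt_base a \<Longrightarrow> vterm_eval LS s u a = cterm_eval VS (env \<sigma> s u) (vt_cterm j a)"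
  by (induction a) (simp_all add: env_def)

lemma mterm_eval_zero: "mterm_scalars t \<subseteq> carrier R \<Longrightarrow> mterm_eval M (\<lambda>_. \<zero>) t = \<zero>"
  by (induction t) auto

end

locale vmod_pair_plain = vmod_pair K \<phi> F \<Delta> v G \<Gamma> w
  for K :: "('k, 'x) ring_scheme" and \<phi> :: "'k \<Rightarrow> 'k"
    and F :: "(nat \<Rightarrow> 'k, 'm) rmodule" and \<Delta> :: "'d chain" and v :: "'m \<Rightarrow> 'd"
    and G :: "(nat \<Rightarrow> 'k, 'n) rmodule" and \<Gamma> :: "'e chain" and w :: "'n \<Rightarrow> 'e"
begin

sublocale A: vmod_plain K \<phi> F \<Delta> v ..
sublocale B: vmod_plain K \<phi> G \<Gamma> w ..

lemma swap: "vmod_pair K \<phi> G \<Gamma> w F \<Delta> v"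
proof
  show "B.M.sep n (B.Pset r) (B.Pset g) \<longleftrightarrow> A.M.sep n (A.Pset r) (A.Pset g)"
    if "r \<in> carrier A.R" "r \<noteq> \<zero>\<^bsub>A.R\<^esub>" "g \<in> carrier A.R" for r g n
    using idx[OF that] by simp
  show "(\<exists>\<gamma>\<in>carrier \<Gamma>. B.mid \<gamma>) \<longleftrightarrow> (\<exists>\<gamma>\<in>carrier \<Delta>. A.mid \<gamma>)" using mid_transfer by simp
qed

text \<open>Quantifier elimination relative to the value set, for two structures at once:
  preservation of truth under agreement takes the place of an equivalent formula.\<close>

definition determines :: "(nat \<Rightarrow> (nat \<Rightarrow> 'k) mterm) \<Rightarrow> cform set \<Rightarrow> (nat \<Rightarrow> 'k) lform \<Rightarrow> bool" where
  "determines \<sigma> \<Psi> f \<longleftrightarrow> (\<forall>n. mterm_scalars (\<sigma> n) \<subseteq> carrier A.R) \<and> finite \<Psi> \<and>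
    (\<forall>s u s' u'. (\<forall>i. s i \<in> carrier F) \<longrightarrow> (\<forall>i. u i \<in> carrier \<Delta>) \<longrightarrow> (\<forall>i. s' i \<in> carrier G) \<longrightarrow>
      (\<forall>i. u' i \<in> carrier \<Gamma>) \<longrightarrow> agree A.VS B.VS \<Psi> (A.env \<sigma> s u) (B.env \<sigma> s' u') \<longrightarrow>
      (lform_sat A.LS s u f \<longleftrightarrow> lform_sat B.LS s' u' f))"

lemma determinesI:
  assumes "\<And>n. mterm_scalars (\<sigma> n) \<subseteq> carrier A.R" "finite \<Psi>"
    "\<And>s u s' u'. (\<And>i. s i \<in> carrier F) \<Longrightarrow> (\<And>i. u i \<in> carrier \<Delta>) \<Longrightarrow> (\<And>i. s' i \<in> carrier G) \<Longrightarrow>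
      (\<And>i. u' i \<in> carrier \<Gamma>) \<Longrightarrow> agree A.VS B.VS \<Psi> (A.env \<sigma> s u) (B.env \<sigma> s' u') \<Longrightarrow>
      lform_sat A.LS s u f \<longleftrightarrow> lform_sat B.LS s' u' f"
  shows "determines \<sigma> \<Psi> f"
  unfolding determines_def using assms by simp

lemma determinesD:
  assumes "determines \<sigma> \<Psi> f" "\<And>i. s i \<in> carrier F" "\<And>i. u i \<in> carrier \<Delta>" "\<And>i. s' i \<in> carrier G"
    "\<And>i. u' i \<in> carrier \<Gamma>" "agree A.VS B.VS \<Psi> (A.env \<sigma> s u) (B.env \<sigma> s' u')"
  shows "lform_sat A.LS s u f \<longleftrightarrow> lform_sat B.LS s' u' f"
  using assms unfolding determines_def by simp

text \<open>Forth and back are \<open>MEx_forth\<close> for the pair and for the swapped pair; the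
  terms and formulas involved are the same, as they depend on the scalars only.\<close>

lemma determines_MEx:
  assumes d: "determines \<sigma> \<Psi> f"
  shows "\<exists>\<sigma> \<Psi>. determines \<sigma> \<Psi> (LF_MEx i f)"
proof -
  interpret swap: vmod_pair K \<phi> G \<Gamma> w F \<Delta> v by (rule swap)
  have \<sigma>: "mterm_scalars (\<sigma> n) \<subseteq> carrier A.R" for n using d by (simp add: determines_def)
  have fin: "finite \<Psi>" using d by (simp add: determines_def)
  let ?r = "\<lambda>j. A.mcoeff i (\<sigma> j)" and ?b = "\<lambda>j. A.mrest i (\<sigma> j)"
  let ?\<rho> = "\<lambda>n. if even n then n else 2 * prod_encode (0, n div 2) + (1::nat)"
  have "finite (\<Union>\<psi>\<in>\<Psi>. cform_free \<psi>)" using fin finite_cform_free by blast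
  \<comment> \<open>Only terms \<open>\<sigma> j\<close> with j < k are visible in
    \<open>\<Psi>\<close>; they are the finitely many x r_j + e_j to be controlled.\<close>
  then obtain k where "\<forall>n\<in>(\<Union>\<psi>\<in>\<Psi>. cform_free \<psi>). n < k" using finite_nat_set_iff_bounded by blast
  then have k: "j < k" if "\<psi> \<in> \<Psi>" "2 * j + 1 \<in> cform_free \<psi>" for \<psi> j using that by fastforce
  obtain l where l: "set l = A.theta ?r k \<union> cform_ren ?\<rho> ` \<Psi>"
    using finite_list[of "A.theta ?r k \<union> cform_ren ?\<rho> ` \<Psi>"] fin A.finite_theta by auto
  obtain vars where vars: "set vars = game_vars k" "distinct vars"
    using finite_distinct_list[OF finite_game_vars] by blast
  let ?\<sigma> = "A.new_terms ?r ?b k"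
  have "determines ?\<sigma> (set (gsteps vars l)) (LF_MEx i f)"
  proof (rule determinesI)
    show "mterm_scalars (?\<sigma> n) \<subseteq> carrier A.R" for n
      using \<sigma> by (intro A.new_terms_scalars) simp_all
    show "finite (set (gsteps vars l))" by simp
    fix s u s' u'
    assume s: "\<And>i. s i \<in> carrier F" "\<And>i. u i \<in> carrier \<Delta>" and s': "\<And>i. s' i \<in> carrier G" "\<And>i. u' i \<in> carrier \<Gamma>"
      and ag: "agree A.VS B.VS (set (gsteps vars l)) (A.env ?\<sigma> s u) (B.env ?\<sigma> s' u')"
    have eq: "lform_sat A.LS (s(i := x)) u f \<longleftrightarrow> lform_sat B.LS (s'(i := x')) u' f"
      if "x \<in> carrier F" "x' \<in> carrier G" "agree A.VS B.VS \<Psi> (A.env \<sigma> (s(i := x)) u) (B.env \<sigma> (s'(i := x')) u')" for x x'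
      using that s s' by (intro determinesD[OF d]) auto
    have "\<exists>x'\<in>carrier G. lform_sat B.LS (s'(i := x')) u' f"
      if x: "x \<in> carrier F" "lform_sat A.LS (s(i := x)) u f" for x
    proof -
      have "\<exists>y\<in>carrier G. agree A.VS B.VS \<Psi> (A.env \<sigma> (s(i := x)) u) (B.env \<sigma> (s'(i := y)) u')"
        by (rule MEx_forth[where k = k and l = l and vars = vars])
          (fact \<sigma> k l vars s s' ag x(1))+
      then obtain y where y: "y \<in> carrier G" "agree A.VS B.VS \<Psi> (A.env \<sigma> (s(i := x)) u) (B.env \<sigma> (s'(i := y)) u')"
        by (elim bexE)
      show ?thesis using eq[OF x(1) y] x(2) y(1) by (intro bexI[of _ y]) simp_all
    qed
    moreover have "\<exists>x\<in>carrier F. lform_sat A.LS (s(i := x)) u f"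
      if x: "x \<in> carrier G" "lform_sat B.LS (s'(i := x)) u' f" for x
    proof -
      note ag' = agree_sym[OF ag]
      have "\<exists>y\<in>carrier F. agree B.VS A.VS \<Psi> (B.env \<sigma> (s'(i := x)) u') (A.env \<sigma> (s(i := y)) u)"
        by (rule swap.MEx_forth[where k = k and l = l and vars = vars])
          (fact \<sigma> k l vars s s' ag' x(1))+
      then obtain y where y: "y \<in> carrier F" "agree B.VS A.VS \<Psi> (B.env \<sigma> (s'(i := x)) u') (A.env \<sigma> (s(i := y)) u)"
        by (elim bexE)
      show ?thesis using eq[OF y(1) x(1) agree_sym[OF y(2)]] x(2) y(1) by (intro bexI[of _ y]) simp_all
    qed
    ultimately show "lform_sat A.LS s u (LF_MEx i f) \<longleftrightarrow> lform_sat B.LS s' u' (LF_MEx i f)"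
      unfolding lform_sat.simps A.LS_simps B.LS_simps by blast
  qed
  then show ?thesis by blast
qed

text \<open>The quantified variable itself is played, at position 2 i, so one round suffices and the
  terms stay the same.\<close>

lemma determines_VEx:
  assumes d: "determines \<sigma> \<Psi> f"
  shows "\<exists>\<sigma> \<Psi>. determines \<sigma> \<Psi> (LF_VEx i f)"
proof -
  have \<sigma>: "mterm_scalars (\<sigma> n) \<subseteq> carrier A.R" for n using d by (simp add: determines_def)
  have "finite \<Psi>" using d by (simp add: determines_def)
  then obtain l where l: "set l = \<Psi>" using finite_list by blast
  have ov: "override_on e g (set [j]) = e(j := g j)" for e g and j :: nat
    by (auto simp: override_on_def)
  have "determines \<sigma> (set (gsteps [2 * i] l)) (LF_VEx i f)"
  proof (rule determinesI[OF \<sigma>])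
    show "finite (set (gsteps [2 * i] l))" by (rule finite_set)
    fix s u s' u'
    assume s: "\<And>i. s i \<in> carrier F" "\<And>i. u i \<in> carrier \<Delta>" and s': "\<And>i. s' i \<in> carrier G" "\<And>i. u' i \<in> carrier \<Gamma>"
      and ag: "agree A.VS B.VS (set (gsteps [2 * i] l)) (A.env \<sigma> s u) (B.env \<sigma> s' u')"
    have eq: "lform_sat A.LS s (u(i := x)) f \<longleftrightarrow> lform_sat B.LS s' (u'(i := x')) f"
      if "x \<in> carrier \<Delta>" "x' \<in> carrier \<Gamma>" "agree A.VS B.VS \<Psi> ((A.env \<sigma> s u)(2 * i := x)) ((B.env \<sigma> s' u')(2 * i := x'))" for x x'
      using that s s' by (intro determinesD[OF d]) (auto simp: A.env_upd B.env_upd)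
    have "\<exists>x'\<in>carrier \<Gamma>. lform_sat B.LS s' (u'(i := x')) f"
      if x: "x \<in> carrier \<Delta>" "lform_sat A.LS s (u(i := x)) f" for x
    proof -
      obtain g where "\<forall>i\<in>set [2 * i]. g i \<in> carrier B.VS"
        "agree A.VS B.VS (set l) (override_on (A.env \<sigma> s u) (\<lambda>_. x) (set [2 * i])) (override_on (B.env \<sigma> s' u') g (set [2 * i]))"
        using gsteps_agree[OF _ ag, of "\<lambda>_. x"] x(1) by auto
      then have "g (2 * i) \<in> carrier \<Gamma>" "agree A.VS B.VS \<Psi> ((A.env \<sigma> s u)(2 * i := x)) ((B.env \<sigma> s' u')(2 * i := g (2 * i)))"
        unfolding ov l by simp_all
      then show ?thesis using eq[OF x(1)] x(2) by blast
    qed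
    moreover have "\<exists>x\<in>carrier \<Delta>. lform_sat A.LS s (u(i := x)) f"
      if x: "x \<in> carrier \<Gamma>" "lform_sat B.LS s' (u'(i := x)) f" for x
    proof -
      obtain g where "\<forall>i\<in>set [2 * i]. g i \<in> carrier A.VS"
        "agree B.VS A.VS (set l) (override_on (B.env \<sigma> s' u') (\<lambda>_. x) (set [2 * i])) (override_on (A.env \<sigma> s u) g (set [2 * i]))"
        using gsteps_agree[OF _ agree_sym[OF ag], of "\<lambda>_. x"] x(1) by auto
      then have g: "g (2 * i) \<in> carrier \<Delta>" "agree B.VS A.VS \<Psi> ((B.env \<sigma> s' u')(2 * i := x)) ((A.env \<sigma> s u)(2 * i := g (2 * i)))"
        unfolding ov l by simp_all
      then show ?thesis using eq[OF g(1) x(1) agree_sym[OF g(2)]] x(2) by blast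
    qed
    ultimately show "lform_sat A.LS s u (LF_VEx i f) \<longleftrightarrow> lform_sat B.LS s' u' (LF_VEx i f)"
      unfolding lform_sat.simps A.LS_simps B.LS_simps A.VS_simps B.VS_simps by blast
  qed
  then show ?thesis by blast
qed

text \<open>The two families of terms are merged, one at the even and one at the odd indices, and
  the formulas are renamed accordingly.\<close>

lemma determines_And:
  assumes f: "determines \<sigma> \<Psi> f" and g: "determines \<sigma>' \<Psi>' g"
  shows "\<exists>\<sigma> \<Psi>. determines \<sigma> \<Psi> (LF_And f g)"
proof -
  define \<tau> where "\<tau> n = (if even n then \<sigma> (n div 2) else \<sigma>' (n div 2))" for n
  let ?\<rho> = "\<lambda>n. if even n then n else 2 * (\<lambda>m. 2 * m) (n div 2) + (1::nat)"
  let ?\<rho>' = "\<lambda>n. if even n then n else 2 * (\<lambda>m. 2 * m + 1) (n div 2) + (1::nat)"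
  have inj: "inj ?\<rho>" "inj ?\<rho>'" by (rule merge_inj, simp add: inj_def)+
  have \<tau>: "(\<lambda>n. \<tau> (2 * n)) = \<sigma>" "(\<lambda>n. \<tau> (2 * n + 1)) = \<sigma>'" by (auto simp: \<tau>_def)
  have "determines \<tau> (cform_ren ?\<rho> ` \<Psi> \<union> cform_ren ?\<rho>' ` \<Psi>') (LF_And f g)"
  proof (rule determinesI)
    show "mterm_scalars (\<tau> n) \<subseteq> carrier A.R" for n using f g by (simp add: determines_def \<tau>_def)
    show "finite (cform_ren ?\<rho> ` \<Psi> \<union> cform_ren ?\<rho>' ` \<Psi>')" using f g by (simp add: determines_def)
    fix s u s' u'
    assume s: "\<And>i. s i \<in> carrier F" "\<And>i. u i \<in> carrier \<Delta>" and s': "\<And>i. s' i \<in> carrier G" "\<And>i. u' i \<in> carrier \<Gamma>"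
      and ag: "agree A.VS B.VS (cform_ren ?\<rho> ` \<Psi> \<union> cform_ren ?\<rho>' ` \<Psi>') (A.env \<tau> s u) (B.env \<tau> s' u')"
    have "agree A.VS B.VS \<Psi> (A.env \<tau> s u \<circ> ?\<rho>) (B.env \<tau> s' u' \<circ> ?\<rho>)"
      using agree_mono[OF ag Un_upper1] unfolding agree_ren[OF inj(1)] .
    then have 1: "agree A.VS B.VS \<Psi> (A.env \<sigma> s u) (B.env \<sigma> s' u')"
      unfolding A.env_merge[where g = "\<lambda>m. 2 * m"] B.env_merge[where g = "\<lambda>m. 2 * m"] \<tau> .
    have "agree A.VS B.VS \<Psi>' (A.env \<tau> s u \<circ> ?\<rho>') (B.env \<tau> s' u' \<circ> ?\<rho>')"
      using agree_mono[OF ag Un_upper2] unfolding agree_ren[OF inj(2)] .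
    then have 2: "agree A.VS B.VS \<Psi>' (A.env \<sigma>' s u) (B.env \<sigma>' s' u')"
      unfolding A.env_merge[where g = "\<lambda>m. 2 * m + 1"] B.env_merge[where g = "\<lambda>m. 2 * m + 1"] \<tau> .
    show "lform_sat A.LS s u (LF_And f g) \<longleftrightarrow> lform_sat B.LS s' u' (LF_And f g)"
      using determinesD[OF f s s' 1] determinesD[OF g s s' 2] by simp
  qed
  then show ?thesis by blast
qed

lemma determines_vterms:
  assumes "vterm_scalars a \<subseteq> carrier A.R" "vterm_scalars b \<subseteq> carrier A.R"
    and "\<And>s u s' u'. (cform_sat A.VS (A.env (\<lambda>n. if n = 0 then vt_base a else vt_base b) s u) \<psi> \<longleftrightarrow>
      cform_sat B.VS (B.env (\<lambda>n. if n = 0 then vt_base a else vt_base b) s' u') \<psi>) \<Longrightarrow>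
      lform_sat A.LS s u f \<longleftrightarrow> lform_sat B.LS s' u' f"
  shows "\<exists>\<sigma> \<Psi>. determines \<sigma> \<Psi> f"
proof -
  have "determines (\<lambda>n. if n = 0 then vt_base a else vt_base b) {\<psi>} f"
  proof (rule determinesI)
    show "mterm_scalars (if n = 0 then vt_base a else vt_base b) \<subseteq> carrier A.R" for n :: nat
      using assms(1,2) vt_base_scalars[of a] vt_base_scalars[of b] by auto
  qed (use assms(3) in \<open>simp_all add: agree_def\<close>)
  then show ?thesis by blast
qed

lemma determines_exists: "lform_scalars f \<subseteq> carrier A.R \<Longrightarrow> \<exists>\<sigma> \<Psi>. determines \<sigma> \<Psi> f"
proof (induction f)
  case (LF_MEq a b)
  \<comment> \<open>An equation a = b between module terms means v(a - b) = \<infinity>.\<close>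
  have "determines (\<lambda>_. MPlus a (MMinus b)) {CF_Eq (CVar 1) CInf} (LF_MEq a b)"
  proof (rule determinesI)
    have sc: "mterm_scalars a \<subseteq> carrier A.R" "mterm_scalars b \<subseteq> carrier A.R" using LF_MEq by auto
    show "mterm_scalars (MPlus a (MMinus b)) \<subseteq> carrier A.R" using sc by simp
    fix s :: "nat \<Rightarrow> 'm" and u and s' :: "nat \<Rightarrow> 'n" and u'
    assume s: "\<And>i. s i \<in> carrier F" "\<And>i. s' i \<in> carrier G"
      and ag: "agree A.VS B.VS {CF_Eq (CVar 1) CInf} (A.env (\<lambda>_. MPlus a (MMinus b)) s u) (B.env (\<lambda>_. MPlus a (MMinus b)) s' u')"
    have 1: "v (mterm_eval F s a \<ominus>\<^bsub>F\<^esub> mterm_eval F s b) = infty \<Delta> \<longleftrightarrow>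
        w (mterm_eval G s' a \<ominus>\<^bsub>G\<^esub> mterm_eval G s' b) = infty \<Gamma>"
      using ag by (simp add: agree_def A.env_def B.env_def A.M.minus_eq B.M.minus_eq)
    have c: "mterm_eval F s a \<in> carrier F" "mterm_eval F s b \<in> carrier F"
      "mterm_eval G s' a \<in> carrier G" "mterm_eval G s' b \<in> carrier G" using s sc by simp_all
    show "lform_sat A.LS s u (LF_MEq a b) \<longleftrightarrow> lform_sat B.LS s' u' (LF_MEq a b)"
      using 1 c A.val_inf_iff[of "mterm_eval F s a \<ominus>\<^bsub>F\<^esub> mterm_eval F s b"]
        B.val_inf_iff[of "mterm_eval G s' a \<ominus>\<^bsub>G\<^esub> mterm_eval G s' b"]
        A.M.eq_iff_diff_zero[OF c(1,2)] B.M.eq_iff_diff_zero[OF c(3,4)] by simp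
  qed simp
  then show ?case by blast
next
  case (LF_VEq a b)
  let ?\<sigma> = "\<lambda>n::nat. if n = 0 then vt_base a else vt_base b"
  have e: "vterm_eval A.LS s u a = cterm_eval A.VS (A.env ?\<sigma> s u) (vt_cterm 0 a)"
    "vterm_eval A.LS s u b = cterm_eval A.VS (A.env ?\<sigma> s u) (vt_cterm 1 b)" for s u
    by (rule A.vterm_env, simp)+
  have e': "vterm_eval B.LS s u a = cterm_eval B.VS (B.env ?\<sigma> s u) (vt_cterm 0 a)"
    "vterm_eval B.LS s u b = cterm_eval B.VS (B.env ?\<sigma> s u) (vt_cterm 1 b)" for s u
    by (rule B.vterm_env, simp)+
  show ?case
    by (rule determines_vterms[of a b "CF_Eq (vt_cterm 0 a) (vt_cterm 1 b)"])
      (use LF_VEq in \<open>simp_all only: lform_sat.simps cform_sat.simps e e' lform.set Un_subset_iff simp_thms\<close>)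
next
  case (LF_Less a b)
  let ?\<sigma> = "\<lambda>n::nat. if n = 0 then vt_base a else vt_base b"
  have e: "vterm_eval A.LS s u a = cterm_eval A.VS (A.env ?\<sigma> s u) (vt_cterm 0 a)"
    "vterm_eval A.LS s u b = cterm_eval A.VS (A.env ?\<sigma> s u) (vt_cterm 1 b)" for s u
    by (rule A.vterm_env, simp)+
  have e': "vterm_eval B.LS s u a = cterm_eval B.VS (B.env ?\<sigma> s u) (vt_cterm 0 a)"
    "vterm_eval B.LS s u b = cterm_eval B.VS (B.env ?\<sigma> s u) (vt_cterm 1 b)" for s u
    by (rule B.vterm_env, simp)+
  show ?case
    by (rule determines_vterms[of a b "CF_Less (vt_cterm 0 a) (vt_cterm 1 b)"])
      (use LF_Less in \<open>simp_all only: lform_sat.simps cform_sat.simps e e' lform.set Un_subset_iff simp_thms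
        A.LS_simps B.LS_simps\<close>)
next
  case (LF_R n a)
  let ?\<sigma> = "\<lambda>n::nat. if n = 0 then vt_base a else vt_base a"
  have e: "vterm_eval A.LS s u a = cterm_eval A.VS (A.env ?\<sigma> s u) (vt_cterm 0 a)" for s u
    by (rule A.vterm_env) simp
  have e': "vterm_eval B.LS s u a = cterm_eval B.VS (B.env ?\<sigma> s u) (vt_cterm 0 a)" for s u
    by (rule B.vterm_env) simp
  show ?case
    by (rule determines_vterms[of a a "CF_R n (vt_cterm 0 a)"])
      (use LF_R in \<open>simp_all only: lform_sat.simps cform_sat.simps e e' lform.set A.LS_simps B.LS_simps\<close>)
next
  case (LF_Not f)
  then obtain \<sigma> \<Psi> where d: "determines \<sigma> \<Psi> f" by auto
  have "determines \<sigma> \<Psi> (LF_Not f)"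
    using d unfolding determines_def lform_sat.simps by blast
  then show ?case by blast
next
  case (LF_And f g)
  then obtain \<sigma> \<Psi> \<sigma>' \<Psi>' where d: "determines \<sigma> \<Psi> f" "determines \<sigma>' \<Psi>' g" by auto
  then show ?case by (rule determines_And)
next
  case (LF_MEx i f)
  then obtain \<sigma> \<Psi> where d: "determines \<sigma> \<Psi> f" by auto
  then show ?case by (rule determines_MEx)
next
  case (LF_VEx i f)
  then obtain \<sigma> \<Psi> where d: "determines \<sigma> \<Psi> f" by auto
  then show ?case by (rule determines_VEx)
qed

text \<open>Elementary equivalence gives agreement on sentences only. From there the game is played
  for all free variables with the move \<infinity>; adding the formulas
  \<open>CF_Eq (CVar i) CInf\<close> to the target forces every reply to be \<infinity> too.\<close>

lemma agree_infinity:
  assumes eq: "val_elem_equiv A.VS B.VS" and fin: "finite \<Psi>"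
  shows "agree A.VS B.VS \<Psi> (\<lambda>_. infty \<Delta>) (\<lambda>_. infty \<Gamma>)"
proof -
  let ?S = "\<Union>\<psi>\<in>\<Psi>. cform_free \<psi>"
  have fS: "finite ?S" using fin finite_cform_free by blast
  obtain vars where vars: "set vars = ?S" "distinct vars" using finite_distinct_list[OF fS] by blast
  obtain l where l: "set l = \<Psi> \<union> (\<lambda>i. CF_Eq (CVar i) CInf) ` ?S"
    using finite_list[of "\<Psi> \<union> (\<lambda>i. CF_Eq (CVar i) CInf) ` ?S"] fin fS by auto
  have "(\<Union>\<psi>\<in>set l. cform_free \<psi>) = ?S" unfolding l by auto
  then have closed: "cform_free \<psi> = {}" if "\<psi> \<in> set (gsteps vars l)" for \<psi>
    using gsteps_free[OF that] vars(1) by auto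
  have "agree A.VS B.VS (set (gsteps vars l)) (\<lambda>_. infty \<Delta>) (\<lambda>_. infty \<Gamma>)"
    unfolding agree_def
  proof
    fix \<psi> assume p: "\<psi> \<in> set (gsteps vars l)"
    show "cform_sat A.VS (\<lambda>_. infty \<Delta>) \<psi> \<longleftrightarrow> cform_sat B.VS (\<lambda>_. infty \<Gamma>) \<psi>"
      using eq closed[OF p] val_models_closed[of \<psi> "\<lambda>_. infty \<Delta>" A.VS] val_models_closed[of \<psi> "\<lambda>_. infty \<Gamma>" B.VS]
      by (simp add: val_elem_equiv_def A.infty_closed B.infty_closed)
  qed
  then obtain f' where ag: "agree A.VS B.VS (set l) (override_on (\<lambda>_. infty \<Delta>) (\<lambda>_. infty \<Delta>) ?S)
      (override_on (\<lambda>_. infty \<Gamma>) f' ?S)"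
    using gsteps_agree[OF vars(2), where f = "\<lambda>_. infty \<Delta>"] A.infty_closed unfolding vars(1) by fastforce
  have c: "override_on (\<lambda>_. infty \<Delta>) (\<lambda>_. infty \<Delta>) ?S = (\<lambda>_. infty \<Delta>)" by (auto simp: override_on_def)
  have "f' i = infty \<Gamma>" if "i \<in> ?S" for i
  proof -
    have "CF_Eq (CVar i) CInf \<in> set l" using that unfolding l by blast
    from agreeD[OF ag this] that show ?thesis by (simp add: override_on_def)
  qed
  then have "override_on (\<lambda>_. infty \<Gamma>) f' ?S = (\<lambda>_. infty \<Gamma>)" by (auto simp: override_on_def)
  then show ?thesis using agree_mono[OF ag, of \<Psi>] c l by simp
qed

lemma l_models_closed_A:
  "lform_mfree f = {} \<Longrightarrow> lform_vfree f = {} \<Longrightarrow>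
    l_models A.LS f \<longleftrightarrow> lform_sat A.LS (\<lambda>_. \<zero>\<^bsub>F\<^esub>) (\<lambda>_. infty \<Delta>) f"
  using lform_sat_cong[of f _ "\<lambda>_. \<zero>\<^bsub>F\<^esub>" _ "\<lambda>_. infty \<Delta>" A.LS] A.infty_closed
  unfolding l_models_def by auto

lemma l_models_closed_B:
  "lform_mfree f = {} \<Longrightarrow> lform_vfree f = {} \<Longrightarrow>
    l_models B.LS f \<longleftrightarrow> lform_sat B.LS (\<lambda>_. \<zero>\<^bsub>G\<^esub>) (\<lambda>_. infty \<Gamma>) f"
  using lform_sat_cong[of f _ "\<lambda>_. \<zero>\<^bsub>G\<^esub>" _ "\<lambda>_. infty \<Gamma>" B.LS] B.infty_closed
  unfolding l_models_def by auto

text \<open>A sentence may be evaluated at the assignments 0 and \<infinity>. There all module terms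
  vanish and the environment is constantly \<infinity>, where \<open>agree_infinity\<close>
  applies.\<close>

lemma elem_equiv:
  assumes eq: "val_elem_equiv A.VS B.VS"
  shows "l_elem_equiv A.R A.LS B.LS"
  unfolding l_elem_equiv_def
proof (intro allI impI)
  fix f assume f: "l_sentence A.R f"
  then have "lform_scalars f \<subseteq> carrier A.R" by (simp add: l_sentence_def)
  then obtain \<sigma> \<Psi> where d: "determines \<sigma> \<Psi> f" using determines_exists by blast
  have "mterm_scalars (\<sigma> n) \<subseteq> carrier A.R" for n using d by (simp add: determines_def)
  then have "A.env \<sigma> (\<lambda>_. \<zero>\<^bsub>F\<^esub>) (\<lambda>_. infty \<Delta>) = (\<lambda>_. infty \<Delta>)"
    "B.env \<sigma> (\<lambda>_. \<zero>\<^bsub>G\<^esub>) (\<lambda>_. infty \<Gamma>) = (\<lambda>_. infty \<Gamma>)"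
    by (auto simp: A.env_def B.env_def A.mterm_eval_zero B.mterm_eval_zero)
  then have "lform_sat A.LS (\<lambda>_. \<zero>\<^bsub>F\<^esub>) (\<lambda>_. infty \<Delta>) f \<longleftrightarrow> lform_sat B.LS (\<lambda>_. \<zero>\<^bsub>G\<^esub>) (\<lambda>_. infty \<Gamma>) f"
    using agree_infinity[OF eq, of \<Psi>] d A.infty_closed B.infty_closed
    by (intro determinesD[OF d]) (simp_all add: determines_def)
  then show "l_models A.LS f \<longleftrightarrow> l_models B.LS f"
    using l_models_closed_A l_models_closed_B f by (simp add: l_sentence_def)
qed

end

theorem mainTheorem2:
  fixes K :: "'k ring" and \<phi> :: "'k \<Rightarrow> 'k"
    and F :: "(nat \<Rightarrow> 'k, 'm) rmodule" and \<Delta> :: "'d chain" and v :: "'m \<Rightarrow> 'd"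
    and G :: "(nat \<Rightarrow> 'k, 'n) rmodule" and \<Gamma> :: "'e chain" and w :: "'n \<Rightarrow> 'e"
  defines "R \<equiv> skew_poly K \<phi>"
  assumes "field K" and "\<phi> \<in> ring_hom K K"
    and "henselian_valued_module K \<phi> F \<Delta> v" and "divisible R F" and "carrier F \<noteq> {\<zero>\<^bsub>F\<^esub>}"
    and "henselian_valued_module K \<phi> G \<Gamma> w" and "divisible R G" and "carrier G \<noteq> {\<zero>\<^bsub>G\<^esub>}"
    and "mod_elem_equiv R (torsion R F) (torsion R G)"
    and "val_elem_equiv (value_set F \<Delta> v) (value_set G \<Gamma> w)"
  shows "l_elem_equiv R (l_structure F \<Delta> v) (l_structure G \<Gamma> w)"
proof -
  have sf: "skew_field K \<phi>" using assms(2,3) by (intro skew_field.intro skew_field_axioms.intro)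
  interpret A: vmod K \<phi> F \<Delta> v
    using assms(5) unfolding R_def by (intro vmod.intro vmod_axioms.intro sf assms(4))
  interpret B: vmod K \<phi> G \<Gamma> w
    using assms(8) unfolding R_def by (intro vmod.intro vmod_axioms.intro sf assms(7))
  interpret vmod_pair K \<phi> F \<Delta> v G \<Gamma> w
  proof
    fix r g n assume rg: "r \<in> carrier (skew_poly K \<phi>)" "r \<noteq> \<zero>\<^bsub>skew_poly K \<phi>\<^esub>" "g \<in> carrier (skew_poly K \<phi>)"
    \<comment> \<open>Both sides are expressed by the same sentence about the torsion
      submodules.\<close>
    show "A.M.sep n (A.Pset r) (A.Pset g) \<longleftrightarrow> B.M.sep n (B.Pset r) (B.Pset g)"
      using A.models_index_sentence[OF rg] B.models_index_sentence[OF rg]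
        index_sentence_closed[OF rg(1,3)] assms(10) unfolding R_def mod_elem_equiv_def by blast
  next
    have "cform_free A.mid_sentence = {}" by (auto simp: A.mid_sentence_def)
    then show "(\<exists>\<gamma>\<in>carrier \<Delta>. A.mid \<gamma>) \<longleftrightarrow> (\<exists>\<gamma>\<in>carrier \<Gamma>. B.mid \<gamma>)"
      using A.models_mid_sentence B.models_mid_sentence assms(11) unfolding val_elem_equiv_def by blast
  qed
  interpret vmod_pair_plain K \<phi> F \<Delta> v G \<Gamma> w ..
  show ?thesis using elem_equiv assms(11) unfolding R_def by blast
qed

end
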